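(* Let $A\subset C$ and $B\subset D$ be unital inclusions of unital $C^*$-algebras which are strongly Morita equivalent with respect to a $C-D$-equivalence bimodule $Y$ and its closed subspace $X$. Let $E^A:C\to A$ and $E^B:D\to B$ be conditional expectations of Watatani index-finite type with $\mathrm{Ind}_W(E^A)\in A$ and $\mathrm{Ind}_W(E^B)\in B$, and let $E^X$ be a conditional expectation from $Y$ onto $X$ with respect to $E^A$ and $E^B$. Let $p\in C$ and $q\in D$ be full projections with $E^A(p)=\mathrm{Ind}_W(E^A)^{-1}$ and $E^B(q)=\mathrm{Ind}_W(E^B)^{-1}$. Let $P=\{p\}'\cap A$, $Q=\{q\}'\cap B$, $E^P(a)=\mathrm{Ind}_W(E^A)E^A(pap)$ $(a\in A)$, $E^Q(b)=\mathrm{Ind}_W(E^B)E^B(qbq)$ $(b\in B)$, let $Z=\{x\in X\mid p\cdot x=x\cdot q\}$ be the downward basic construction of $X$ for $E^X$ and $E^Z(x)=\mathrm{Ind}_W(E^A)\cdot E^X(p\cdot x\cdot q)$ $(x\in X)$ the pre-dual conditional expectation of $E^X$. Then $Y$ can be regarded as the upward basic construction for $E^Z$ and $E^X$ can be regarded as the dual conditional expectation of $E^Z$. That is, identifying $C$ and $D$ with the $C^*$-basic constructions for $E^P$ and $E^Q$ with Jones projections $p$ and $q$, there is a $C-D$-equivalence bimodule isomorphism $\theta$ of $Y$ onto the upward basic construction $A\otimes_P Z\otimes_Q\widetilde B$ for $E^Z$ such that $E^X=F\circ\theta$, where $F(a\otimes z\otimes\widetilde b)=\mathrm{Ind}_W(E^P)^{-1}a\cdot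 z\cdot b^*$ is the dual conditional expectation of $E^Z$.
   Context: Equivalence bimodules are imprimitivity bimodules; actions are written $c\cdot y$, $y\cdot d$; ${}_C\langle\ ,\ \rangle$ (linear in the first variable) and $\langle\ ,\ \rangle_D$ (linear in the second variable) are the inner products. An equivalence bimodule isomorphism is a bijective bimodule map preserving both inner products. For sets, $\langle U,V\rangle$ means the linear span of the inner products. A projection $p\in C$ is full if $CpC=C$ (linear span). Strong Morita equivalence of inclusions: unital inclusions $A\subset C$, $B\subset D$ are strongly Morita equivalent with respect to a $C-D$-equivalence bimodule $Y$ and its closed subspace $X$ if (1) $a\cdot x\in X$ and ${}_C\langle x,y\rangle\in A$ for $a\in A$, $x,y\in X$, and $\overline{{}_C\langle X,X\rangle}=A$, $\overline{{}_C\langle Y,X\rangle}=C$; (2) $x\cdot b\in X$ and $\langle x,y\rangle_D\in B$ for $b\in B$, $x,y\in X$, and $\overline{\langle X,X\rangle_D}=B$, $\overline{\langle Y,X\rangle_D}=D$. Then $X$ is an $A-B$-equivalence bimodule. A linear map $E^X$ from $Y$ onto $X$ is a conditional expectation with respect to $E^A$ and $E^B$ if, for all $a\in A,b\in B,c\in C,d\in D,x\in X,y\in Y$: $E^X(c\cdot x)=E^A(c)\cdot x$; $E^X(a\cdot y)=a\cdot E^X(y)$; $E^A({}_C\langle y,x\rangle)={}_C\langle E^X(y),x\rangle$; $E^X(x\cdot d)=x\cdot E^B(d)$; $E^X(y\cdot b)=E^X(y)\cdot b$; $E^B(\langle y,x\rangle_D)=\langle E^X(y),x\rangle_D$. $E^A$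 is of Watatani index-finite type if it has a quasi-basis: a finite family $\{(u_i,u_i^* )\}$ with $u_i\in C$ and $\sum_i u_iE^A(u_i^*c)=c=\sum_i E^A(cu_i)u_i^*$ for all $c\in C$; then $\mathrm{Ind}_W(E^A)=\sum_i u_iu_i^*\in C\cap C'$, positive and invertible. Known facts under these hypotheses (Osaka–Kodaka–Teruya): $E^P:A\to P$ and $E^Q:B\to Q$ are conditional expectations of Watatani index-finite type, $\mathrm{Ind}_W(E^P)=\mathrm{Ind}_W(E^A)\in P\cap C'$, $\mathrm{Ind}_W(E^Q)=\mathrm{Ind}_W(E^B)\in Q\cap D'$, $ApA=C$, $BqB=D$, and $C$, $D$ can be regarded as the $C^*$-basic constructions for $E^P$, $E^Q$ with Jones projections $p$, $q$. Also $P\subset A$, $Q\subset B$ are strongly Morita equivalent with respect to $X$ and $Z$, and $E^Z$ is a conditional expectation from $X$ onto $Z$ with respect to $E^P$ and $E^Q$. Upward basic construction for $E^Z$: $A$ is a $C-P$-equivalence bimodule via ${}_C\langle x,y\rangle=xpy^*$, $\langle x,y\rangle_P=E^P(x^*y)$, $(xpy)\cdot z=xE^P(yz)$, $x\cdot r=xr$ ($x,y,z\in A$, $r\in P$); likewise $B$ is a $D-Q$-equivalence bimodule, and $\widetilde B=\{\widetilde b:b\in B\}$ is its dual $Q-D$-equivalence bimodule. The upward basic construction is the $C-D$-equivalence bimodule $A\otimes_P Z\otimes_Q\widetilde B$; $X$ is embedded in it by $x\mapsto\sum_{i,j}s_i\otimes E^Z(s_i^*\cdot x\cdot t_j)\otimes\widetilde{t_j}$,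 with $\{(s_i,s_i^* )\}$, $\{(t_j,t_j^* )\}$ quasi-bases for $E^P$, $E^Q$. *)

theory Defs
  imports "HOL-Analysis.Analysis"
begin

section \<open>Unital C*-algebras\<close>

class scaleC = scaleR +
  fixes scaleC :: "complex \<Rightarrow> 'a \<Rightarrow> 'a" (infixr "*\<^sub>C" 75)
  assumes scaleR_scaleC: "r *\<^sub>R a = complex_of_real r *\<^sub>C a"

text \<open>The class \<open>monoid_mult\<close>, rather than \<open>ring_1\<close>, provides the unit: the zero algebra is
  not excluded.\<close>

class unital_cstar_algebra = real_normed_algebra + monoid_mult + banach + scaleC +
  fixes star :: "'a \<Rightarrow> 'a"
  assumes scaleC_add_right: "c *\<^sub>C (a + b) = c *\<^sub>C a + c *\<^sub>C b"
    and scaleC_add_left: "(c + c') *\<^sub>C a = c *\<^sub>C a + c' *\<^sub>C a"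
    and scaleC_scaleC: "c *\<^sub>C (c' *\<^sub>C a) = (c * c') *\<^sub>C a"
    and scaleC_one: "1 *\<^sub>C a = a"
    and mult_scaleC_left: "(c *\<^sub>C a) * b = c *\<^sub>C (a * b)"
    and mult_scaleC_right: "a * (c *\<^sub>C b) = c *\<^sub>C (a * b)"
    and norm_scaleC: "norm (c *\<^sub>C a) = cmod c * norm a"
    and star_star: "star (star a) = a"
    and star_add: "star (a + b) = star a + star b"
    and star_scaleC: "star (c *\<^sub>C a) = cnj c *\<^sub>C star a"
    and star_mult: "star (a * b) = star b * star a"
    and cstar_identity: "norm (star a * a) = (norm a)\<^sup>2"

definition cspan :: "'c::unital_cstar_algebra set \<Rightarrow> 'c set" where
  "cspan = module.span scaleC"

definition cpositive :: "'c::unital_cstar_algebra \<Rightarrow> bool" where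
  "cpositive a \<longleftrightarrow> (\<exists>b. a = star b * b)"

definition cinverse :: "'c::unital_cstar_algebra \<Rightarrow> 'c" where
  "cinverse a = (THE b. a * b = 1 \<and> b * a = 1)"

text \<open>\<open>A\<close> is a C*-subalgebra of the ambient algebra containing its unit.\<close>

definition unital_cstar_subalgebra :: "'c::unital_cstar_algebra set \<Rightarrow> bool" where
  "unital_cstar_subalgebra A \<longleftrightarrow>
     closed A \<and> 1 \<in> A \<and>
     (\<forall>a\<in>A. \<forall>b\<in>A. a + b \<in> A \<and> a * b \<in> A) \<and>
     (\<forall>a\<in>A. star a \<in> A \<and> (\<forall>c. c *\<^sub>C a \<in> A))"

definition full_projection :: "'c::unital_cstar_algebra \<Rightarrow> bool" where
  "full_projection p \<longleftrightarrow>
     star p = p \<and> p * p = p \<and> cspan {c * p * c' | c c'. True} = UNIV"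


section \<open>Conditional expectations of Watatani index-finite type\<close>

text \<open>A conditional expectation is a projection of norm one; by Tomiyama's theorem the
  positivity and bimodule conditions are then automatic.\<close>

definition conditional_expectation ::
  "'c::unital_cstar_algebra set \<Rightarrow> ('c \<Rightarrow> 'c) \<Rightarrow> bool" where
  "conditional_expectation A E \<longleftrightarrow>
     (\<forall>c c'. E (c + c') = E c + E c') \<and> (\<forall>k c. E (k *\<^sub>C c) = k *\<^sub>C E c) \<and>
     (\<forall>c. E c \<in> A) \<and> (\<forall>a\<in>A. E a = a) \<and>
     (\<forall>c. norm (E c) \<le> norm c) \<and>
     (\<forall>c. cpositive c \<longrightarrow> cpositive (E c)) \<and>
     (\<forall>a\<in>A. \<forall>c. E (a * c) = a * E c \<and> E (c * a) = E c * a)"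

text \<open>The list \<open>us\<close> encodes the family of pairs \<open>(u, star u)\<close>. The first argument is the
  domain of \<open>E\<close>, which is a subalgebra of the ambient type.\<close>

definition quasi_basis ::
  "'c::unital_cstar_algebra set \<Rightarrow> ('c \<Rightarrow> 'c) \<Rightarrow> 'c list \<Rightarrow> bool" where
  "quasi_basis N E us \<longleftrightarrow>
     set us \<subseteq> N \<and>
     (\<forall>c\<in>N. (\<Sum>u\<leftarrow>us. u * E (star u * c)) = c \<and> (\<Sum>u\<leftarrow>us. E (c * u) * star u) = c)"

definition index_finite :: "'c::unital_cstar_algebra set \<Rightarrow> ('c \<Rightarrow> 'c) \<Rightarrow> bool" where
  "index_finite N E \<longleftrightarrow> (\<exists>us. quasi_basis N E us)"

text \<open>The value does not depend on the quasi-basis.\<close>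

definition Ind_W :: "'c::unital_cstar_algebra set \<Rightarrow> ('c \<Rightarrow> 'c) \<Rightarrow> 'c" where
  "Ind_W N E = (THE k. \<exists>us. quasi_basis N E us \<and> k = (\<Sum>u\<leftarrow>us. u * star u))"


section \<open>Equivalence bimodules\<close>

text \<open>\<open>lip\<close> is the left inner product, linear in the first variable; \<open>rip\<close> is the right
  one, linear in the second variable.\<close>

record ('c, 'm, 'd) bimodule =
  bcarrier :: "'m set"
  bzero :: 'm
  badd :: "'m \<Rightarrow> 'm \<Rightarrow> 'm"
  bscale :: "complex \<Rightarrow> 'm \<Rightarrow> 'm"
  lact :: "'c \<Rightarrow> 'm \<Rightarrow> 'm"
  ract :: "'m \<Rightarrow> 'd \<Rightarrow> 'm"
  lip :: "'m \<Rightarrow> 'm \<Rightarrow> 'c"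
  rip :: "'m \<Rightarrow> 'm \<Rightarrow> 'd"

definition bdiff :: "('c, 'm, 'd) bimodule \<Rightarrow> 'm \<Rightarrow> 'm \<Rightarrow> 'm" where
  "bdiff M x y = badd M x (bscale M (- 1) y)"

definition bsum :: "('c, 'm, 'd) bimodule \<Rightarrow> 'm list \<Rightarrow> 'm" where
  "bsum M xs = foldr (badd M) xs (bzero M)"

definition rnorm :: "('c, 'm, 'd::unital_cstar_algebra) bimodule \<Rightarrow> 'm \<Rightarrow> real" where
  "rnorm M x = sqrt (norm (rip M x x))"

definition lnorm :: "('c::unital_cstar_algebra, 'm, 'd) bimodule \<Rightarrow> 'm \<Rightarrow> real" where
  "lnorm M x = sqrt (norm (lip M x x))"

definition complete_for ::
  "('m \<Rightarrow> real) \<Rightarrow> ('c, 'm, 'd) bimodule \<Rightarrow> bool" where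
  "complete_for nrm M \<longleftrightarrow>
     (\<forall>s :: nat \<Rightarrow> 'm.
        (\<forall>k. s k \<in> bcarrier M) \<and>
        (\<forall>e>0. \<exists>K. \<forall>i\<ge>K. \<forall>j\<ge>K. nrm (bdiff M (s i) (s j)) < e) \<longrightarrow>
        (\<exists>x\<in>bcarrier M. (\<lambda>k. nrm (bdiff M (s k) x)) \<longlonglongrightarrow> 0))"

locale equivalence_bimodule =
  fixes M :: "('c::unital_cstar_algebra, 'm, 'd::unital_cstar_algebra) bimodule"
  assumes zero_closed: "bzero M \<in> bcarrier M"
    and add_closed: "\<lbrakk>x \<in> bcarrier M; y \<in> bcarrier M\<rbrakk> \<Longrightarrow> badd M x y \<in> bcarrier M"
    and scale_closed: "x \<in> bcarrier M \<Longrightarrow> bscale M k x \<in> bcarrier M"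
    and lact_closed: "x \<in> bcarrier M \<Longrightarrow> lact M c x \<in> bcarrier M"
    and ract_closed: "x \<in> bcarrier M \<Longrightarrow> ract M x d \<in> bcarrier M"
    and add_assoc: "\<lbrakk>x \<in> bcarrier M; y \<in> bcarrier M; z \<in> bcarrier M\<rbrakk>
      \<Longrightarrow> badd M (badd M x y) z = badd M x (badd M y z)"
    and add_commute: "\<lbrakk>x \<in> bcarrier M; y \<in> bcarrier M\<rbrakk> \<Longrightarrow> badd M x y = badd M y x"
    and add_zero: "x \<in> bcarrier M \<Longrightarrow> badd M x (bzero M) = x"
    and add_uminus: "x \<in> bcarrier M \<Longrightarrow> bdiff M x x = bzero M"
    and scale_add_right: "\<lbrakk>x \<in> bcarrier M; y \<in> bcarrier M\<rbrakk>
      \<Longrightarrow> bscale M k (badd M x y) = badd M (bscale M k x) (bscale M k y)"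
    and scale_add_left: "x \<in> bcarrier M
      \<Longrightarrow> bscale M (k + l) x = badd M (bscale M k x) (bscale M l x)"
    and scale_scale: "x \<in> bcarrier M \<Longrightarrow> bscale M k (bscale M l x) = bscale M (k * l) x"
    and scale_one: "x \<in> bcarrier M \<Longrightarrow> bscale M 1 x = x"
    and lact_add_right: "\<lbrakk>x \<in> bcarrier M; y \<in> bcarrier M\<rbrakk>
      \<Longrightarrow> lact M c (badd M x y) = badd M (lact M c x) (lact M c y)"
    and lact_add_left: "x \<in> bcarrier M
      \<Longrightarrow> lact M (c + c') x = badd M (lact M c x) (lact M c' x)"
    and lact_scale_right: "x \<in> bcarrier M
      \<Longrightarrow> lact M c (bscale M k x) = bscale M k (lact M c x)"
    and lact_scale_left: "x \<in> bcarrier M \<Longrightarrow> lact M (k *\<^sub>C c) x = bscale M k (lact M c x)"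
    and lact_mult: "x \<in> bcarrier M \<Longrightarrow> lact M (c * c') x = lact M c (lact M c' x)"
    and lact_one: "x \<in> bcarrier M \<Longrightarrow> lact M 1 x = x"
    and ract_add_left: "\<lbrakk>x \<in> bcarrier M; y \<in> bcarrier M\<rbrakk>
      \<Longrightarrow> ract M (badd M x y) d = badd M (ract M x d) (ract M y d)"
    and ract_add_right: "x \<in> bcarrier M
      \<Longrightarrow> ract M x (d + d') = badd M (ract M x d) (ract M x d')"
    and ract_scale_left: "x \<in> bcarrier M
      \<Longrightarrow> ract M (bscale M k x) d = bscale M k (ract M x d)"
    and ract_scale_right: "x \<in> bcarrier M \<Longrightarrow> ract M x (k *\<^sub>C d) = bscale M k (ract M x d)"
    and ract_mult: "x \<in> bcarrier M \<Longrightarrow> ract M x (d * d') = ract M (ract M x d) d'"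
    and ract_one: "x \<in> bcarrier M \<Longrightarrow> ract M x 1 = x"
    and lact_ract: "x \<in> bcarrier M \<Longrightarrow> ract M (lact M c x) d = lact M c (ract M x d)"
    and lip_add: "\<lbrakk>x \<in> bcarrier M; y \<in> bcarrier M; z \<in> bcarrier M\<rbrakk>
      \<Longrightarrow> lip M (badd M x y) z = lip M x z + lip M y z"
    and lip_scale: "\<lbrakk>x \<in> bcarrier M; y \<in> bcarrier M\<rbrakk>
      \<Longrightarrow> lip M (bscale M k x) y = k *\<^sub>C lip M x y"
    and lip_lact: "\<lbrakk>x \<in> bcarrier M; y \<in> bcarrier M\<rbrakk> \<Longrightarrow> lip M (lact M c x) y = c * lip M x y"
    and lip_star: "\<lbrakk>x \<in> bcarrier M; y \<in> bcarrier M\<rbrakk> \<Longrightarrow> star (lip M x y) = lip M y x"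
    and lip_positive: "x \<in> bcarrier M \<Longrightarrow> cpositive (lip M x x)"
    and lip_definite: "\<lbrakk>x \<in> bcarrier M; lip M x x = 0\<rbrakk> \<Longrightarrow> x = bzero M"
    and rip_add: "\<lbrakk>x \<in> bcarrier M; y \<in> bcarrier M; z \<in> bcarrier M\<rbrakk>
      \<Longrightarrow> rip M x (badd M y z) = rip M x y + rip M x z"
    and rip_scale: "\<lbrakk>x \<in> bcarrier M; y \<in> bcarrier M\<rbrakk>
      \<Longrightarrow> rip M x (bscale M k y) = k *\<^sub>C rip M x y"
    and rip_ract: "\<lbrakk>x \<in> bcarrier M; y \<in> bcarrier M\<rbrakk> \<Longrightarrow> rip M x (ract M y d) = rip M x y * d"
    and rip_star: "\<lbrakk>x \<in> bcarrier M; y \<in> bcarrier M\<rbrakk> \<Longrightarrow> star (rip M x y) = rip M y x"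
    and rip_positive: "x \<in> bcarrier M \<Longrightarrow> cpositive (rip M x x)"
    and rip_definite: "\<lbrakk>x \<in> bcarrier M; rip M x x = 0\<rbrakk> \<Longrightarrow> x = bzero M"
    and lip_ract: "\<lbrakk>x \<in> bcarrier M; y \<in> bcarrier M\<rbrakk>
      \<Longrightarrow> lip M (ract M x d) y = lip M x (ract M y (star d))"
    and rip_lact: "\<lbrakk>x \<in> bcarrier M; y \<in> bcarrier M\<rbrakk>
      \<Longrightarrow> rip M (lact M c x) y = rip M x (lact M (star c) y)"
    and compatible: "\<lbrakk>x \<in> bcarrier M; y \<in> bcarrier M; z \<in> bcarrier M\<rbrakk>
      \<Longrightarrow> lact M (lip M x y) z = ract M x (rip M y z)"
    and lip_full:
      "closure (cspan {lip M x y | x y. x \<in> bcarrier M \<and> y \<in> bcarrier M}) = UNIV"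
    and rip_full:
      "closure (cspan {rip M x y | x y. x \<in> bcarrier M \<and> y \<in> bcarrier M}) = UNIV"
    and lcomplete: "complete_for (lnorm M) M"
    and rcomplete: "complete_for (rnorm M) M"

definition bimodule_isomorphism ::
  "('c::unital_cstar_algebra, 'm, 'd::unital_cstar_algebra) bimodule
   \<Rightarrow> ('c, 'n, 'd) bimodule \<Rightarrow> ('m \<Rightarrow> 'n) \<Rightarrow> bool" where
  "bimodule_isomorphism M N \<theta> \<longleftrightarrow>
     equivalence_bimodule M \<and> equivalence_bimodule N \<and>
     bij_betw \<theta> (bcarrier M) (bcarrier N) \<and>
     (\<forall>x\<in>bcarrier M. \<forall>y\<in>bcarrier M. \<theta> (badd M x y) = badd N (\<theta> x) (\<theta> y)) \<and>
     (\<forall>k. \<forall>x\<in>bcarrier M. \<theta> (bscale M k x) = bscale N k (\<theta> x)) \<and>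
     (\<forall>c. \<forall>x\<in>bcarrier M. \<theta> (lact M c x) = lact N c (\<theta> x)) \<and>
     (\<forall>d. \<forall>x\<in>bcarrier M. \<theta> (ract M x d) = ract N (\<theta> x) d) \<and>
     (\<forall>x\<in>bcarrier M. \<forall>y\<in>bcarrier M. lip N (\<theta> x) (\<theta> y) = lip M x y) \<and>
     (\<forall>x\<in>bcarrier M. \<forall>y\<in>bcarrier M. rip N (\<theta> x) (\<theta> y) = rip M x y)"

text \<open>Closedness refers to the norm \<open>rnorm\<close>, which agrees with \<open>lnorm\<close> on an equivalence
  bimodule.\<close>

definition closed_subspace ::
  "('c, 'm, 'd::unital_cstar_algebra) bimodule \<Rightarrow> 'm set \<Rightarrow> bool" where
  "closed_subspace M X \<longleftrightarrow>
     X \<subseteq> bcarrier M \<and> bzero M \<in> X \<and>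
     (\<forall>x\<in>X. \<forall>y\<in>X. badd M x y \<in> X) \<and> (\<forall>k. \<forall>x\<in>X. bscale M k x \<in> X) \<and>
     (\<forall>(s :: nat \<Rightarrow> 'm) y. (\<forall>k. s k \<in> X) \<and> y \<in> bcarrier M \<and>
        (\<lambda>k. rnorm M (bdiff M (s k) y)) \<longlonglongrightarrow> 0 \<longrightarrow> y \<in> X)"

text \<open>The inclusions are those of \<open>A\<close> and \<open>B\<close> in the algebras acting on \<open>Y\<close>, which are the
  full types \<open>'c\<close> and \<open>'d\<close>.\<close>

definition strongly_Morita_equivalent ::
  "'c::unital_cstar_algebra set \<Rightarrow> 'd::unital_cstar_algebra set
   \<Rightarrow> ('c, 'y, 'd) bimodule \<Rightarrow> 'y set \<Rightarrow> bool" where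
  "strongly_Morita_equivalent A B Y X \<longleftrightarrow>
     unital_cstar_subalgebra A \<and> unital_cstar_subalgebra B \<and>
     equivalence_bimodule Y \<and> closed_subspace Y X \<and>
     (\<forall>a\<in>A. \<forall>x\<in>X. lact Y a x \<in> X) \<and> (\<forall>x\<in>X. \<forall>y\<in>X. lip Y x y \<in> A) \<and>
     closure (cspan {lip Y x y | x y. x \<in> X \<and> y \<in> X}) = A \<and>
     closure (cspan {lip Y y x | y x. y \<in> bcarrier Y \<and> x \<in> X}) = UNIV \<and>
     (\<forall>b\<in>B. \<forall>x\<in>X. ract Y x b \<in> X) \<and> (\<forall>x\<in>X. \<forall>y\<in>X. rip Y x y \<in> B) \<and>
     closure (cspan {rip Y x y | x y. x \<in> X \<and> y \<in> X}) = B \<and>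
     closure (cspan {rip Y y x | y x. y \<in> bcarrier Y \<and> x \<in> X}) = UNIV"

definition bimodule_expectation ::
  "'c::unital_cstar_algebra set \<Rightarrow> 'd::unital_cstar_algebra set
   \<Rightarrow> ('c, 'y, 'd) bimodule \<Rightarrow> 'y set
   \<Rightarrow> ('c \<Rightarrow> 'c) \<Rightarrow> ('d \<Rightarrow> 'd) \<Rightarrow> ('y \<Rightarrow> 'y) \<Rightarrow> bool" where
  "bimodule_expectation A B Y X E\<^sub>A E\<^sub>B E\<^sub>X \<longleftrightarrow>
     E\<^sub>X ` bcarrier Y = X \<and>
     (\<forall>y\<in>bcarrier Y. \<forall>y'\<in>bcarrier Y. E\<^sub>X (badd Y y y') = badd Y (E\<^sub>X y) (E\<^sub>X y')) \<and>
     (\<forall>k. \<forall>y\<in>bcarrier Y. E\<^sub>X (bscale Y k y) = bscale Y k (E\<^sub>X y)) \<and>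
     (\<forall>c. \<forall>x\<in>X. E\<^sub>X (lact Y c x) = lact Y (E\<^sub>A c) x) \<and>
     (\<forall>a\<in>A. \<forall>y\<in>bcarrier Y. E\<^sub>X (lact Y a y) = lact Y a (E\<^sub>X y)) \<and>
     (\<forall>x\<in>X. \<forall>y\<in>bcarrier Y. E\<^sub>A (lip Y y x) = lip Y (E\<^sub>X y) x) \<and>
     (\<forall>d. \<forall>x\<in>X. E\<^sub>X (ract Y x d) = ract Y x (E\<^sub>B d)) \<and>
     (\<forall>b\<in>B. \<forall>y\<in>bcarrier Y. E\<^sub>X (ract Y y b) = ract Y (E\<^sub>X y) b) \<and>
     (\<forall>x\<in>X. \<forall>y\<in>bcarrier Y. E\<^sub>B (rip Y y x) = rip Y (E\<^sub>X y) x)"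

text \<open>The dual bimodule. An element \<open>x\<close> stands for its formal dual, so the vector space
  structure is the conjugate one and the two actions are swapped through the involutions.\<close>

definition dual_bimodule ::
  "('c::unital_cstar_algebra, 'm, 'd::unital_cstar_algebra) bimodule
   \<Rightarrow> ('d, 'm, 'c) bimodule" where
  "dual_bimodule M =
     \<lparr> bcarrier = bcarrier M, bzero = bzero M, badd = badd M,
       bscale = (\<lambda>k x. bscale M (cnj k) x),
       lact = (\<lambda>d x. ract M x (star d)), ract = (\<lambda>x c. lact M (star c) x),
       lip = rip M, rip = lip M \<rparr>"


section \<open>Tensor products of equivalence bimodules\<close>

text \<open>The (interior) tensor product of \<open>M\<close> and \<open>N\<close> over the algebra in the middle is the
  Hausdorff completion of the algebraic tensor product in the norm of the inner product.
  A list \<open>[(m1, n1), (m2, n2), \<dots>]\<close> stands for the formal sum of the elementary tensors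
  \<open>mi \<otimes> ni\<close>; scalars are absorbed in the first factor. The relations of the algebraic
  balanced tensor product need not be imposed separately because all of them are null vectors
  of the inner product.\<close>

definition pre_lip ::
  "('c::unital_cstar_algebra, 'm, 'k) bimodule \<Rightarrow> ('k, 'n, 'd) bimodule
   \<Rightarrow> ('m \<times> 'n) list \<Rightarrow> ('m \<times> 'n) list \<Rightarrow> 'c" where
  "pre_lip M N v w =
     (\<Sum>(m, n)\<leftarrow>v. \<Sum>(m', n')\<leftarrow>w. lip M (ract M m (lip N n n')) m')"

definition pre_rip ::
  "('c, 'm, 'k) bimodule \<Rightarrow> ('k, 'n, 'd::unital_cstar_algebra) bimodule
   \<Rightarrow> ('m \<times> 'n) list \<Rightarrow> ('m \<times> 'n) list \<Rightarrow> 'd" where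
  "pre_rip M N v w =
     (\<Sum>(m, n)\<leftarrow>v. \<Sum>(m', n')\<leftarrow>w. rip N n (lact N (rip M m m') n'))"

definition pre_scale ::
  "('c, 'm, 'k) bimodule \<Rightarrow> complex \<Rightarrow> ('m \<times> 'n) list \<Rightarrow> ('m \<times> 'n) list" where
  "pre_scale M k v = map (\<lambda>(m, n). (bscale M k m, n)) v"

definition pre_dist ::
  "('c, 'm, 'k) bimodule \<Rightarrow> ('k, 'n, 'd::unital_cstar_algebra) bimodule
   \<Rightarrow> ('m \<times> 'n) list \<Rightarrow> ('m \<times> 'n) list \<Rightarrow> real" where
  "pre_dist M N v w =
     (let u = v @ pre_scale M (- 1) w in sqrt (norm (pre_rip M N u u)))"

definition pre_Cauchy ::
  "('c, 'm, 'k) bimodule \<Rightarrow> ('k, 'n, 'd::unital_cstar_algebra) bimodule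
   \<Rightarrow> (nat \<Rightarrow> ('m \<times> 'n) list) set" where
  "pre_Cauchy M N =
     {s. (\<forall>k. set (s k) \<subseteq> bcarrier M \<times> bcarrier N) \<and>
         (\<forall>e>0. \<exists>K. \<forall>i\<ge>K. \<forall>j\<ge>K. pre_dist M N (s i) (s j) < e)}"

definition tensor_class ::
  "('c, 'm, 'k) bimodule \<Rightarrow> ('k, 'n, 'd::unital_cstar_algebra) bimodule
   \<Rightarrow> (nat \<Rightarrow> ('m \<times> 'n) list) \<Rightarrow> (nat \<Rightarrow> ('m \<times> 'n) list) set" where
  "tensor_class M N s =
     {t \<in> pre_Cauchy M N. (\<lambda>k. pre_dist M N (s k) (t k)) \<longlonglongrightarrow> 0}"

definition class_rep :: "'a set \<Rightarrow> 'a" where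
  "class_rep \<xi> = (SOME s. s \<in> \<xi>)"

definition bimodule_tensor ::
  "('c::unital_cstar_algebra, 'm, 'k) bimodule
   \<Rightarrow> ('k, 'n, 'd::unital_cstar_algebra) bimodule
   \<Rightarrow> ('c, (nat \<Rightarrow> ('m \<times> 'n) list) set, 'd) bimodule" where
  "bimodule_tensor M N =
     \<lparr> bcarrier = tensor_class M N ` pre_Cauchy M N,
       bzero = tensor_class M N (\<lambda>i. []),
       badd = (\<lambda>\<xi> \<eta>. tensor_class M N (\<lambda>i. class_rep \<xi> i @ class_rep \<eta> i)),
       bscale = (\<lambda>k \<xi>. tensor_class M N (\<lambda>i. pre_scale M k (class_rep \<xi> i))),
       lact = (\<lambda>c \<xi>. tensor_class M N (\<lambda>i. map (\<lambda>(m, n). (lact M c m, n)) (class_rep \<xi> i))),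
       ract = (\<lambda>\<xi> d. tensor_class M N (\<lambda>i. map (\<lambda>(m, n). (m, ract N n d)) (class_rep \<xi> i))),
       lip = (\<lambda>\<xi> \<eta>. lim (\<lambda>i. pre_lip M N (class_rep \<xi> i) (class_rep \<eta> i))),
       rip = (\<lambda>\<xi> \<eta>. lim (\<lambda>i. pre_rip M N (class_rep \<xi> i) (class_rep \<eta> i))) \<rparr>"

definition elementary_tensor ::
  "('c, 'm, 'k) bimodule \<Rightarrow> ('k, 'n, 'd::unital_cstar_algebra) bimodule
   \<Rightarrow> 'm \<Rightarrow> 'n \<Rightarrow> (nat \<Rightarrow> ('m \<times> 'n) list) set" where
  "elementary_tensor M N m n = tensor_class M N (\<lambda>i. [(m, n)])"


section \<open>The upward basic construction\<close>

text \<open>\<open>A\<close> as a \<open>C\<close>-\<open>P\<close>-bimodule, where \<open>C\<close> is the linear span of \<open>A p A\<close>, regarded as the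
  C*-basic construction for \<open>E\<^sub>P : A \<rightarrow> P\<close> with Jones projection \<open>p\<close>. The left action is the
  linear extension of \<open>(x p y) \<cdot> z = x E\<^sub>P (y z)\<close>.\<close>

definition basic_bimodule ::
  "'c::unital_cstar_algebra set \<Rightarrow> 'c \<Rightarrow> ('c \<Rightarrow> 'c) \<Rightarrow> ('c, 'c, 'c) bimodule" where
  "basic_bimodule A p E\<^sub>P =
     \<lparr> bcarrier = A, bzero = 0, badd = (+), bscale = scaleC,
       lact = (\<lambda>c z. THE w. \<exists>xys. set xys \<subseteq> A \<times> A \<and>
                 c = (\<Sum>(x, y)\<leftarrow>xys. x * p * y) \<and> w = (\<Sum>(x, y)\<leftarrow>xys. x * E\<^sub>P (y * z))),
       ract = (\<lambda>x r. x * r),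
       lip = (\<lambda>x y. x * p * star y),
       rip = (\<lambda>x y. E\<^sub>P (star x * y)) \<rparr>"

text \<open>The \<open>P\<close>-\<open>Q\<close>-equivalence bimodule \<open>Z\<close> carries the structure inherited from \<open>Y\<close>. In the
  three definitions below the tensor product is bracketed to the left.\<close>

definition upward_construction ::
  "'c::unital_cstar_algebra set \<Rightarrow> 'c \<Rightarrow> ('c \<Rightarrow> 'c)
   \<Rightarrow> ('c, 'y, 'd::unital_cstar_algebra) bimodule \<Rightarrow> 'y set
   \<Rightarrow> 'd set \<Rightarrow> 'd \<Rightarrow> ('d \<Rightarrow> 'd)
   \<Rightarrow> ('c, (nat \<Rightarrow> ((nat \<Rightarrow> ('c \<times> 'y) list) set \<times> 'd) list) set, 'd) bimodule" where
  "upward_construction A p E\<^sub>P Y Z B q E\<^sub>Q =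
     bimodule_tensor (bimodule_tensor (basic_bimodule A p E\<^sub>P) (Y\<lparr>bcarrier := Z\<rparr>))
       (dual_bimodule (basic_bimodule B q E\<^sub>Q))"

definition upward_tensor ::
  "'c::unital_cstar_algebra set \<Rightarrow> 'c \<Rightarrow> ('c \<Rightarrow> 'c)
   \<Rightarrow> ('c, 'y, 'd::unital_cstar_algebra) bimodule \<Rightarrow> 'y set
   \<Rightarrow> 'd set \<Rightarrow> 'd \<Rightarrow> ('d \<Rightarrow> 'd)
   \<Rightarrow> 'c \<Rightarrow> 'y \<Rightarrow> 'd \<Rightarrow> (nat \<Rightarrow> ((nat \<Rightarrow> ('c \<times> 'y) list) set \<times> 'd) list) set" where
  "upward_tensor A p E\<^sub>P Y Z B q E\<^sub>Q a z b =
     elementary_tensor (bimodule_tensor (basic_bimodule A p E\<^sub>P) (Y\<lparr>bcarrier := Z\<rparr>))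
       (dual_bimodule (basic_bimodule B q E\<^sub>Q))
       (elementary_tensor (basic_bimodule A p E\<^sub>P) (Y\<lparr>bcarrier := Z\<rparr>) a z) b"

text \<open>The embedding of \<open>X\<close> in the upward basic construction for \<open>E\<^sub>Z\<close>, relative to
  quasi-bases \<open>ss\<close> and \<open>ts\<close> of \<open>E\<^sub>P\<close> and \<open>E\<^sub>Q\<close>.\<close>

definition upward_embedding ::
  "'c::unital_cstar_algebra set \<Rightarrow> 'c \<Rightarrow> ('c \<Rightarrow> 'c)
   \<Rightarrow> ('c, 'y, 'd::unital_cstar_algebra) bimodule \<Rightarrow> 'y set
   \<Rightarrow> 'd set \<Rightarrow> 'd \<Rightarrow> ('d \<Rightarrow> 'd) \<Rightarrow> ('y \<Rightarrow> 'y) \<Rightarrow> 'c list \<Rightarrow> 'd list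
   \<Rightarrow> 'y \<Rightarrow> (nat \<Rightarrow> ((nat \<Rightarrow> ('c \<times> 'y) list) set \<times> 'd) list) set" where
  "upward_embedding A p E\<^sub>P Y Z B q E\<^sub>Q E\<^sub>Z ss ts x =
     bsum (upward_construction A p E\<^sub>P Y Z B q E\<^sub>Q)
       [upward_tensor A p E\<^sub>P Y Z B q E\<^sub>Q s (E\<^sub>Z (ract Y (lact Y (star s) x) t)) t.
          s \<leftarrow> ss, t \<leftarrow> ts]"

text \<open>\<open>F\<close> is the dual conditional expectation of \<open>E\<^sub>Z\<close>: the bounded linear map into \<open>X\<close> given
  on elementary tensors by the stated formula. It is unique, since the elementary tensors
  span a dense subspace of the upward basic construction.\<close>

definition dual_expectation ::
  "'c::unital_cstar_algebra set \<Rightarrow> 'c \<Rightarrow> ('c \<Rightarrow> 'c)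
   \<Rightarrow> ('c, 'y, 'd::unital_cstar_algebra) bimodule \<Rightarrow> 'y set \<Rightarrow> 'y set
   \<Rightarrow> 'd set \<Rightarrow> 'd \<Rightarrow> ('d \<Rightarrow> 'd)
   \<Rightarrow> ((nat \<Rightarrow> ((nat \<Rightarrow> ('c \<times> 'y) list) set \<times> 'd) list) set \<Rightarrow> 'y) \<Rightarrow> bool" where
  "dual_expectation A p E\<^sub>P Y X Z B q E\<^sub>Q F \<longleftrightarrow>
     (let U = upward_construction A p E\<^sub>P Y Z B q E\<^sub>Q in
       (\<forall>\<xi>\<in>bcarrier U. F \<xi> \<in> X) \<and>
       (\<forall>\<xi>\<in>bcarrier U. \<forall>\<eta>\<in>bcarrier U. F (badd U \<xi> \<eta>) = badd Y (F \<xi>) (F \<eta>)) \<and>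
       (\<forall>k. \<forall>\<xi>\<in>bcarrier U. F (bscale U k \<xi>) = bscale Y k (F \<xi>)) \<and>
       (\<exists>K. \<forall>\<xi>\<in>bcarrier U. rnorm Y (F \<xi>) \<le> K * rnorm U \<xi>) \<and>
       (\<forall>a\<in>A. \<forall>z\<in>Z. \<forall>b\<in>B.
          F (upward_tensor A p E\<^sub>P Y Z B q E\<^sub>Q a z b) =
            lact Y (cinverse (Ind_W A E\<^sub>P)) (ract Y (lact Y a z) (star b))))"

end

theory Submission
  imports Defs
begin

text \<open>
  Write \<open>k\<close> and \<open>l\<close> for the indices of \<open>E\<^sub>A\<close> and \<open>E\<^sub>B\<close>. The upward construction
  \<open>A \<otimes>\<^sub>P Z \<otimes>\<^sub>Q B~\<close> can be seen inside \<open>Y\<close>: the elementary tensor \<open>a \<otimes> z \<otimes> b~\<close> is the vector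
  \<open>a \<cdot> z \<cdot> q b\<^sup>* = a p \<cdot> z \<cdot> b\<^sup>*\<close>. The inner products of such vectors are those of the tensor product,
  and every vector of \<open>Y\<close> is a finite sum of them; so the Hausdorff completion that defines the
  tensor product reproduces the complete space \<open>Y\<close>, and \<open>\<theta>\<close> maps \<open>y\<close> to the class of those sequences
  of formal sums whose values in \<open>Y\<close> converge to \<open>y\<close>. The dual expectation is \<open>F = E\<^sub>X \<circ> \<theta>\<^sup>-\<^sup>1\<close>, since
  \<open>E\<^sub>X (a p \<cdot> z \<cdot> b\<^sup>*) = a E\<^sub>A(p) \<cdot> z \<cdot> b\<^sup>*\<close> and \<open>E\<^sub>A(p) = k\<^sup>-\<^sup>1\<close> is central.

  That this picture is right rests on the identity \<open>p c = k p E\<^sub>A(p c)\<close> for all \<open>c\<close> in \<open>C\<close> (lemma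
  \<open>p_absorb\<close>), which says that \<open>p\<close> is the Jones projection of a basic construction: it yields
  \<open>p a p = E\<^sub>P(a) p\<close> and \<open>C = A p A\<close>, and a family \<open>s\<close> in \<open>A\<close> is a quasi-basis of \<open>E\<^sub>P\<close> iff
  \<open>\<Sum> s p s\<^sup>* = 1\<close>. It holds because the elements \<open>z(u) = p u - k p E\<^sub>A(p u)\<close> for \<open>u\<close> in a quasi-basis
  of \<open>E\<^sub>A\<close> satisfy \<open>\<Sum> z(u) z(u)\<^sup>* = 0\<close>. As \<open>Y\<close> is spanned by \<open>C \<cdot> X\<close> and by \<open>X \<cdot> D\<close>, the identity
  and its mirror image pass to \<open>Y\<close>, and with \<open>k \<cdot> y = y \<cdot> l\<close> they show that every \<open>p \<cdot> y \<cdot> q\<close> equals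
  \<open>z \<cdot> q = p \<cdot> z\<close> for \<open>z = k \<cdot> E\<^sub>X(p \<cdot> y \<cdot> q)\<close> in \<open>Z\<close>. Hence
  \<open>y = \<Sum> s p s\<^sup>* \<cdot> y \<cdot> t q t\<^sup>*\<close>, over quasi-bases \<open>s\<close>, \<open>t\<close> of \<open>E\<^sub>P\<close>, \<open>E\<^sub>Q\<close>, is a finite sum of
  vectors \<open>s \<cdot> z \<cdot> q t\<^sup>*\<close>; for \<open>y\<close> in \<open>X\<close> this sum is the stated embedding of \<open>X\<close>.

  The tensor product is bracketed to the left, so the comparison with \<open>Y\<close> is made twice: for
  \<open>A \<otimes>\<^sub>P Z\<close>, whose model is \<open>Y \<cdot> q\<close>, and then for the full product. Both are instances of the
  locale \<open>tensor_model\<close>.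

  The analytic input is that a sum of elements \<open>b\<^sup>* b\<close> dominates each summand in norm. It gives the
  Cauchy-Schwarz inequality in equivalence bimodules and the step from \<open>\<Sum> z(u) z(u)\<^sup>* = 0\<close> to
  \<open>z(u) = 0\<close>. It is proved from the axioms of a C*-algebra by means of square roots, without
  spectral theory.
\<close>

section \<open>Positive elements of a C*-algebra\<close>

lemma scaleC_zero_left [simp]: "0 *\<^sub>C a = (0::'a::unital_cstar_algebra)"
  using scaleC_add_left[of 0 0 a] by simp

lemma scaleC_zero_right [simp]: "c *\<^sub>C 0 = (0::'a::unital_cstar_algebra)"
  using scaleC_add_right[of c 0 "0::'a"] by simp

lemma scaleC_minus_left: "(- c) *\<^sub>C a = - (c *\<^sub>C (a::'a::unital_cstar_algebra))"
  by (metis add.right_inverse add_eq_0_iff scaleC_add_left scaleC_zero_left)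

lemma scaleC_minus1 [simp]: "(- 1) *\<^sub>C a = - (a::'a::unital_cstar_algebra)"
  by (simp add: scaleC_minus_left scaleC_one)

lemma scaleC_minus_right: "c *\<^sub>C (- a) = - (c *\<^sub>C (a::'a::unital_cstar_algebra))"
  by (metis add.right_inverse add_eq_0_iff scaleC_add_right scaleC_zero_right)

lemma scaleC_diff_right: "c *\<^sub>C (a - b) = c *\<^sub>C a - c *\<^sub>C (b::'a::unital_cstar_algebra)"
  by (metis diff_conv_add_uminus scaleC_add_right scaleC_minus_right)

lemma star_zero [simp]: "star 0 = (0::'a::unital_cstar_algebra)"
  using star_add[of 0 "0::'a"] by simp

lemma star_minus: "star (- a) = - star (a::'a::unital_cstar_algebra)"
  by (metis add.right_inverse add_eq_0_iff star_add star_zero)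

lemma star_diff: "star (a - b) = star a - star (b::'a::unital_cstar_algebra)"
  by (metis diff_conv_add_uminus star_add star_minus)

lemma star_one [simp]: "star 1 = (1::'a::unital_cstar_algebra)"
  by (metis mult_1_right star_mult star_star)

lemma star_scaleR: "star (r *\<^sub>R a) = r *\<^sub>R star (a::'a::unital_cstar_algebra)"
  by (simp add: scaleR_scaleC star_scaleC)

lemma star_sum_list: "star (\<Sum>x\<leftarrow>xs. f x) = (\<Sum>x\<leftarrow>xs. star (f x :: 'a::unital_cstar_algebra))"
  by (induction xs) (simp_all add: star_add)

lemma norm_star: "norm (star a) = norm (a::'a::unital_cstar_algebra)"
proof -
  have le: "norm b \<le> norm (star b)" for b :: 'a
  proof (cases "norm b = 0")
    case False
    have "norm b * norm b \<le> norm (star b) * norm b"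
      using cstar_identity[of b] norm_mult_ineq[of "star b" b] by (simp add: power2_eq_square)
    then show ?thesis using False by simp
  qed simp
  show ?thesis using le[of a] le[of "star a"] by (simp add: star_star)
qed

lemma cstar_identity': "norm (a * star a) = (norm (a::'a::unital_cstar_algebra))\<^sup>2"
  using cstar_identity[of "star a"] by (simp add: star_star norm_star)

lemma norm_one_le: "norm (1::'a::unital_cstar_algebra) \<le> 1"
proof -
  have "norm (1::'a) = (norm (1::'a))\<^sup>2" using cstar_identity[of "1::'a"] by simp
  then show ?thesis by (metis power2_eq_square mult_cancel_left1 norm_ge_zero order_refl zero_le_one)
qed

lemma bounded_linear_star: "bounded_linear (star :: 'a::unital_cstar_algebra \<Rightarrow> 'a)"
  by (rule bounded_linear_intro[where K=1]) (simp_all add: star_add star_scaleR norm_star)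

lemmas tendsto_star = bounded_linear.tendsto[OF bounded_linear_star]

text \<open>The scalar case \<open>x = 1\<close> of the iteration \<open>s \<mapsto> (x + s\<^sup>2)/2\<close>, which dominates the iteration for every
  \<open>x\<close> in the unit ball.\<close>

lemma sqrt_iteration_bound:
  fixes \<sigma> :: "nat \<Rightarrow> real"
  assumes "\<sigma> 0 = 0" "\<And>n. \<sigma> (Suc n) = (1 + (\<sigma> n)\<^sup>2) / 2"
  shows "0 \<le> \<sigma> n" "\<sigma> n \<le> 1" "\<sigma> n \<le> \<sigma> (Suc n)"
proof -
  have b: "0 \<le> \<sigma> n \<and> \<sigma> n \<le> 1" for n
    by (induction n) (auto simp: assms power_le_one)
  show "0 \<le> \<sigma> n" "\<sigma> n \<le> 1" using b by auto
  have "0 \<le> (\<sigma> n - 1)\<^sup>2" by simp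
  then show "\<sigma> n \<le> \<sigma> (Suc n)" by (simp add: assms power2_eq_square algebra_simps)
qed

text \<open>\<open>(1 - s)\<^sup>2 = 1 - x\<close> means \<open>s = (x + s\<^sup>2)/2\<close>. The iteration of this map from \<open>0\<close> converges for
  \<open>\<parallel>x\<parallel> \<le> 1\<close>, the boundary case included, because its increments are at most those of the scalar
  iteration for \<open>x = 1\<close>. The iterates are polynomials in \<open>x\<close>, so their limit inherits selfadjointness
  and commutation relations.\<close>

lemma exists_sqrt_one_minus:
  fixes x :: "'a::unital_cstar_algebra"
  assumes x: "norm x \<le> 1"
  obtains r where "r * r = 1 - x" "norm (1 - r) \<le> 1"
    "star x = x \<Longrightarrow> star r = r" "\<And>y. x * y = y * x \<Longrightarrow> r * y = y * r"
proof -
  define s where "s = rec_nat (0::'a) (\<lambda>_ y. (1/2) *\<^sub>R (x + y * y))"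
  define \<sigma> where "\<sigma> = rec_nat (0::real) (\<lambda>_ y. (1 + y\<^sup>2) / 2)"
  have s0: "s 0 = 0" and sS: "\<And>n. s (Suc n) = (1/2) *\<^sub>R (x + s n * s n)" by (simp_all add: s_def)
  have \<sigma>0: "\<sigma> 0 = 0" and \<sigma>S: "\<And>n. \<sigma> (Suc n) = (1 + (\<sigma> n)\<^sup>2) / 2" by (simp_all add: \<sigma>_def)
  note \<sigma> = sqrt_iteration_bound[of \<sigma>, OF \<sigma>0 \<sigma>S]
  have s_le: "norm (s n) \<le> \<sigma> n" for n
  proof (induction n)
    case (Suc n)
    have "norm (s n * s n) \<le> (\<sigma> n)\<^sup>2"
      using norm_mult_ineq[of "s n" "s n"] mult_mono[OF Suc Suc] \<sigma>(1)[of n]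
      by (simp add: power2_eq_square)
    then have "norm (x + s n * s n) \<le> 1 + (\<sigma> n)\<^sup>2"
      using norm_triangle_ineq[of x "s n * s n"] x by linarith
    then show ?case by (simp add: sS \<sigma>S)
  qed (simp add: s0 \<sigma>0)
  have step: "norm (s (Suc n) - s n) \<le> \<sigma> (Suc n) - \<sigma> n" for n
  proof (induction n)
    case 0
    show ?case using x by (simp add: s0 sS \<sigma>0 \<sigma>S)
  next
    case (Suc n)
    let ?d = "s (Suc n) - s n"
    have eq: "s (Suc (Suc n)) - s (Suc n) = (1/2) *\<^sub>R (s (Suc n) * ?d + ?d * s n)"
    proof -
      have "s (Suc (Suc n)) - s (Suc n) = (1/2) *\<^sub>R (x + s (Suc n) * s (Suc n)) - (1/2) *\<^sub>R (x + s n * s n)"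
        using sS[of "Suc n"] sS[of n] by metis
      then show ?thesis by (simp add: algebra_simps)
    qed
    have "norm (s (Suc n) * ?d) \<le> \<sigma> (Suc n) * (\<sigma> (Suc n) - \<sigma> n)"
      by (intro order_trans[OF norm_mult_ineq] mult_mono s_le Suc \<sigma>) auto
    moreover have "norm (?d * s n) \<le> (\<sigma> (Suc n) - \<sigma> n) * \<sigma> n"
      using \<sigma>(3)[of n] by (intro order_trans[OF norm_mult_ineq] mult_mono s_le Suc) auto
    ultimately have "norm (s (Suc n) * ?d + ?d * s n) \<le> (\<sigma> (Suc n))\<^sup>2 - (\<sigma> n)\<^sup>2"
      using norm_triangle_ineq[of "s (Suc n) * ?d" "?d * s n"]
      by (simp add: power2_eq_square algebra_simps)
    then have "norm (s (Suc (Suc n)) - s (Suc n)) \<le> (1/2) * ((\<sigma> (Suc n))\<^sup>2 - (\<sigma> n)\<^sup>2)"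
      unfolding eq by simp
    then show ?case using \<sigma>S[of "Suc n"] \<sigma>S[of n] by (simp add: field_simps)
  qed
  have "convergent \<sigma>"
    using \<sigma> by (intro Bseq_monoseq_convergent incseq_imp_monoseq incseq_SucI BseqI'[of _ 1]) auto
  then have "summable (\<lambda>n. \<sigma> (Suc n) - \<sigma> n)"
    using telescope_summable convergent_LIMSEQ_iff by blast
  then have "summable (\<lambda>n. s (Suc n) - s n)"
    by (rule summable_comparison_test') (use step in auto)
  then obtain l where "(\<lambda>n. s (Suc n) - s n) sums l" by (auto simp: summable_def)
  then have "(\<lambda>n. (\<Sum>i<n. s (Suc i) - s i)) \<longlonglongrightarrow> l" by (simp add: sums_def)
  then have lim: "s \<longlonglongrightarrow> l" by (simp add: sum_lessThan_telescope s0)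
  have "(\<lambda>n. s (Suc n)) \<longlonglongrightarrow> (1/2) *\<^sub>R (x + l * l)"
    unfolding sS by (intro tendsto_intros lim)
  then have fixl: "l = (1/2) *\<^sub>R (x + l * l)"
    using LIMSEQ_unique[OF LIMSEQ_Suc[OF lim]] by blast
  then have "2 *\<^sub>R l = 2 *\<^sub>R ((1/2) *\<^sub>R (x + l * l))" by (rule arg_cong)
  then have ll: "l + l = x + l * l" by (simp add: scaleR_2)
  show thesis
  proof (rule that[of "1 - l"])
    show "(1 - l) * (1 - l) = 1 - x" using ll by (simp add: algebra_simps)
    have "norm (s n) \<le> 1" for n using s_le[of n] \<sigma>(2)[of n] by linarith
    then have "norm l \<le> 1" by (intro LIMSEQ_le_const2[OF tendsto_norm[OF lim]]) blast
    then show "norm (1 - (1 - l)) \<le> 1" by simp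
    show "star (1 - l) = 1 - l" if "star x = x"
    proof -
      have "star (s n) = s n" for n
        by (induction n) (simp_all add: s0 sS star_scaleR star_add star_mult that)
      then have "s \<longlonglongrightarrow> star l" using tendsto_star[OF lim] by simp
      then have "star l = l" using lim LIMSEQ_unique by blast
      then show ?thesis by (simp add: star_diff)
    qed
    show "(1 - l) * y = y * (1 - l)" if xy: "x * y = y * x" for y
    proof -
      have c: "s n * y = y * s n" for n
      proof (induction n)
        case (Suc n)
        have "s n * s n * y = y * (s n * s n)" by (metis Suc mult.assoc)
        then show ?case by (simp add: sS algebra_simps xy)
      qed (simp add: s0)
      have "(\<lambda>n. s n * y) \<longlonglongrightarrow> l * y" "(\<lambda>n. y * s n) \<longlonglongrightarrow> y * l"
        by (intro tendsto_intros lim)+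
      then have "l * y = y * l" unfolding c by (rule LIMSEQ_unique)
      then show ?thesis by (simp add: algebra_simps)
    qed
  qed
qed

text \<open>Here \<open>s + \<i> r\<close> is unitary, and \<open>s\<close> and \<open>r\<close> are its real and imaginary part.\<close>

lemma commuting_squares_norm_le:
  fixes r s :: "'a::unital_cstar_algebra"
  assumes "star r = r" "star s = s" "r * s = s * r" "r * r + s * s = 1"
  shows "norm r \<le> 1" "norm s \<le> 1"
proof -
  let ?u = "s + \<i> *\<^sub>C r"
  have su: "star ?u = s - \<i> *\<^sub>C r" using assms by (simp add: star_add star_scaleC scaleC_minus_left)
  have "?u * star ?u = s * s + r * r"
    unfolding su
    by (simp add: algebra_simps mult_scaleC_left mult_scaleC_right scaleC_scaleC scaleC_add_right scaleC_diff_right assms(3))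
  then have "norm (?u * star ?u) \<le> 1" using norm_one_le assms(4) by (simp add: add.commute)
  then have u: "norm ?u \<le> 1" by (simp add: cstar_identity' power_le_one_iff)
  have "2 *\<^sub>R s = ?u + star ?u" "(2 *\<^sub>R r) = (- \<i>) *\<^sub>C (?u - star ?u)"
    unfolding su by (simp_all add: scaleR_2 scaleC_add_right scaleC_scaleC scaleC_one)
  then have "norm (2 *\<^sub>R s) \<le> 2" "norm (2 *\<^sub>R r) \<le> 2"
    using norm_triangle_ineq[of ?u "star ?u"] norm_triangle_ineq4[of ?u "star ?u"] u
    by (auto simp: norm_star norm_scaleC)
  then show "norm r \<le> 1" "norm s \<le> 1" by auto
qed

text \<open>Positivity as being a square of a selfadjoint element. It agrees with \<open>cpositive\<close>
  (lemma \<open>cpositive_iff_sqpos\<close>), but is easier to work with since a square root is at hand.\<close>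

definition sqpos :: "'a::unital_cstar_algebra \<Rightarrow> bool" where
  "sqpos h \<longleftrightarrow> (\<exists>s. star s = s \<and> h = s * s)"

lemma sqpos_selfadjoint: "sqpos h \<Longrightarrow> star h = h"
  by (auto simp: sqpos_def star_mult)

text \<open>Together with \<open>sqposI\<close> this describes positivity by the convex condition
  \<open>\<parallel>t - h\<parallel> \<le> t\<close>, from which closure under sums is immediate. For \<open>h = s\<^sup>2\<close> with \<open>\<parallel>s\<parallel> = 1\<close>, the
  element \<open>1 - h\<close> is the square of some \<open>r\<close> commuting with \<open>s\<close>, and \<open>\<parallel>r\<parallel> \<le> 1\<close> as \<open>r\<^sup>2 + s\<^sup>2 = 1\<close>.\<close>

lemma sqpos_norm_bound:
  fixes h :: "'a::unital_cstar_algebra"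
  assumes "sqpos h"
  shows "norm (norm h *\<^sub>R 1 - h) \<le> norm h"
proof (cases "h = 0")
  case False
  obtain s where s: "star s = s" "h = s * s" using assms by (auto simp: sqpos_def)
  define t where "t = norm s"
  have t: "norm h = t\<^sup>2" using cstar_identity[of s] s by (simp add: t_def)
  have t0: "t > 0" using False s by (auto simp: t_def)
  define s' where "s' = inverse t *\<^sub>R s"
  have s': "star s' = s'" "norm s' = 1" using s t0 by (auto simp: s'_def star_scaleR t_def)
  have "norm (s' * s') \<le> 1" using cstar_identity[of s'] s' by simp
  then obtain r where r: "r * r = 1 - s' * s'" "star (s' * s') = s' * s' \<Longrightarrow> star r = r"
    "\<And>y. (s' * s') * y = y * (s' * s') \<Longrightarrow> r * y = y * r" using exists_sqrt_one_minus by metis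
  have "r * s' = s' * r" by (rule r(3)) (simp add: mult.assoc)
  moreover have "star r = r" by (rule r(2)) (simp add: star_mult s')
  ultimately have "norm r \<le> 1" using r(1) s'(1) by (intro commuting_squares_norm_le[of r s']) auto
  then have "norm r * norm r \<le> 1" by (simp add: mult_le_one)
  then have "norm (1 - s' * s') \<le> 1" using norm_mult_ineq[of r r] unfolding r(1) by linarith
  then have "norm (t\<^sup>2 *\<^sub>R (1 - s' * s')) \<le> t\<^sup>2" using mult_left_le[of _ "t\<^sup>2"] by simp
  moreover have "t\<^sup>2 *\<^sub>R (1 - s' * s') = t\<^sup>2 *\<^sub>R 1 - h"
    using t0 s by (simp add: s'_def algebra_simps power2_eq_square)
  ultimately show ?thesis by (simp add: t)
qed simp

lemma commuting_sqrt:
  fixes h :: "'a::unital_cstar_algebra"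
  assumes "star h = h" "norm (t *\<^sub>R 1 - h) \<le> t"
  obtains r where "star r = r" "h = r * r" "\<And>y. h * y = y * h \<Longrightarrow> r * y = y * r"
proof (cases "t = 0")
  case True
  then have "h = 0" using assms by simp
  then show ?thesis using that[of 0] by simp
next
  case False
  then have t0: "t > 0" using assms(2) norm_ge_zero[of "t *\<^sub>R 1 - h"] by linarith
  define x where "x = 1 - inverse t *\<^sub>R h"
  have "x = inverse t *\<^sub>R (t *\<^sub>R 1 - h)" using t0 by (simp add: x_def algebra_simps)
  then have "t *\<^sub>R x = t *\<^sub>R 1 - h" using t0 by simp
  then have "t * norm x = norm (t *\<^sub>R 1 - h)" using t0 by (metis abs_of_pos norm_scaleR)
  then have "t * norm x \<le> t * 1" using assms(2) t0 by simp
  then have "norm x \<le> 1" using t0 mult_le_cancel_left_pos by blast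
  moreover have "star x = x" using assms(1) by (simp add: x_def star_diff star_scaleR)
  ultimately obtain r where r: "r * r = 1 - x" "star r = r" "\<And>y. x * y = y * x \<Longrightarrow> r * y = y * r"
    using exists_sqrt_one_minus by metis
  show ?thesis
  proof (rule that[of "sqrt t *\<^sub>R r"])
    show "h = (sqrt t *\<^sub>R r) * (sqrt t *\<^sub>R r)" using r(1) t0 by (simp add: x_def flip: mult.assoc)
    show "(sqrt t *\<^sub>R r) * y = y * (sqrt t *\<^sub>R r)" if "h * y = y * h" for y
      using r(3)[of y] that by (simp add: x_def algebra_simps)
  qed (simp add: star_scaleR r)
qed

lemma sqposI: "star h = h \<Longrightarrow> norm (t *\<^sub>R 1 - h) \<le> t \<Longrightarrow> sqpos h"
  by (metis commuting_sqrt sqpos_def)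

lemma sqpos_commuting_sqrt:
  assumes "sqpos h"
  obtains r where "star r = r" "h = r * r" "\<And>y. h * y = y * h \<Longrightarrow> r * y = y * r"
  using commuting_sqrt[OF sqpos_selfadjoint[OF assms] sqpos_norm_bound[OF assms]] by metis

lemma sqpos_add:
  assumes "sqpos h" "sqpos g"
  shows "sqpos (h + g)"
proof (rule sqposI[where t="norm h + norm g"])
  show "star (h + g) = h + g" using assms by (simp add: star_add sqpos_selfadjoint)
  have "norm ((norm h *\<^sub>R 1 - h) + (norm g *\<^sub>R 1 - g)) \<le> norm h + norm g"
    using norm_triangle_mono[OF sqpos_norm_bound[OF assms(1)] sqpos_norm_bound[OF assms(2)]] .
  then show "norm ((norm h + norm g) *\<^sub>R 1 - (h + g)) \<le> norm h + norm g"
    by (simp add: algebra_simps)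
qed

lemma sqpos_scaleR:
  assumes "sqpos h" "c \<ge> 0"
  shows "sqpos (c *\<^sub>R h)"
proof -
  obtain s where s: "star s = s" "h = s * s" using assms by (auto simp: sqpos_def)
  have "star (sqrt c *\<^sub>R s) = sqrt c *\<^sub>R s" "c *\<^sub>R h = (sqrt c *\<^sub>R s) * (sqrt c *\<^sub>R s)"
    using s assms by (simp_all add: star_scaleR)
  then show ?thesis unfolding sqpos_def by blast
qed

lemma sqpos_norm_minus:
  assumes "star h = h" "norm h \<le> t"
  shows "sqpos (t *\<^sub>R 1 - h)"
  by (rule sqposI[where t=t]) (use assms in \<open>simp_all add: star_diff star_scaleR\<close>)

text \<open>If \<open>h + g\<close> has norm below \<open>t\<close> then \<open>t - h = (t - h - g) + g\<close> is positive, and \<open>h\<close>, \<open>t - h\<close> are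
  commuting squares with sum \<open>t\<close>.\<close>

lemma sqpos_norm_mono:
  fixes h g :: "'a::unital_cstar_algebra"
  assumes h: "sqpos h" and g: "sqpos g"
  shows "norm h \<le> norm (h + g)"
proof (rule dense_ge)
  fix t assume t: "norm (h + g) < t"
  then have t0: "t > 0" using norm_ge_zero[of "h + g"] by linarith
  have "sqpos (t *\<^sub>R 1 - (h + g))"
    by (rule sqpos_norm_minus) (use sqpos_add[OF h g] sqpos_selfadjoint t in auto)
  then have "sqpos ((t *\<^sub>R 1 - (h + g)) + g)" using g sqpos_add by blast
  then have "sqpos (t *\<^sub>R 1 - h)" by (simp add: algebra_simps)
  then obtain r where r: "star r = r" "t *\<^sub>R 1 - h = r * r"
    "\<And>y. (t *\<^sub>R 1 - h) * y = y * (t *\<^sub>R 1 - h) \<Longrightarrow> r * y = y * r"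
    using sqpos_commuting_sqrt by metis
  obtain s where s: "star s = s" "h = s * s" using h by (auto simp: sqpos_def)
  have rs: "r * s = s * r" using r(3)[of s] s by (simp add: algebra_simps)
  have sum: "r * r + s * s = t *\<^sub>R 1" using r(2) s(2) by (metis diff_add_cancel)
  define c where "c = inverse (sqrt t)"
  have cc: "c * c * t = 1" "c * c = inverse t" using t0 by (simp_all add: c_def field_simps)
  have "norm (c *\<^sub>R s) \<le> 1"
  proof (rule commuting_squares_norm_le(2)[of "c *\<^sub>R r"])
    have "(c *\<^sub>R r) * (c *\<^sub>R r) + (c *\<^sub>R s) * (c *\<^sub>R s) = (c * c) *\<^sub>R (r * r + s * s)"
      by (simp add: scaleR_add_right)
    then show "(c *\<^sub>R r) * (c *\<^sub>R r) + (c *\<^sub>R s) * (c *\<^sub>R s) = 1"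
      unfolding sum using cc by (simp add: mult.assoc)
  qed (use r(1) s(1) rs in \<open>simp_all add: star_scaleR\<close>)
  then have "norm s \<le> sqrt t" using t0 by (simp add: c_def field_simps)
  then have "(norm s)\<^sup>2 \<le> t" 
    using t0 power_mono[of "norm s" "sqrt t" 2] real_sqrt_pow2[of t] by (metis less_imp_le norm_ge_zero)
  then show "norm h \<le> t" using cstar_identity[of s] s by simp
qed

text \<open>The core of Kaplansky's argument. With \<open>x = u + \<i> v\<close> one has
  \<open>x x\<^sup>* = 2 (u\<^sup>2 + v\<^sup>2) + k\<close>, so \<open>x x\<^sup>*\<close> is positive of norm \<open>t = \<parallel>k\<parallel>\<close> and \<open>\<parallel>t - x x\<^sup>*\<parallel> \<le> t\<close>. Multiplication by
  \<open>x\<^sup>*\<close> and \<open>x\<close> gives \<open>\<parallel>t k + k\<^sup>2\<parallel> \<le> t\<^sup>2\<close>. But \<open>t k + k\<^sup>2\<close> dominates \<open>2 k\<^sup>2\<close>, whose norm is \<open>2 t\<^sup>2\<close>.\<close>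

lemma negative_square_zero:
  fixes x k :: "'a::unital_cstar_algebra"
  assumes xk: "star x * x = - k" and k: "sqpos k"
  shows "x = 0"
proof -
  define t where "t = norm k"
  have tx: "t = (norm x)\<^sup>2" using cstar_identity[of x] by (simp add: t_def xk)
  define u where "u = (1/2) *\<^sub>R (x + star x)"
  define v where "v = (- \<i> / 2) *\<^sub>C (x - star x)"
  have u: "star u = u" by (simp add: u_def star_scaleR star_add star_star add.commute)
  have "star v = (\<i> / 2) *\<^sub>C (star x - x)" by (simp add: v_def star_scaleC star_diff star_star)
  also have "\<dots> = (\<i> / 2) *\<^sub>C (- (x - star x))" by simp
  also have "\<dots> = v" by (simp only: v_def scaleC_minus_right) (simp add: scaleC_minus_left)
  finally have v: "star v = v" .
  have vv: "v * v = (- (1/4)) *\<^sub>R ((x - star x) * (x - star x))"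
    by (simp add: v_def mult_scaleC_left mult_scaleC_right scaleC_scaleC scaleR_scaleC)
  have uu: "u * u = (1/4) *\<^sub>R ((x + star x) * (x + star x))" by (simp add: u_def)
  have "2 *\<^sub>R (u * u + v * v) = x * star x + star x * x"
    unfolding uu vv by (simp add: algebra_simps) (simp flip: scaleR_add_left add: add.assoc[symmetric])
  then have "x * star x = 2 *\<^sub>R (u * u + v * v) + k" using xk by simp
  moreover have "sqpos (2 *\<^sub>R (u * u + v * v) + k)"
    using u v k by (intro sqpos_add sqpos_scaleR) (auto simp: sqpos_def)
  ultimately have m: "sqpos (x * star x)" by simp
  have "norm (t *\<^sub>R 1 - x * star x) \<le> t"
    using sqpos_norm_bound[OF m] by (simp add: cstar_identity' tx)
  then have "norm (star x * (t *\<^sub>R 1 - x * star x) * x) \<le> t * t"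
    by (intro order_trans[OF norm_mult_ineq])
       (smt (verit) tx mult_right_mono mult_left_mono norm_ge_zero norm_mult_ineq norm_star power2_eq_square mult.assoc mult.commute)
  moreover have "star x * (t *\<^sub>R 1 - x * star x) * x = - (t *\<^sub>R k + k * k)"
  proof -
    have "star x * (t *\<^sub>R 1 - x * star x) * x = t *\<^sub>R (star x * x) - (star x * x) * (star x * x)"
      by (simp add: algebra_simps)
    then show ?thesis by (simp add: xk)
  qed
  ultimately have le: "norm (t *\<^sub>R k + k * k) \<le> t * t" by (metis norm_minus_cancel)
  obtain l where l: "star l = l" "k = l * l" using k by (auto simp: sqpos_def)
  \<comment> \<open>\<open>t k - k\<^sup>2 = l (t - k) l\<close> is the square of \<open>l r\<close>.\<close>
  have "sqpos (t *\<^sub>R 1 - k)" using sqpos_norm_minus sqpos_selfadjoint[OF k] t_def by blast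
  then obtain r where r: "star r = r" "t *\<^sub>R 1 - k = r * r"
    "\<And>y. (t *\<^sub>R 1 - k) * y = y * (t *\<^sub>R 1 - k) \<Longrightarrow> r * y = y * r"
    using sqpos_commuting_sqrt by metis
  have rl: "r * l = l * r" using r(3)[of l] l by (simp add: algebra_simps)
  have "t *\<^sub>R k - k * k = l * (t *\<^sub>R 1 - k) * l"
    by (simp add: l(2) algebra_simps)
  also have "\<dots> = (l * r) * (l * r)" by (metis r(2) rl mult.assoc)
  finally have "sqpos (t *\<^sub>R k - k * k)" using rl r l unfolding sqpos_def by (metis star_mult)
  moreover have kk: "sqpos (2 *\<^sub>R (k * k))"
    by (intro sqpos_scaleR) (use sqpos_selfadjoint[OF k] in \<open>auto simp: sqpos_def\<close>)
  ultimately have "norm (2 *\<^sub>R (k * k)) \<le> norm (2 *\<^sub>R (k * k) + (t *\<^sub>R k - k * k))"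
    using sqpos_norm_mono by blast
  also have "2 *\<^sub>R (k * k) + (t *\<^sub>R k - k * k) = t *\<^sub>R k + k * k" by (simp add: scaleR_2)
  finally have "2 * (t * t) \<le> t * t"
    using le cstar_identity[of k] sqpos_selfadjoint[OF k] by (simp add: t_def power2_eq_square)
  then have "t * t \<le> 0" by simp
  then have "t = 0" by (metis mult_eq_0_iff norm_ge_zero order_antisym t_def zero_le_mult_iff) 
  then show "x = 0" using tx by simp
qed

text \<open>Kaplansky's theorem. Let \<open>h = b\<^sup>* b\<close> and let \<open>g = w\<^sup>2\<close> be a positive square root of \<open>h\<^sup>2\<close>, in
  the role of the absolute value of \<open>h\<close>. For the negative part, up to a factor, \<open>n = g - h\<close>, the element
  \<open>(b n)\<^sup>* (b n) = n h n = - (w n)\<^sup>2\<close> is the negative of a square, so \<open>b n = 0\<close>, and then \<open>n = 0\<close>.\<close>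

lemma star_mult_self_sqpos:
  fixes b :: "'a::unital_cstar_algebra"
  shows "sqpos (star b * b)"
proof -
  define h where "h = star b * b"
  have h: "star h = h" by (simp add: h_def star_mult star_star)
  have hh: "sqpos (h * h)" using h by (auto simp: sqpos_def)
  obtain g where g: "star g = g" "h * h = g * g" "\<And>y. h * h * y = y * (h * h) \<Longrightarrow> g * y = y * g"
     and gpos: "sqpos g"
  proof -
    define T where "T = norm h"
    show ?thesis
    proof (cases "T = 0")
      case True
      then have "h = 0" by (simp add: T_def)
      then show ?thesis by (intro that[of 0]) (auto simp: sqpos_def intro: exI[of _ 0])
    next
      case False
      then have T: "T > 0" by (simp add: T_def)
      define x where "x = 1 - inverse (T * T) *\<^sub>R (h * h)"
      have nh: "norm (h * h) = T * T" using cstar_identity[of h] h by (simp add: T_def power2_eq_square)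
      have "(T * T) *\<^sub>R x = (T * T) *\<^sub>R 1 - h * h" using T by (simp add: x_def algebra_simps)
      then have "(T * T) * norm x = norm ((T * T) *\<^sub>R 1 - h * h)" by (metis abs_of_nonneg norm_ge_zero norm_scaleR nh)
      then have "(T * T) * norm x \<le> (T * T) * 1" using sqpos_norm_bound[OF hh] nh by simp
      then have "norm x \<le> 1" using T mult_le_cancel_left_pos[of "T * T"] by auto
      moreover have "star x = x" by (simp add: x_def star_diff star_scaleR star_mult h)
      ultimately obtain r where r: "r * r = 1 - x" "norm (1 - r) \<le> 1" "star r = r"
        "\<And>y. x * y = y * x \<Longrightarrow> r * y = y * r" using exists_sqrt_one_minus by metis
      show ?thesis
      proof (rule that[of "T *\<^sub>R r"])
        show "star (T *\<^sub>R r) = T *\<^sub>R r" by (simp add: star_scaleR r)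
        show "h * h = T *\<^sub>R r * T *\<^sub>R r"
          using T by (simp add: r(1) x_def) (simp add: field_simps)
        show "T *\<^sub>R r * y = y * T *\<^sub>R r" if "h * h * y = y * (h * h)" for y
          using r(4)[of y] that by (simp add: x_def algebra_simps)
        have "norm (T *\<^sub>R 1 - T *\<^sub>R r) \<le> T"
          using r(2) T mult_left_le[of "norm (1 - r)" T] by (simp flip: scaleR_diff_right)
        then show "sqpos (T *\<^sub>R r)" by (intro sqposI[of _ T]) (simp_all add: star_scaleR r)
      qed
    qed
  qed
  have gh: "g * h = h * g" using g(3)[of h] by (simp add: mult.assoc)
  obtain w where w: "star w = w" "g = w * w" "\<And>y. g * y = y * g \<Longrightarrow> w * y = y * w"
    using sqpos_commuting_sqrt[OF gpos] by metis
  define n where "n = g - h"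
  have n: "star n = n" by (simp add: n_def star_diff g h)
  have hn: "h * n = - (g * n)" using g(2) gh by (simp add: n_def algebra_simps)
  have gn: "g * n = n * g" using gh by (simp add: n_def algebra_simps)
  have wn: "w * n = n * w" using w(3) gn by blast
  have "star (b * n) * (b * n) = n * (h * n)" by (simp add: star_mult n h_def mult.assoc)
  also have "\<dots> = - ((w * n) * (w * n))" 
    by (simp add: hn) (metis gn w(2) wn mult.assoc)
  finally have eq: "star (b * n) * (b * n) = - ((w * n) * (w * n))" .
  moreover have "sqpos ((w * n) * (w * n))" unfolding sqpos_def by (metis n star_mult w(1) wn)
  ultimately have "b * n = 0" by (rule negative_square_zero)
  then have "h * n = 0" by (simp add: h_def mult.assoc)
  then have "g * n = 0" using hn by simp
  then have "n * n = 0" using \<open>h * n = 0\<close> by (simp add: n_def algebra_simps)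
  then have "n = 0" using cstar_identity[of n] n by simp
  then show ?thesis using gpos by (simp add: n_def h_def)
qed

lemma cpositive_iff_sqpos: "cpositive h \<longleftrightarrow> sqpos h"
  unfolding cpositive_def using star_mult_self_sqpos by (metis sqpos_def)

lemma sum_list_sqpos: "(\<And>x. x \<in> set xs \<Longrightarrow> sqpos (f x)) \<Longrightarrow> sqpos (\<Sum>x\<leftarrow>xs. f x)"
proof (induction xs)
  case Nil
  show ?case by (auto simp: sqpos_def intro: exI[of _ 0])
qed (simp add: sqpos_add)

lemma mult_star_self_sqpos: "sqpos (b * star b)"
  using star_mult_self_sqpos[of "star b"] by (simp add: star_star)

lemma sum_list_mult_star_zero:
  fixes f :: "'b \<Rightarrow> 'a::unital_cstar_algebra"
  assumes "(\<Sum>x\<leftarrow>xs. f x * star (f x)) = 0" "x \<in> set xs"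
  shows "f x = 0"
  using assms
proof (induction xs)
  case (Cons y ys)
  let ?S = "\<Sum>x\<leftarrow>ys. f x * star (f x)"
  have S: "sqpos ?S" by (intro sum_list_sqpos mult_star_self_sqpos)
  have "norm (f y * star (f y)) \<le> norm (f y * star (f y) + ?S)"
    by (intro sqpos_norm_mono mult_star_self_sqpos S)
  then have "f y * star (f y) = 0" using Cons.prems(1) by simp
  moreover from this have "?S = 0" using Cons.prems(1) by simp
  ultimately show ?case
    using Cons.IH Cons.prems(2) cstar_identity'[of "f y"] by auto
qed simp

text \<open>The one-sided inverses of \<open>a = 1 - x\<close> are the fixed points of the contractions
  \<open>y \<mapsto> 1 + x y\<close> and \<open>y \<mapsto> 1 + y x\<close>.\<close>

lemma invertible_near_one:
  fixes a :: "'a::unital_cstar_algebra"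
  assumes "norm (1 - a) < 1"
  obtains b where "a * b = 1" "b * a = 1"
proof -
  let ?x = "1 - a"
  have "\<exists>!y. 1 + ?x * y = y"
  proof (rule banach_fix_type[OF _ assms], simp, intro allI)
    show "dist (1 + ?x * y) (1 + ?x * z) \<le> norm ?x * dist y z" for y z
      using norm_mult_ineq[of ?x "y - z"] by (simp only: dist_norm add_diff_cancel_left right_diff_distrib)
  qed
  then obtain b where b: "1 + ?x * b = b" by blast
  have "\<exists>!y. 1 + y * ?x = y"
  proof (rule banach_fix_type[OF _ assms], simp, intro allI)
    show "dist (1 + y * ?x) (1 + z * ?x) \<le> norm ?x * dist y z" for y z
      using norm_mult_ineq[of "y - z" ?x]
      by (simp only: dist_norm add_diff_cancel_left left_diff_distrib mult.commute[of "norm ?x"])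
  qed
  then obtain c where c: "1 + c * ?x = c" by blast
  have ab: "a * b = 1" using b by (simp add: algebra_simps)
  have ca: "c * a = 1" using c by (simp add: algebra_simps)
  have "c = b" by (metis ab ca mult.assoc mult_1_left mult_1_right)
  then show thesis using that ab ca by blast
qed

text \<open>For \<open>t = c + \<parallel>h\<parallel>\<close> the element \<open>(c + h)/t\<close> lies at distance at most \<open>\<parallel>h\<parallel>/t < 1\<close> from \<open>1\<close>.\<close>

lemma one_plus_sqpos_invertible:
  fixes h :: "'a::unital_cstar_algebra"
  assumes "sqpos h" "c > 0"
  obtains b where "(c *\<^sub>R 1 + h) * b = 1" "b * (c *\<^sub>R 1 + h) = 1"
proof -
  define t where "t = c + norm h"
  have t: "t > 0" using assms(2) by (simp add: t_def add_pos_nonneg)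
  define a where "a = inverse t *\<^sub>R (c *\<^sub>R 1 + h)"
  have "1 - a = inverse t *\<^sub>R (norm h *\<^sub>R 1 - h)"
  proof -
    have "1 = inverse t *\<^sub>R (t *\<^sub>R (1::'a))" using t by simp
    then have "1 - a = inverse t *\<^sub>R (t *\<^sub>R 1 - (c *\<^sub>R 1 + h))" by (simp add: a_def scaleR_diff_right)
    also have "t *\<^sub>R 1 - (c *\<^sub>R 1 + h) = norm h *\<^sub>R 1 - h" by (simp add: t_def scaleR_add_left)
    finally show ?thesis .
  qed
  then have "norm (1 - a) \<le> inverse t * norm h" using sqpos_norm_bound[OF assms(1)] t by (simp add: mult_left_mono)
  also have "\<dots> < 1" using t assms(2) by (simp add: t_def field_simps)
  finally obtain b where "a * b = 1" "b * a = 1" using invertible_near_one by metis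
  then show thesis using that[of "inverse t *\<^sub>R b"] by (simp add: a_def)
qed

section \<open>Equivalence bimodules as normed spaces\<close>

context equivalence_bimodule
begin

lemma diff_closed: "x \<in> bcarrier M \<Longrightarrow> y \<in> bcarrier M \<Longrightarrow> bdiff M x y \<in> bcarrier M"
  by (simp add: bdiff_def add_closed scale_closed)

lemmas closed = zero_closed add_closed scale_closed lact_closed ract_closed diff_closed

lemma scale_zero: "x \<in> bcarrier M \<Longrightarrow> bscale M 0 x = bzero M"
  using scale_add_left[of x 1 "-1"] add_uminus[of x] by (simp add: bdiff_def scale_one)

lemma rip_zero_right: "x \<in> bcarrier M \<Longrightarrow> rip M x (bzero M) = 0"
  using rip_scale[of x x 0] by (simp add: scale_zero)

lemma rip_add_left: "x \<in> bcarrier M \<Longrightarrow> y \<in> bcarrier M \<Longrightarrow> z \<in> bcarrier M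
    \<Longrightarrow> rip M (badd M x y) z = rip M x z + rip M y z"
  using rip_star[of z "badd M x y"] by (simp add: add_closed rip_add star_add rip_star)

lemma rip_scale_left: "x \<in> bcarrier M \<Longrightarrow> y \<in> bcarrier M
    \<Longrightarrow> rip M (bscale M k x) y = cnj k *\<^sub>C rip M x y"
  using rip_star[of y "bscale M k x"] by (simp add: scale_closed rip_scale star_scaleC rip_star)

lemma rip_ract_left: "x \<in> bcarrier M \<Longrightarrow> y \<in> bcarrier M
    \<Longrightarrow> rip M (ract M x d) y = star d * rip M x y"
  using rip_star[of y "ract M x d"] by (simp add: ract_closed rip_ract star_mult rip_star)

lemma rip_zero_left: "x \<in> bcarrier M \<Longrightarrow> rip M (bzero M) x = 0"
  using rip_star[OF _ zero_closed, of x] by (simp add: rip_zero_right)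

lemma rip_diff_right: "x \<in> bcarrier M \<Longrightarrow> y \<in> bcarrier M \<Longrightarrow> z \<in> bcarrier M
    \<Longrightarrow> rip M x (bdiff M y z) = rip M x y - rip M x z"
  by (simp add: bdiff_def rip_add rip_scale scale_closed)

lemma rip_diff_left: "x \<in> bcarrier M \<Longrightarrow> y \<in> bcarrier M \<Longrightarrow> z \<in> bcarrier M
    \<Longrightarrow> rip M (bdiff M x y) z = rip M x z - rip M y z"
  by (simp add: bdiff_def rip_add_left rip_scale_left scale_closed)

lemmas rip_linear = rip_zero_left rip_zero_right rip_add rip_add_left rip_scale rip_scale_left
  rip_ract rip_ract_left rip_diff_left rip_diff_right

lemma diff_eq_zeroD:
  assumes "x \<in> bcarrier M" "y \<in> bcarrier M" "bdiff M x y = bzero M"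
  shows "x = y"
proof -
  have "x = badd M x (bdiff M y y)" using assms by (simp add: add_uminus add_zero)
  also have "\<dots> = badd M (bdiff M x y) y" using assms(1,2)
    unfolding bdiff_def by (simp add: add_assoc scale_closed add_commute[of y])
  also have "\<dots> = y" using assms add_commute[OF zero_closed, of y] by (simp add: add_zero)
  finally show ?thesis .
qed

text \<open>The inner product separates points, so an identity between vectors may be checked
  inside the algebra.\<close>

lemma vector_eqI:
  assumes x: "x \<in> bcarrier M" and y: "y \<in> bcarrier M"
    and eq: "\<And>w. w \<in> bcarrier M \<Longrightarrow> rip M w x = rip M w y"
  shows "x = y"
proof -
  have "rip M (bdiff M x y) (bdiff M x y) = 0"
    using eq[OF diff_closed[OF x y]] x y by (simp add: rip_diff_right diff_closed)
  then show ?thesis using diff_eq_zeroD[OF x y] rip_definite[OF diff_closed[OF x y]] by blast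
qed

lemma lact_zero_right: "lact M c (bzero M) = bzero M"
  using lact_scale_right[OF zero_closed, of c 0] by (simp add: scale_zero zero_closed lact_closed)

lemma ract_zero_left: "ract M (bzero M) d = bzero M"
  using ract_scale_left[OF zero_closed, of 0 d] by (simp add: scale_zero zero_closed ract_closed)

lemma lact_zero_left: "x \<in> bcarrier M \<Longrightarrow> lact M 0 x = bzero M"
  using lact_scale_left[of x 0 0] by (simp add: scale_zero lact_closed)

lemma ract_zero_right: "x \<in> bcarrier M \<Longrightarrow> ract M x 0 = bzero M"
  using ract_scale_right[of x 0 0] by (simp add: scale_zero ract_closed)

lemma lip_add_right: "x \<in> bcarrier M \<Longrightarrow> y \<in> bcarrier M \<Longrightarrow> z \<in> bcarrier M
    \<Longrightarrow> lip M x (badd M y z) = lip M x y + lip M x z"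
  using lip_star[of "badd M y z" x] by (simp add: add_closed lip_add star_add lip_star)

lemma lip_scale_right: "x \<in> bcarrier M \<Longrightarrow> y \<in> bcarrier M
    \<Longrightarrow> lip M x (bscale M k y) = cnj k *\<^sub>C lip M x y"
  using lip_star[of "bscale M k y" x] by (simp add: scale_closed lip_scale star_scaleC lip_star)

lemma lip_lact_right: "x \<in> bcarrier M \<Longrightarrow> y \<in> bcarrier M
    \<Longrightarrow> lip M x (lact M c y) = lip M x y * star c"
  using lip_star[of "lact M c y" x] by (simp add: lact_closed lip_lact star_mult lip_star)

text \<open>Passing to the dual exchanges left and right, so statements about one inner product yield
  those about the other.\<close>

lemma dual: "equivalence_bimodule (dual_bimodule M)"
proof -
  have bd: "bdiff (dual_bimodule M) = bdiff M"
    by (intro ext) (simp add: bdiff_def dual_bimodule_def)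
  have "lnorm (dual_bimodule M) = rnorm M" "rnorm (dual_bimodule M) = lnorm M"
    by (intro ext, simp add: lnorm_def rnorm_def dual_bimodule_def)+
  then have cmp: "complete_for (lnorm (dual_bimodule M)) (dual_bimodule M)"
    "complete_for (rnorm (dual_bimodule M)) (dual_bimodule M)"
    using lcomplete rcomplete by (simp_all add: complete_for_def bd) (simp_all add: dual_bimodule_def)
  have full: "closure (cspan {lip (dual_bimodule M) x y | x y.
      x \<in> bcarrier (dual_bimodule M) \<and> y \<in> bcarrier (dual_bimodule M)}) = UNIV"
    "closure (cspan {rip (dual_bimodule M) x y | x y.
      x \<in> bcarrier (dual_bimodule M) \<and> y \<in> bcarrier (dual_bimodule M)}) = UNIV"
    using rip_full lip_full by (simp_all add: dual_bimodule_def)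
  have eqs: "bcarrier (dual_bimodule M) = bcarrier M" "bzero (dual_bimodule M) = bzero M"
    "badd (dual_bimodule M) = badd M" "bscale (dual_bimodule M) = (\<lambda>k. bscale M (cnj k))"
    "lact (dual_bimodule M) = (\<lambda>d x. ract M x (star d))"
    "ract (dual_bimodule M) = (\<lambda>x c. lact M (star c) x)"
    "lip (dual_bimodule M) = rip M" "rip (dual_bimodule M) = lip M"
    by (auto simp: dual_bimodule_def)
  show ?thesis
    apply (unfold_locales)
    apply (unfold bd eqs)
    apply ((simp add: closed; fail)+)[5]
    apply (fact add_assoc) apply (fact add_commute) apply (fact add_zero) apply (fact add_uminus)
    apply (fact scale_add_right)
    apply (simp add: scale_add_left) 
    apply (simp add: scale_scale)
    apply (simp add: scale_one)
    apply (fact ract_add_left)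
    apply (simp add: ract_add_right star_add)
    apply (simp add: ract_scale_left)
    apply (simp add: star_scaleC ract_scale_right)
    apply (simp add: star_mult ract_mult)
    apply (simp add: ract_one)
    apply (fact lact_add_right)
    apply (simp add: lact_add_left star_add)
    apply (simp add: lact_scale_right)
    apply (simp add: star_scaleC lact_scale_left)
    apply (simp add: star_mult lact_mult)
    apply (simp add: lact_one)
    apply (simp add: lact_ract)
    apply (simp add: rip_add_left)
    apply (simp add: rip_scale_left)
    apply (simp add: rip_ract_left star_star)
    apply (simp add: rip_star)
    apply (simp add: rip_positive)
    apply (simp add: rip_definite)
    apply (simp add: lip_add_right)
    apply (simp add: lip_scale_right)
    apply (simp add: lip_lact_right star_star)
    apply (simp add: lip_star)
    apply (simp add: lip_positive)
    apply (simp add: lip_definite)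
    apply (simp add: rip_lact)
    apply (simp add: lip_ract)
    apply (simp add: lip_star rip_star compatible)
    apply (fact full[unfolded eqs] cmp)+
    done
qed

lemma rip_lact_diff:
  assumes "x \<in> bcarrier M" "y \<in> bcarrier M"
  shows "rip M x (lact M (c - d) y) = rip M x (lact M c y) - rip M x (lact M d y)"
proof -
  have "rip M x (lact M ((c - d) + d) y) = rip M x (lact M (c - d) y) + rip M x (lact M d y)"
    using assms by (simp only: lact_add_left rip_add lact_closed)
  then show ?thesis by simp
qed

text \<open>Left multiplication by \<open>c\<close> is bounded by the norm of \<open>c\<close>, since
  \<open>\<parallel>c\<parallel>\<^sup>2 - c\<^sup>* c\<close> is a square \<open>s\<^sup>* s\<close>.\<close>

lemma norm_rip_lact_le:
  assumes x: "x \<in> bcarrier M"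
  shows "norm (rip M (lact M c x) (lact M c x)) \<le> (norm c)\<^sup>2 * norm (rip M x x)"
proof -
  define T where "T = (norm c)\<^sup>2"
  have "sqpos (T *\<^sub>R 1 - star c * c)"
    by (rule sqpos_norm_minus) (simp_all add: star_mult star_star cstar_identity T_def)
  then obtain s where s: "star s = s" "T *\<^sub>R 1 - star c * c = s * s" by (auto simp: sqpos_def)
  have "rip M (lact M s x) (lact M s x) = rip M x (lact M (s * s) x)"
    using x by (simp add: rip_lact s(1) lact_mult lact_closed)
  also have "\<dots> = rip M x (lact M (T *\<^sub>R 1) x) - rip M x (lact M (star c * c) x)"
    using x by (simp only: s(2)[symmetric] rip_lact_diff)
  also have "rip M x (lact M (T *\<^sub>R 1) x) = T *\<^sub>R rip M x x"
    using x by (simp add: scaleR_scaleC lact_scale_left lact_one rip_scale lact_closed)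
  also have "rip M x (lact M (star c * c) x) = rip M (lact M c x) (lact M c x)"
    using x by (simp add: rip_lact lact_mult lact_closed)
  finally have eq: "T *\<^sub>R rip M x x
      = rip M (lact M c x) (lact M c x) + rip M (lact M s x) (lact M s x)" by simp
  have "norm (rip M (lact M c x) (lact M c x)) \<le> norm (T *\<^sub>R rip M x x)"
    unfolding eq by (intro sqpos_norm_mono) (use x in \<open>simp_all add: lact_closed rip_positive
      flip: cpositive_iff_sqpos\<close>)
  then show ?thesis by (simp add: T_def)
qed

lemma rnorm_nonneg [simp]: "0 \<le> rnorm M x"
  by (simp add: rnorm_def)

lemma rnorm_square: "(rnorm M x)\<^sup>2 = norm (rip M x x)"
  by (simp add: rnorm_def)

lemma lnorm_square: "(lnorm M x)\<^sup>2 = norm (lip M x x)"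
  by (simp add: lnorm_def)

text \<open>Cauchy-Schwarz with the left norm of the first vector:
  \<open>\<langle>x,y\<rangle>\<^sup>* \<langle>x,y\<rangle> = \<langle>y, h \<cdot> y\<rangle>\<close> where \<open>h\<close> is the left inner product of \<open>x\<close> with itself. Its case \<open>x = y\<close>,
  applied to the module and to its dual, shows that the two norms coincide.\<close>

lemma norm_rip_le_lnorm:
  assumes x: "x \<in> bcarrier M" and y: "y \<in> bcarrier M"
  shows "norm (rip M x y) \<le> lnorm M x * rnorm M y"
proof -
  obtain b where b: "lip M x x = star b * b" using lip_positive[OF x] by (auto simp: cpositive_def)
  have "star (rip M x y) * rip M x y = rip M y (lact M (lip M x x) y)"
    using x y by (simp add: rip_star rip_ract compatible)
  also have "\<dots> = rip M (lact M b y) (lact M b y)"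
    using y by (simp add: b rip_lact lact_mult lact_closed)
  finally have "(norm (rip M x y))\<^sup>2 \<le> (norm b)\<^sup>2 * norm (rip M y y)"
    using norm_rip_lact_le[OF y, of b] cstar_identity[of "rip M x y"] by simp
  also have "(norm b)\<^sup>2 = (lnorm M x)\<^sup>2" by (simp add: lnorm_square b cstar_identity)
  also have "norm (rip M y y) = (rnorm M y)\<^sup>2" by (simp add: rnorm_square)
  finally have "(norm (rip M x y))\<^sup>2 \<le> (lnorm M x * rnorm M y)\<^sup>2" by (simp add: power_mult_distrib)
  then show ?thesis by (rule power2_le_imp_le) (simp add: lnorm_def)
qed

lemma rnorm_le_lnorm:
  assumes "x \<in> bcarrier M"
  shows "rnorm M x \<le> lnorm M x"
proof (cases "rnorm M x = 0")
  case False
  have "rnorm M x * rnorm M x \<le> lnorm M x * rnorm M x"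
    using norm_rip_le_lnorm[OF assms assms] rnorm_square[of x] by (simp add: power2_eq_square)
  then show ?thesis using False rnorm_nonneg[of x] by (simp add: less_le)
qed (simp add: lnorm_def)

end

lemma dual_bimodule_simps:
  "bcarrier (dual_bimodule M) = bcarrier M" "bzero (dual_bimodule M) = bzero M"
  "badd (dual_bimodule M) = badd M" "bscale (dual_bimodule M) = (\<lambda>k. bscale M (cnj k))"
  "lact (dual_bimodule M) = (\<lambda>d x. ract M x (star d))"
  "ract (dual_bimodule M) = (\<lambda>x c. lact M (star c) x)"
  "lip (dual_bimodule M) = rip M" "rip (dual_bimodule M) = lip M"
  by (auto simp: dual_bimodule_def)

lemma rnorm_dual: "rnorm (dual_bimodule M) = lnorm M" "lnorm (dual_bimodule M) = rnorm M"
  by (simp_all add: fun_eq_iff rnorm_def lnorm_def dual_bimodule_simps)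

context equivalence_bimodule
begin

lemma lnorm_eq_rnorm: "x \<in> bcarrier M \<Longrightarrow> lnorm M x = rnorm M x"
  using rnorm_le_lnorm[of x] equivalence_bimodule.rnorm_le_lnorm[OF dual, of x]
  by (simp add: rnorm_dual dual_bimodule_simps)

lemma norm_rip_le: "x \<in> bcarrier M \<Longrightarrow> y \<in> bcarrier M \<Longrightarrow> norm (rip M x y) \<le> rnorm M x * rnorm M y"
  using norm_rip_le_lnorm[of x y] by (simp add: lnorm_eq_rnorm)

lemma rnorm_eq_zero: "x \<in> bcarrier M \<Longrightarrow> rnorm M x = 0 \<Longrightarrow> x = bzero M"
  by (simp add: rnorm_def rip_definite)

lemma rnorm_scale: "x \<in> bcarrier M \<Longrightarrow> rnorm M (bscale M k x) = cmod k * rnorm M x"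
  by (rule power2_eq_imp_eq)
     (simp_all add: rnorm_square power_mult_distrib rip_linear closed norm_scaleC,
      simp add: power2_eq_square)

lemma rnorm_lact_le: "x \<in> bcarrier M \<Longrightarrow> rnorm M (lact M c x) \<le> norm c * rnorm M x"
  using norm_rip_lact_le[of x c]
  by - (rule power2_le_imp_le, simp_all add: rnorm_square power_mult_distrib)

lemma rnorm_ract_le: "x \<in> bcarrier M \<Longrightarrow> rnorm M (ract M x d) \<le> norm d * rnorm M x"
  using equivalence_bimodule.rnorm_lact_le[OF dual, of x "star d"]
  by (simp add: rnorm_dual dual_bimodule_simps lnorm_eq_rnorm ract_closed star_star norm_star)

lemma rnorm_add_le:
  assumes x: "x \<in> bcarrier M" and y: "y \<in> bcarrier M"
  shows "rnorm M (badd M x y) \<le> rnorm M x + rnorm M y"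
proof (rule power2_le_imp_le)
  have "rip M (badd M x y) (badd M x y) = (rip M x x + rip M y y) + (rip M x y + rip M y x)"
    using x y by (simp add: rip_linear closed)
  then have "norm (rip M (badd M x y) (badd M x y))
      \<le> (norm (rip M x x) + norm (rip M y y)) + (norm (rip M x y) + norm (rip M y x))"
    by (metis norm_triangle_mono norm_triangle_ineq)
  also have "\<dots> \<le> (rnorm M x + rnorm M y)\<^sup>2"
    using norm_rip_le[OF x y] norm_rip_le[OF y x]
    by (simp add: power2_sum mult.commute[of "rnorm M y"] flip: rnorm_square)
  finally show "(rnorm M (badd M x y))\<^sup>2 \<le> (rnorm M x + rnorm M y)\<^sup>2" by (simp add: rnorm_square)
qed simp

lemma diff_self: "x \<in> bcarrier M \<Longrightarrow> bdiff M x x = bzero M"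
  by (rule add_uminus)

lemma rnorm_zero [simp]: "rnorm M (bzero M) = 0"
  by (simp add: rnorm_def rip_zero_right zero_closed)

lemma rnorm_diff_commute:
  "x \<in> bcarrier M \<Longrightarrow> y \<in> bcarrier M \<Longrightarrow> rnorm M (bdiff M x y) = rnorm M (bdiff M y x)"
  unfolding rnorm_def by (simp add: rip_linear closed algebra_simps)

lemma rnorm_diff_triangle:
  assumes "x \<in> bcarrier M" "y \<in> bcarrier M" "z \<in> bcarrier M"
  shows "rnorm M (bdiff M x z) \<le> rnorm M (bdiff M x y) + rnorm M (bdiff M y z)"
proof -
  have "bdiff M x z = badd M (bdiff M x y) (bdiff M y z)"
    by (rule vector_eqI) (use assms in \<open>simp_all add: rip_linear closed\<close>)
  then show ?thesis using rnorm_add_le[of "bdiff M x y" "bdiff M y z"] assms by (simp add: closed)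
qed

definition converges :: "(nat \<Rightarrow> 'm) \<Rightarrow> 'm \<Rightarrow> bool" where
  "converges s x \<longleftrightarrow> (\<forall>i. s i \<in> bcarrier M) \<and> x \<in> bcarrier M \<and>
     (\<lambda>i. rnorm M (bdiff M (s i) x)) \<longlonglongrightarrow> 0"

lemma convergesI:
  assumes "\<And>i. s i \<in> bcarrier M" "x \<in> bcarrier M"
    and "\<And>i. rnorm M (bdiff M (s i) x) \<le> b i" "b \<longlonglongrightarrow> 0"
  shows "converges s x"
proof -
  have "(\<lambda>i. rnorm M (bdiff M (s i) x)) \<longlonglongrightarrow> 0"
    by (rule tendsto_sandwich[OF _ _ tendsto_const assms(4)]) (simp_all add: assms(3))
  then show ?thesis using assms(1,2) by (simp add: converges_def)
qed

lemma converges_const: "x \<in> bcarrier M \<Longrightarrow> converges (\<lambda>_. x) x"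
  by (simp add: converges_def diff_self)

text \<open>The form in which the Hausdorff quotient is used: sequences at distance tending to zero have the
  same limit.\<close>

lemma converges_unique:
  assumes "converges s x" "converges t y" "(\<lambda>i. rnorm M (bdiff M (s i) (t i))) \<longlonglongrightarrow> 0"
  shows "x = y"
proof -
  have c: "s i \<in> bcarrier M" "t i \<in> bcarrier M" "x \<in> bcarrier M" "y \<in> bcarrier M" for i
    using assms by (auto simp: converges_def)
  have "rnorm M (bdiff M x y)
      \<le> rnorm M (bdiff M (s i) x) + rnorm M (bdiff M (s i) (t i)) + rnorm M (bdiff M (t i) y)" for i
    using rnorm_diff_triangle[of x "s i" y] rnorm_diff_triangle[of "s i" "t i" y] c
      rnorm_diff_commute[of x "s i"] by force
  moreover have "(\<lambda>i. rnorm M (bdiff M (s i) x) + rnorm M (bdiff M (s i) (t i))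
      + rnorm M (bdiff M (t i) y)) \<longlonglongrightarrow> 0 + 0 + 0"
    using assms by (intro tendsto_add) (auto simp: converges_def)
  ultimately have "rnorm M (bdiff M x y) \<le> 0"
    by (intro LIMSEQ_le_const) auto
  then have "rnorm M (bdiff M x y) = 0" using rnorm_nonneg[of "bdiff M x y"] by linarith
  then show ?thesis using diff_eq_zeroD[OF c(3,4)] rnorm_eq_zero[OF diff_closed[OF c(3,4)]] by blast
qed

lemma converges_diff_null:
  assumes "converges s x" "converges t x"
  shows "(\<lambda>i. rnorm M (bdiff M (s i) (t i))) \<longlonglongrightarrow> 0"
proof (rule tendsto_sandwich[OF _ _ tendsto_const])
  have c: "s i \<in> bcarrier M" "t i \<in> bcarrier M" "x \<in> bcarrier M" for i
    using assms by (auto simp: converges_def)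
  show "\<forall>\<^sub>F i in sequentially. rnorm M (bdiff M (s i) (t i))
      \<le> rnorm M (bdiff M (s i) x) + rnorm M (bdiff M (t i) x)"
    using rnorm_diff_triangle[OF c(1,3,2)] rnorm_diff_commute[OF c(3,2)] by (simp add: always_eventually)
  show "(\<lambda>i. rnorm M (bdiff M (s i) x) + rnorm M (bdiff M (t i) x)) \<longlonglongrightarrow> 0"
    using assms by (auto simp: converges_def intro: tendsto_add_zero)
qed simp

lemma converges_add:
  assumes "converges s x" "converges t y"
  shows "converges (\<lambda>i. badd M (s i) (t i)) (badd M x y)"
proof (rule convergesI)
  have c: "s i \<in> bcarrier M" "t i \<in> bcarrier M" "x \<in> bcarrier M" "y \<in> bcarrier M" for i
    using assms by (auto simp: converges_def)
  then show "badd M (s i) (t i) \<in> bcarrier M" "badd M x y \<in> bcarrier M" for i by (simp_all add: closed)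
  show "rnorm M (bdiff M (badd M (s i) (t i)) (badd M x y))
      \<le> rnorm M (bdiff M (s i) x) + rnorm M (bdiff M (t i) y)" for i
  proof -
    have "bdiff M (badd M (s i) (t i)) (badd M x y) = badd M (bdiff M (s i) x) (bdiff M (t i) y)"
      by (rule vector_eqI) (use c in \<open>simp_all add: rip_linear closed\<close>)
    then show ?thesis using c by (simp add: rnorm_add_le closed)
  qed
  show "(\<lambda>i. rnorm M (bdiff M (s i) x) + rnorm M (bdiff M (t i) y)) \<longlonglongrightarrow> 0"
    using assms by (auto simp: converges_def intro: tendsto_add_zero)
qed

lemma converges_map:
  assumes s: "converges s x"
    and closed: "\<And>x. x \<in> bcarrier M \<Longrightarrow> h x \<in> bcarrier M"
    and diff: "\<And>x y. x \<in> bcarrier M \<Longrightarrow> y \<in> bcarrier M \<Longrightarrow> h (bdiff M x y) = bdiff M (h x) (h y)"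
    and bound: "\<And>x. x \<in> bcarrier M \<Longrightarrow> rnorm M (h x) \<le> K * rnorm M x"
  shows "converges (\<lambda>i. h (s i)) (h x)"
proof (rule convergesI)
  have c: "s i \<in> bcarrier M" "x \<in> bcarrier M" for i using s by (auto simp: converges_def)
  then show "h (s i) \<in> bcarrier M" "h x \<in> bcarrier M" for i by (simp_all add: closed)
  show "rnorm M (bdiff M (h (s i)) (h x)) \<le> K * rnorm M (bdiff M (s i) x)" for i
    using bound[of "bdiff M (s i) x"] c by (simp add: diff diff_closed)
  show "(\<lambda>i. K * rnorm M (bdiff M (s i) x)) \<longlonglongrightarrow> 0"
    using s tendsto_mult_right_zero by (auto simp: converges_def)
qed

lemma scale_diff: "x \<in> bcarrier M \<Longrightarrow> y \<in> bcarrier M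
    \<Longrightarrow> bscale M k (bdiff M x y) = bdiff M (bscale M k x) (bscale M k y)"
  by (rule vector_eqI) (simp_all add: rip_linear closed scaleC_diff_right)

lemma converges_scale:
  assumes "converges s x"
  shows "converges (\<lambda>i. bscale M k (s i)) (bscale M k x)"
  by (rule converges_map[OF assms, where K="cmod k"])
     (simp_all add: closed rnorm_scale scale_diff)

lemma lact_diff: "x \<in> bcarrier M \<Longrightarrow> y \<in> bcarrier M
    \<Longrightarrow> lact M c (bdiff M x y) = bdiff M (lact M c x) (lact M c y)"
  by (simp add: bdiff_def lact_add_right lact_scale_right closed)

lemma ract_diff: "x \<in> bcarrier M \<Longrightarrow> y \<in> bcarrier M
    \<Longrightarrow> ract M (bdiff M x y) d = bdiff M (ract M x d) (ract M y d)"
  by (simp add: bdiff_def ract_add_left ract_scale_left closed)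

lemma converges_lact:
  assumes "converges s x"
  shows "converges (\<lambda>i. lact M c (s i)) (lact M c x)"
  by (rule converges_map[OF assms, where K="norm c"]) (simp_all add: closed lact_diff rnorm_lact_le)

lemma converges_ract:
  assumes "converges s x"
  shows "converges (\<lambda>i. ract M (s i) d) (ract M x d)"
  by (rule converges_map[OF assms, where K="norm d"]) (simp_all add: closed ract_diff rnorm_ract_le)

lemma converges_rip:
  assumes "converges s x" "converges t y"
  shows "(\<lambda>i. rip M (s i) (t i)) \<longlonglongrightarrow> rip M x y"
proof (rule Lim_transform_bound[OF always_eventually, THEN LIM_zero_cancel, OF allI])
  have c: "s i \<in> bcarrier M" "t i \<in> bcarrier M" "x \<in> bcarrier M" "y \<in> bcarrier M" for i
    using assms by (auto simp: converges_def)
  let ?d = "\<lambda>i. bdiff M (s i) x" and ?e = "\<lambda>i. bdiff M (t i) y"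
  let ?b = "\<lambda>i. rnorm M (?d i) * rnorm M (?e i) + rnorm M (?d i) * rnorm M y + rnorm M x * rnorm M (?e i)"
  show "norm (rip M (s i) (t i) - rip M x y) \<le> norm (?b i)" for i
  proof -
    have eq: "rip M (s i) (t i) - rip M x y
        = rip M (?d i) (?e i) + rip M (?d i) y + rip M x (?e i)"
      using c by (simp add: rip_linear closed)
    have "norm (rip M (s i) (t i) - rip M x y)
        \<le> norm (rip M (?d i) (?e i)) + norm (rip M (?d i) y) + norm (rip M x (?e i))"
      unfolding eq using norm_triangle_ineq[of "rip M (?d i) (?e i) + rip M (?d i) y" "rip M x (?e i)"]
        norm_triangle_ineq[of "rip M (?d i) (?e i)" "rip M (?d i) y"] by linarith
    also have "\<dots> \<le> ?b i" using c by (intro add_mono norm_rip_le diff_closed)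
    also have "\<dots> \<le> norm (?b i)" by simp
    finally show ?thesis .
  qed
  have "?b \<longlonglongrightarrow> 0 * 0 + 0 * rnorm M y + rnorm M x * 0"
    using assms by (intro tendsto_intros) (auto simp: converges_def)
  then show "?b \<longlonglongrightarrow> 0" by simp
qed

end

lemma bdiff_dual: "bdiff (dual_bimodule M) = bdiff M"
  by (simp add: fun_eq_iff bdiff_def dual_bimodule_simps)

context equivalence_bimodule
begin

lemma converges_lip:
  assumes "converges s x" "converges t y"
  shows "(\<lambda>i. lip M (s i) (t i)) \<longlonglongrightarrow> lip M x y"
proof -
  interpret D: equivalence_bimodule "dual_bimodule M" by (rule dual)
  have "D.converges s x" "D.converges t y"
    using assms by (auto simp: D.converges_def converges_def dual_bimodule_simps rnorm_dual bdiff_dual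
      lnorm_eq_rnorm diff_closed)
  then show ?thesis using D.converges_rip[of s x t y] by (simp add: dual_bimodule_simps)
qed

end

section \<open>Finite sums in equivalence bimodules\<close>

lemma bsum_simps [simp]: "bsum M [] = bzero M" "bsum M (x # xs) = badd M x (bsum M xs)"
  by (simp_all add: bsum_def)

lemma sum_list_swap:
  fixes h :: "'i \<Rightarrow> 'j \<Rightarrow> 'a::comm_monoid_add"
  shows "(\<Sum>i\<leftarrow>is. \<Sum>j\<leftarrow>js. h i j) = (\<Sum>j\<leftarrow>js. \<Sum>i\<leftarrow>is. h i j)"
  by (induction "is") (simp_all add: sum_list_addf)

context equivalence_bimodule
begin

lemma bsum_closed: "set xs \<subseteq> bcarrier M \<Longrightarrow> bsum M xs \<in> bcarrier M"
  by (induction xs) (simp_all add: closed)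

lemma bsum_append: "set xs \<subseteq> bcarrier M \<Longrightarrow> set ys \<subseteq> bcarrier M
    \<Longrightarrow> bsum M (xs @ ys) = badd M (bsum M xs) (bsum M ys)"
proof (induction xs)
  case Nil
  then show ?case using add_commute[OF zero_closed bsum_closed] by (simp add: add_zero bsum_closed)
qed (simp add: add_assoc bsum_closed)

lemma rip_bsum: "x \<in> bcarrier M \<Longrightarrow> (\<And>i. i \<in> set is \<Longrightarrow> g i \<in> bcarrier M)
    \<Longrightarrow> rip M x (bsum M (map g is)) = (\<Sum>i\<leftarrow>is. rip M x (g i))"
  by (induction "is") (simp_all add: rip_linear bsum_closed image_subset_iff)

lemma lip_zero_left: "x \<in> bcarrier M \<Longrightarrow> lip M (bzero M) x = 0"
  using lip_scale[OF zero_closed, of x 0] by (simp add: scale_zero zero_closed)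

lemma lip_zero_right: "x \<in> bcarrier M \<Longrightarrow> lip M x (bzero M) = 0"
  using lip_scale_right[OF _ zero_closed, of x 0] by (simp add: scale_zero zero_closed)

lemma lact_bsum: "(\<And>i. i \<in> set is \<Longrightarrow> g i \<in> bcarrier M)
    \<Longrightarrow> lact M c (bsum M (map g is)) = bsum M (map (\<lambda>i. lact M c (g i)) is)"
  by (induction "is") (simp_all add: lact_zero_right lact_add_right bsum_closed image_subset_iff)

lemma ract_bsum: "(\<And>i. i \<in> set is \<Longrightarrow> g i \<in> bcarrier M)
    \<Longrightarrow> ract M (bsum M (map g is)) d = bsum M (map (\<lambda>i. ract M (g i) d) is)"
  by (induction "is") (simp_all add: ract_zero_left ract_add_left bsum_closed image_subset_iff)

lemma scale_bsum: "(\<And>i. i \<in> set is \<Longrightarrow> g i \<in> bcarrier M)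
    \<Longrightarrow> bscale M k (bsum M (map g is)) = bsum M (map (\<lambda>i. bscale M k (g i)) is)"
proof (induction "is")
  case Nil
  show ?case using scale_scale[OF zero_closed, of k 0] by (simp add: scale_zero zero_closed)
qed (simp add: scale_add_right bsum_closed image_subset_iff)

lemma bsum_lact: "x \<in> bcarrier M \<Longrightarrow> bsum M (map (\<lambda>i. lact M (g i) x) is) = lact M (\<Sum>i\<leftarrow>is. g i) x"
  by (induction "is") (simp_all add: lact_zero_left lact_add_left)

lemma bsum_ract: "x \<in> bcarrier M \<Longrightarrow> bsum M (map (\<lambda>i. ract M x (g i)) is) = ract M x (\<Sum>i\<leftarrow>is. g i)"
  by (induction "is") (simp_all add: ract_zero_right ract_add_right)

lemma bsum_swap:
  assumes "\<And>i j. i \<in> set is \<Longrightarrow> j \<in> set js \<Longrightarrow> g i j \<in> bcarrier M"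
  shows "bsum M (map (\<lambda>i. bsum M (map (g i) js)) is) = bsum M (map (\<lambda>j. bsum M (map (\<lambda>i. g i j) is)) js)"
proof (rule vector_eqI)
  have c: "bsum M (map (g i) js) \<in> bcarrier M" if "i \<in> set is" for i
    using assms that by (intro bsum_closed) auto
  have c': "bsum M (map (\<lambda>i. g i j) is) \<in> bcarrier M" if "j \<in> set js" for j
    using assms that by (intro bsum_closed) auto
  show "bsum M (map (\<lambda>i. bsum M (map (g i) js)) is) \<in> bcarrier M"
    "bsum M (map (\<lambda>j. bsum M (map (\<lambda>i. g i j) is)) js) \<in> bcarrier M"
    using c c' assms by (auto intro!: bsum_closed)
  fix w assume w: "w \<in> bcarrier M"
  have "rip M w (bsum M (map (\<lambda>i. bsum M (map (g i) js)) is)) = (\<Sum>i\<leftarrow>is. \<Sum>j\<leftarrow>js. rip M w (g i j))"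
    using w assms c by (simp add: rip_bsum cong: map_cong)
  also have "\<dots> = (\<Sum>j\<leftarrow>js. \<Sum>i\<leftarrow>is. rip M w (g i j))" by (rule sum_list_swap)
  also have "\<dots> = rip M w (bsum M (map (\<lambda>j. bsum M (map (\<lambda>i. g i j) is)) js))"
    using w assms c' by (simp add: rip_bsum cong: map_cong)
  finally show "rip M w (bsum M (map (\<lambda>i. bsum M (map (g i) js)) is))
    = rip M w (bsum M (map (\<lambda>j. bsum M (map (\<lambda>i. g i j) is)) js))" .
qed

lemma Cauchy_converges:
  assumes "\<And>i. s i \<in> bcarrier M" "\<forall>e>0. \<exists>K. \<forall>i\<ge>K. \<forall>j\<ge>K. rnorm M (bdiff M (s i) (s j)) < e"
  obtains x where "converges s x"
  using rcomplete assms unfolding complete_for_def converges_def by blast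

end

section \<open>Concrete models of tensor products\<close>

text \<open>A map \<open>\<Phi>\<close> on pairs, with values in a closed subspace \<open>V\<close> of an equivalence bimodule \<open>Y\<close>,
  that reproduces the inner products of elementary tensors and whose values span \<open>V\<close> identifies the
  tensor product of \<open>M\<close> and \<open>N\<close> with \<open>V\<close>. Left inner products have to agree; the right ones only up to
  a map \<open>f\<close>, because the tensor product may carry a right action of another algebra than \<open>Y\<close>: in
  \<open>A \<otimes>\<^sub>P Z\<close> the right inner products lie in \<open>Q\<close>, those of the corresponding vectors of \<open>Y\<close> in \<open>q D q\<close>.
  The two bounds by \<open>K\<close> make \<open>\<langle>y, y\<rangle>\<close> and its image under \<open>f\<close> comparable in norm, so that completion in
  either norm gives the same space.\<close>

locale tensor_model = equivalence_bimodule Y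
  for Y :: "('c::unital_cstar_algebra, 'y, 'd::unital_cstar_algebra) bimodule" +
  fixes M :: "('c, 'm, 'k) bimodule" and N :: "('k, 'n, 'e::unital_cstar_algebra) bimodule"
    and \<Phi> :: "'m \<Rightarrow> 'n \<Rightarrow> 'y" and f :: "'d \<Rightarrow> 'e" and V :: "'y set" and K :: real
  assumes V: "closed_subspace Y V"
    and map_closed: "m \<in> bcarrier M \<Longrightarrow> n \<in> bcarrier N \<Longrightarrow> \<Phi> m n \<in> V"
    and scale_left_closed: "m \<in> bcarrier M \<Longrightarrow> bscale M k m \<in> bcarrier M"
    and map_scale: "m \<in> bcarrier M \<Longrightarrow> n \<in> bcarrier N \<Longrightarrow> \<Phi> (bscale M k m) n = bscale Y k (\<Phi> m n)"
    and map_lip: "m \<in> bcarrier M \<Longrightarrow> n \<in> bcarrier N \<Longrightarrow> m' \<in> bcarrier M \<Longrightarrow> n' \<in> bcarrier N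
      \<Longrightarrow> lip M (ract M m (lip N n n')) m' = lip Y (\<Phi> m n) (\<Phi> m' n')"
    and map_rip: "m \<in> bcarrier M \<Longrightarrow> n \<in> bcarrier N \<Longrightarrow> m' \<in> bcarrier M \<Longrightarrow> n' \<in> bcarrier N
      \<Longrightarrow> rip N n (lact N (rip M m m') n') = f (rip Y (\<Phi> m n) (\<Phi> m' n'))"
    and f_add: "f (d + d') = f d + f d'"
    and f_bounded: "norm (f d) \<le> K * norm d"
    and f_bounded_below: "y \<in> V \<Longrightarrow> norm (rip Y y y) \<le> K * norm (f (rip Y y y))"
    and generated: "y \<in> V \<Longrightarrow> \<exists>v. set v \<subseteq> bcarrier M \<times> bcarrier N \<and> y = bsum Y (map (\<lambda>(m, n). \<Phi> m n) v)"
begin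

lemma f_zero [simp]: "f 0 = 0"
  using f_add[of 0 0] by simp

lemma f_tendsto:
  assumes "(\<lambda>i. d i) \<longlonglongrightarrow> l"
  shows "(\<lambda>i. f (d i)) \<longlonglongrightarrow> f l"
proof (rule LIM_zero_cancel, rule Lim_transform_bound[OF always_eventually, OF allI])
  have "f (d i) - f l = f (d i - l)" for i using f_add[of "d i - l" l] by simp
  then show "norm (f (d i) - f l) \<le> norm (K * norm (d i - l))" for i
    using f_bounded[of "d i - l"] by simp
  show "(\<lambda>i. K * norm (d i - l)) \<longlonglongrightarrow> 0"
    using assms by (intro tendsto_mult_right_zero) (simp add: LIM_zero tendsto_norm_zero)
qed

lemma V_sub: "x \<in> V \<Longrightarrow> x \<in> bcarrier Y"
  using V by (auto simp: closed_subspace_def)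

lemma V_ops: "bzero Y \<in> V" "x \<in> V \<Longrightarrow> y \<in> V \<Longrightarrow> badd Y x y \<in> V" "x \<in> V \<Longrightarrow> bscale Y k x \<in> V"
  using V by (auto simp: closed_subspace_def)

lemma V_limit: "converges s y \<Longrightarrow> (\<And>i. s i \<in> V) \<Longrightarrow> y \<in> V"
  using V unfolding closed_subspace_def converges_def by blast

text \<open>A list of pairs is a formal sum of elementary tensors; \<open>val\<close> is the vector of \<open>Y\<close> that it stands for.\<close>

definition formal :: "('m \<times> 'n) list \<Rightarrow> bool" where
  "formal v \<longleftrightarrow> set v \<subseteq> bcarrier M \<times> bcarrier N"

definition val :: "('m \<times> 'n) list \<Rightarrow> 'y" where
  "val v = bsum Y (map (\<lambda>(m, n). \<Phi> m n) v)"

lemma formal_simps [simp]: "formal []"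
  "formal ((m, n) # v) \<longleftrightarrow> m \<in> bcarrier M \<and> n \<in> bcarrier N \<and> formal v"
  "formal (v @ w) \<longleftrightarrow> formal v \<and> formal w"
  by (auto simp: formal_def)

lemma formal_pre_scale: "formal v \<Longrightarrow> formal (pre_scale M k v)"
  by (auto simp: formal_def pre_scale_def scale_left_closed)

lemma val_simps [simp]: "val [] = bzero Y" "val ((m, n) # v) = badd Y (\<Phi> m n) (val v)"
  by (simp_all add: val_def)

lemma formal_induct [consumes 1, case_names Nil Cons]:
  assumes "formal v" "P []"
    "\<And>m n v. m \<in> bcarrier M \<Longrightarrow> n \<in> bcarrier N \<Longrightarrow> formal v \<Longrightarrow> P v \<Longrightarrow> P ((m, n) # v)"
  shows "P v"
  using assms(1)
proof (induction v)
  case (Cons mn v)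
  then show ?case using assms(3) by (cases mn) auto
qed (rule assms(2))

lemma val_V: "formal v \<Longrightarrow> val v \<in> V"
  by (induction rule: formal_induct) (simp_all add: V_ops map_closed)

lemma val_closed: "formal v \<Longrightarrow> val v \<in> bcarrier Y"
  by (rule V_sub[OF val_V])

lemma map_closed': "m \<in> bcarrier M \<Longrightarrow> n \<in> bcarrier N \<Longrightarrow> \<Phi> m n \<in> bcarrier Y"
  by (rule V_sub[OF map_closed])

lemma val_append: "formal v \<Longrightarrow> formal w \<Longrightarrow> val (v @ w) = badd Y (val v) (val w)"
proof (induction rule: formal_induct)
  case Nil
  then show ?case using add_commute[OF zero_closed val_closed] by (simp add: add_zero val_closed)
qed (simp add: add_assoc val_closed map_closed')

lemma val_scale: "formal v \<Longrightarrow> val (pre_scale M k v) = bscale Y k (val v)"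
proof (induction rule: formal_induct)
  case Nil
  show ?case using scale_bsum[of "[]" undefined k] by (simp add: pre_scale_def)
qed (simp_all add: pre_scale_def map_scale scale_add_right map_closed' val_closed)

lemma pre_lip_eq:
  assumes "formal v" "formal w"
  shows "pre_lip M N v w = lip Y (val v) (val w)"
proof -
  have 1: "(\<Sum>(m', n')\<leftarrow>w. lip M (ract M m (lip N n n')) m') = lip Y (\<Phi> m n) (val w)"
    if "m \<in> bcarrier M" "n \<in> bcarrier N" for m n
    using assms(2)
    by (induction rule: formal_induct)
       (simp_all add: that lip_zero_right lip_add_right map_lip map_closed' val_closed)
  show ?thesis
    using assms(1)
    by (induction rule: formal_induct)
       (simp_all add: pre_lip_def 1 lip_zero_left lip_add val_closed map_closed' assms(2))
qed

lemma pre_rip_eq: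
  assumes "formal v" "formal w"
  shows "pre_rip M N v w = f (rip Y (val v) (val w))"
proof -
  have 1: "(\<Sum>(m', n')\<leftarrow>w. rip N n (lact N (rip M m m') n')) = f (rip Y (\<Phi> m n) (val w))"
    if "m \<in> bcarrier M" "n \<in> bcarrier N" for m n
    using assms(2)
    by (induction rule: formal_induct)
       (simp_all add: that rip_linear map_rip map_closed' val_closed f_add)
  show ?thesis
    using assms(1)
    by (induction rule: formal_induct)
       (simp_all add: pre_rip_def 1 rip_linear f_add val_closed map_closed' assms(2))
qed

lemma pre_dist_eq:
  assumes "formal v" "formal w"
  shows "pre_dist M N v w = sqrt (norm (f (rip Y (bdiff Y (val v) (val w)) (bdiff Y (val v) (val w)))))"
  using assms by (simp add: pre_dist_def pre_rip_eq formal_pre_scale val_append val_scale bdiff_def)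

lemma pre_dist_nonneg: "0 \<le> pre_dist M N v w"
  by (simp add: pre_dist_def Let_def)

lemma V_diff: "x \<in> V \<Longrightarrow> y \<in> V \<Longrightarrow> bdiff Y x y \<in> V"
  by (simp add: bdiff_def V_ops)

lemma pre_dist_le:
  assumes "formal v" "formal w"
  shows "pre_dist M N v w \<le> sqrt K * rnorm Y (bdiff Y (val v) (val w))"
  using f_bounded unfolding pre_dist_eq[OF assms] by (simp add: rnorm_def flip: real_sqrt_mult)

lemma rnorm_le_pre_dist:
  assumes "formal v" "formal w"
  shows "rnorm Y (bdiff Y (val v) (val w)) \<le> sqrt K * pre_dist M N v w"
  unfolding pre_dist_eq[OF assms] using assms
  by (simp add: rnorm_def f_bounded_below V_diff val_V flip: real_sqrt_mult)

lemma pre_Cauchy_converges: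
  assumes "s \<in> pre_Cauchy M N"
  obtains y where "y \<in> V" "converges (\<lambda>i. val (s i)) y"
proof -
  have s: "formal (s i)" for i using assms by (simp add: pre_Cauchy_def formal_def)
  have "\<forall>e>0. \<exists>J. \<forall>i\<ge>J. \<forall>j\<ge>J. rnorm Y (bdiff Y (val (s i)) (val (s j))) < e"
  proof (intro allI impI)
    fix e :: real assume e: "e > 0"
    define L where "L = \<bar>sqrt K\<bar> + 1"
    have L: "L > 0" by (simp add: L_def)
    obtain J where J: "\<And>i j. i \<ge> J \<Longrightarrow> j \<ge> J \<Longrightarrow> pre_dist M N (s i) (s j) < e / L"
      using assms e L unfolding pre_Cauchy_def by (simp add: ) (metis divide_pos_pos)
    have "rnorm Y (bdiff Y (val (s i)) (val (s j))) < e" if ij: "i \<ge> J" "j \<ge> J" for i j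
    proof -
      have "rnorm Y (bdiff Y (val (s i)) (val (s j))) \<le> sqrt K * pre_dist M N (s i) (s j)"
        by (rule rnorm_le_pre_dist[OF s s])
      also have "\<dots> \<le> L * pre_dist M N (s i) (s j)"
        by (intro mult_right_mono) (simp_all add: L_def pre_dist_def Let_def)
      also have "\<dots> < L * (e / L)" using J[OF ij] L by (simp only: mult_strict_left_mono)
      finally show ?thesis using L by simp
    qed
    then show "\<exists>J. \<forall>i\<ge>J. \<forall>j\<ge>J. rnorm Y (bdiff Y (val (s i)) (val (s j))) < e" by blast
  qed
  then obtain y where "converges (\<lambda>i. val (s i)) y" using Cauchy_converges val_closed[OF s] by metis
  then show thesis using that V_limit val_V[OF s] by blast
qed

lemma converges_pre_Cauchy:
  assumes s: "\<And>i. formal (s i)" and y: "converges (\<lambda>i. val (s i)) y"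
  shows "s \<in> pre_Cauchy M N"
proof -
  have yc: "y \<in> bcarrier Y" using y by (simp add: converges_def)
  have "\<exists>J. \<forall>i\<ge>J. \<forall>j\<ge>J. pre_dist M N (s i) (s j) < e" if e: "e > 0" for e
  proof -
    define L where "L = \<bar>sqrt K\<bar> + 1"
    have L: "L > 0" by (simp add: L_def)
    have "(\<lambda>i. rnorm Y (bdiff Y (val (s i)) y)) \<longlonglongrightarrow> 0" using y by (simp add: converges_def)
    then have "\<forall>\<^sub>F i in sequentially. rnorm Y (bdiff Y (val (s i)) y) < e / (2 * L)"
      using e L by (intro order_tendstoD(2)) auto
    then obtain J where J: "\<And>i. i \<ge> J \<Longrightarrow> rnorm Y (bdiff Y (val (s i)) y) < e / (2 * L)"
      by (auto simp: eventually_sequentially)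
    have "pre_dist M N (s i) (s j) < e" if ij: "i \<ge> J" "j \<ge> J" for i j
    proof -
      have "rnorm Y (bdiff Y (val (s i)) (val (s j)))
          \<le> rnorm Y (bdiff Y (val (s i)) y) + rnorm Y (bdiff Y (val (s j)) y)"
        using rnorm_diff_triangle[OF val_closed[OF s, of i] yc val_closed[OF s, of j]]
          rnorm_diff_commute[OF yc val_closed[OF s, of j]] by simp
      also have "\<dots> < e / (2 * L) + e / (2 * L)" using J ij by (intro add_strict_mono) auto
      also have "\<dots> = e / L" by simp
      finally have "L * rnorm Y (bdiff Y (val (s i)) (val (s j))) < L * (e / L)"
        using L by (simp only: mult_strict_left_mono)
      moreover have "sqrt K * rnorm Y (bdiff Y (val (s i)) (val (s j)))
          \<le> L * rnorm Y (bdiff Y (val (s i)) (val (s j)))"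
        by (intro mult_right_mono) (simp_all add: L_def)
      ultimately show ?thesis using pre_dist_le[OF s s, of i j] L by simp
    qed
    then show ?thesis by blast
  qed
  then show ?thesis using s by (simp add: pre_Cauchy_def formal_def)
qed

text \<open>The inverse of the map that sends an element of the tensor product to the limit of the values of
  its representing sequences. All representatives are collected, so \<open>cls y\<close> is equal, as a set, to a tensor
  class.\<close>

definition cls :: "'y \<Rightarrow> (nat \<Rightarrow> ('m \<times> 'n) list) set" where
  "cls y = {s. (\<forall>i. formal (s i)) \<and> converges (\<lambda>i. val (s i)) y}"

lemma tensor_class_eq:
  assumes s: "\<And>i. formal (s i)" and y: "converges (\<lambda>i. val (s i)) y"
  shows "tensor_class M N s = cls y"
proof (intro set_eqI iffI)
  fix t assume t: "t \<in> tensor_class M N s"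
  then have tc: "t \<in> pre_Cauchy M N" and lim: "(\<lambda>i. pre_dist M N (s i) (t i)) \<longlonglongrightarrow> 0"
    by (auto simp: tensor_class_def)
  have tf: "formal (t i)" for i using tc by (simp add: pre_Cauchy_def formal_def)
  obtain z where z: "converges (\<lambda>i. val (t i)) z" using pre_Cauchy_converges[OF tc] by blast
  have "(\<lambda>i. rnorm Y (bdiff Y (val (s i)) (val (t i)))) \<longlonglongrightarrow> 0"
    by (rule tendsto_sandwich[OF _ _ tendsto_const tendsto_mult_right_zero[OF lim, of "sqrt K"]])
       (simp_all add: rnorm_le_pre_dist s tf)
  then have "y = z" by (rule converges_unique[OF y z])
  then show "t \<in> cls y" using z tf by (simp add: cls_def)
next
  fix t assume t: "t \<in> cls y"
  then have tf: "\<And>i. formal (t i)" and ty: "converges (\<lambda>i. val (t i)) y" by (auto simp: cls_def)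
  have lim: "(\<lambda>i. rnorm Y (bdiff Y (val (s i)) (val (t i)))) \<longlonglongrightarrow> 0"
    by (rule converges_diff_null[OF y ty])
  have "(\<lambda>i. pre_dist M N (s i) (t i)) \<longlonglongrightarrow> 0"
    by (rule tendsto_sandwich[OF _ _ tendsto_const tendsto_mult_right_zero[OF lim, of "sqrt K"]])
       (simp_all add: pre_dist_le s tf pre_dist_nonneg)
  then show "t \<in> tensor_class M N s"
    using converges_pre_Cauchy[OF tf ty] by (simp add: tensor_class_def)
qed

lemma class_rep_cls:
  assumes "y \<in> V"
  shows "class_rep (cls y) \<in> cls y"
proof -
  obtain v where "formal v" "y = val v" using generated[OF assms] by (auto simp: formal_def val_def)
  then have "(\<lambda>_. v) \<in> cls y" by (simp add: cls_def converges_const val_closed)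
  then have "\<exists>s. s \<in> cls y" by blast
  then show ?thesis unfolding class_rep_def by (rule someI_ex)
qed

lemma class_rep_cls':
  assumes "y \<in> V"
  shows "formal (class_rep (cls y) i)" "converges (\<lambda>i. val (class_rep (cls y) i)) y"
  using class_rep_cls[OF assms] by (auto simp: cls_def)

lemma cls_inj: "inj_on cls V"
proof (rule inj_onI)
  fix x y assume xy: "x \<in> V" "y \<in> V" "cls x = cls y"
  then have "converges (\<lambda>i. val (class_rep (cls x) i)) y" using class_rep_cls'(2)[of y] by simp
  then show "x = y" using converges_unique[OF class_rep_cls'(2)[OF xy(1)]] converges_diff_null by blast
qed

lemma tensor_carrier: "bcarrier (bimodule_tensor M N) = cls ` V"
proof -
  have "tensor_class M N s \<in> cls ` V" if s: "s \<in> pre_Cauchy M N" for s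
  proof -
    obtain y where "y \<in> V" "converges (\<lambda>i. val (s i)) y" using pre_Cauchy_converges[OF s] .
    moreover have "\<And>i. formal (s i)" using s by (simp add: pre_Cauchy_def formal_def)
    ultimately show ?thesis using tensor_class_eq by blast
  qed
  moreover have "cls y \<in> tensor_class M N ` pre_Cauchy M N" if "y \<in> V" for y
    using tensor_class_eq[OF class_rep_cls'[OF that]] converges_pre_Cauchy[OF class_rep_cls'[OF that]] by blast
  ultimately show ?thesis by (auto simp: bimodule_tensor_def)
qed

lemma tensor_zero: "bzero (bimodule_tensor M N) = cls (bzero Y)"
  by (simp add: bimodule_tensor_def tensor_class_eq converges_const zero_closed)

lemma tensor_add: "x \<in> V \<Longrightarrow> y \<in> V \<Longrightarrow> badd (bimodule_tensor M N) (cls x) (cls y) = cls (badd Y x y)"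
  by (simp add: bimodule_tensor_def tensor_class_eq class_rep_cls' val_append converges_add)

lemma tensor_scale: "x \<in> V \<Longrightarrow> bscale (bimodule_tensor M N) k (cls x) = cls (bscale Y k x)"
  by (simp add: bimodule_tensor_def tensor_class_eq class_rep_cls' val_scale converges_scale formal_pre_scale)

lemma tensor_lact:
  assumes x: "x \<in> V"
    and closed: "\<And>m. m \<in> bcarrier M \<Longrightarrow> lact M c m \<in> bcarrier M"
    and eq: "\<And>m n. m \<in> bcarrier M \<Longrightarrow> n \<in> bcarrier N \<Longrightarrow> \<Phi> (lact M c m) n = lact Y c (\<Phi> m n)"
  shows "lact (bimodule_tensor M N) c (cls x) = cls (lact Y c x)"
proof -
  let ?h = "map (\<lambda>(m, n). (lact M c m, n))"
  have "formal (?h v) \<and> val (?h v) = lact Y c (val v)" if "formal v" for v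
    using that by (induction rule: formal_induct)
      (simp_all add: closed eq lact_zero_right lact_add_right val_closed map_closed')
  then show ?thesis using x
    by (simp add: bimodule_tensor_def tensor_class_eq class_rep_cls' converges_lact)
qed

lemma tensor_ract:
  assumes x: "x \<in> V"
    and closed: "\<And>n. n \<in> bcarrier N \<Longrightarrow> ract N n d \<in> bcarrier N"
    and eq: "\<And>m n. m \<in> bcarrier M \<Longrightarrow> n \<in> bcarrier N \<Longrightarrow> \<Phi> m (ract N n d) = ract Y (\<Phi> m n) d'"
  shows "ract (bimodule_tensor M N) (cls x) d = cls (ract Y x d')"
proof -
  let ?h = "map (\<lambda>(m, n). (m, ract N n d))"
  have "formal (?h v) \<and> val (?h v) = ract Y (val v) d'" if "formal v" for v
    using that by (induction rule: formal_induct)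
      (simp_all add: closed eq ract_zero_left ract_add_left val_closed map_closed')
  then show ?thesis using x
    by (simp add: bimodule_tensor_def tensor_class_eq class_rep_cls' converges_ract)
qed

lemma tensor_lip:
  assumes "x \<in> V" "y \<in> V"
  shows "lip (bimodule_tensor M N) (cls x) (cls y) = lip Y x y"
  using limI[OF converges_lip[OF class_rep_cls'(2)[OF assms(1)] class_rep_cls'(2)[OF assms(2)]]] assms
  by (simp add: bimodule_tensor_def pre_lip_eq class_rep_cls')

lemma tensor_rip:
  assumes "x \<in> V" "y \<in> V"
  shows "rip (bimodule_tensor M N) (cls x) (cls y) = f (rip Y x y)"
  using limI[OF f_tendsto[OF converges_rip[OF class_rep_cls'(2)[OF assms(1)] class_rep_cls'(2)[OF assms(2)]]]] assms
  by (simp add: bimodule_tensor_def pre_rip_eq class_rep_cls')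

lemma tensor_elementary:
  "m \<in> bcarrier M \<Longrightarrow> n \<in> bcarrier N \<Longrightarrow> elementary_tensor M N m n = cls (\<Phi> m n)"
  using add_zero[OF map_closed'] unfolding elementary_tensor_def
  by (intro tensor_class_eq) (simp_all add: converges_const map_closed')

end

text \<open>The completed tensor product is not known beforehand to be an equivalence bimodule; it inherits
  the axioms from its model.\<close>

lemma equivalence_bimodule_transport:
  fixes Y :: "('c::unital_cstar_algebra, 'y, 'd::unital_cstar_algebra) bimodule"
    and U :: "('c, 'u, 'd) bimodule"
  assumes Y: "equivalence_bimodule Y"
    and carrier: "bcarrier U = \<theta> ` bcarrier Y" and inj: "inj_on \<theta> (bcarrier Y)"
    and zero: "bzero U = \<theta> (bzero Y)"
    and add: "\<And>x y. x \<in> bcarrier Y \<Longrightarrow> y \<in> bcarrier Y \<Longrightarrow> badd U (\<theta> x) (\<theta> y) = \<theta> (badd Y x y)"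
    and scale: "\<And>x k. x \<in> bcarrier Y \<Longrightarrow> bscale U k (\<theta> x) = \<theta> (bscale Y k x)"
    and lact: "\<And>x c. x \<in> bcarrier Y \<Longrightarrow> lact U c (\<theta> x) = \<theta> (lact Y c x)"
    and ract: "\<And>x d. x \<in> bcarrier Y \<Longrightarrow> ract U (\<theta> x) d = \<theta> (ract Y x d)"
    and lip: "\<And>x y. x \<in> bcarrier Y \<Longrightarrow> y \<in> bcarrier Y \<Longrightarrow> lip U (\<theta> x) (\<theta> y) = lip Y x y"
    and rip: "\<And>x y. x \<in> bcarrier Y \<Longrightarrow> y \<in> bcarrier Y \<Longrightarrow> rip U (\<theta> x) (\<theta> y) = rip Y x y"
  shows "equivalence_bimodule U" "bimodule_isomorphism Y U \<theta>"
proof -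
  interpret Y: equivalence_bimodule Y by (rule Y)
  note ops = zero add scale lact ract lip rip
  have diff: "bdiff U (\<theta> x) (\<theta> y) = \<theta> (bdiff Y x y)" if "x \<in> bcarrier Y" "y \<in> bcarrier Y" for x y
    using that by (simp add: bdiff_def ops Y.closed)
  have norms: "rnorm U (\<theta> x) = rnorm Y x" "lnorm U (\<theta> x) = lnorm Y x" if "x \<in> bcarrier Y" for x
    using that by (simp_all add: rnorm_def lnorm_def ops)
  have complete: "complete_for nU U"
    if cY: "complete_for nY Y" and n: "\<And>x. x \<in> bcarrier Y \<Longrightarrow> nU (\<theta> x) = nY x" for nU nY
    unfolding complete_for_def
  proof (intro allI impI, elim conjE)
    fix s :: "nat \<Rightarrow> 'u"
    assume s: "\<forall>k. s k \<in> bcarrier U"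
      and C: "\<forall>e>0. \<exists>K. \<forall>i\<ge>K. \<forall>j\<ge>K. nU (bdiff U (s i) (s j)) < e"
    from s have "\<forall>k. \<exists>x. x \<in> bcarrier Y \<and> s k = \<theta> x" by (auto simp: carrier)
    then obtain t where t: "\<And>k. t k \<in> bcarrier Y" "\<And>k. s k = \<theta> (t k)" by metis
    have "\<forall>e>0. \<exists>K. \<forall>i\<ge>K. \<forall>j\<ge>K. nY (bdiff Y (t i) (t j)) < e"
      using C by (simp add: t diff n Y.diff_closed)
    then obtain x where "x \<in> bcarrier Y" "(\<lambda>k. nY (bdiff Y (t k) x)) \<longlonglongrightarrow> 0"
      using cY t(1) unfolding complete_for_def by blast
    then show "\<exists>x\<in>bcarrier U. (\<lambda>k. nU (bdiff U (s k) x)) \<longlonglongrightarrow> 0"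
      by (intro bexI[of _ "\<theta> x"]) (simp_all add: t diff n Y.diff_closed carrier)
  qed
  have full: "{lip U x y | x y. x \<in> bcarrier U \<and> y \<in> bcarrier U}
      = {lip Y x y | x y. x \<in> bcarrier Y \<and> y \<in> bcarrier Y}"
    "{rip U x y | x y. x \<in> bcarrier U \<and> y \<in> bcarrier U}
      = {rip Y x y | x y. x \<in> bcarrier Y \<and> y \<in> bcarrier Y}"
    apply (auto simp: carrier lip rip)
    apply blast apply (metis lip imageI) apply blast apply (metis rip imageI)
    done
  show U: "equivalence_bimodule U"
    apply unfold_locales
    apply (unfold full)
    apply (simp_all only: Y.lip_full Y.rip_full)
    apply (simp_all only: complete[OF Y.lcomplete norms(2)] complete[OF Y.rcomplete norms(1)])
    apply (use carrier inj in \<open>auto simp: ops Y.closed Y.scale_add_right Y.scale_add_left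
      Y.scale_scale Y.scale_one Y.lact_add_right Y.lact_add_left Y.lact_scale_right Y.lact_scale_left Y.lact_mult Y.lact_one
      Y.ract_add_left Y.ract_add_right Y.ract_scale_left Y.ract_scale_right Y.ract_mult Y.ract_one
      Y.lact_ract Y.lip_add Y.lip_scale Y.lip_lact Y.lip_star Y.lip_positive Y.rip_add Y.rip_scale Y.rip_ract
      Y.rip_star Y.rip_positive Y.lip_ract Y.rip_lact Y.compatible Y.add_zero Y.add_assoc diff Y.add_uminus
      intro: arg_cong[OF Y.add_commute] dest: Y.lip_definite Y.rip_definite\<close>)
    done
  have "bij_betw \<theta> (bcarrier Y) (bcarrier U)" using inj by (simp add: bij_betw_def carrier)
  then show "bimodule_isomorphism Y U \<theta>"
    using U Y by (simp add: bimodule_isomorphism_def ops)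
qed

section \<open>Expectations of finite index and Jones projections\<close>

lemma module_scaleC: "module (scaleC :: complex \<Rightarrow> 'a::unital_cstar_algebra \<Rightarrow> 'a)"
  by unfold_locales (simp_all add: scaleC_add_right scaleC_add_left scaleC_scaleC scaleC_one)

lemma cspan_induct [consumes 1, case_names zero add scale base]:
  assumes "x \<in> cspan S" "P 0" "\<And>x y. P x \<Longrightarrow> P y \<Longrightarrow> P (x + y)" "\<And>c x. P x \<Longrightarrow> P (c *\<^sub>C x)"
    "\<And>x. x \<in> S \<Longrightarrow> P x"
  shows "P x"
proof -
  interpret module "scaleC :: complex \<Rightarrow> 'a \<Rightarrow> 'a" by (rule module_scaleC)
  have "subspace (Collect P)" using assms(2-4) by (intro subspaceI) auto
  then show ?thesis using assms(1,5) span_induct[of x S P] by (simp add: cspan_def)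
qed

lemma cinverse_eq: "a * b = 1 \<Longrightarrow> b * a = 1 \<Longrightarrow> cinverse a = b"
  unfolding cinverse_def by (rule the_equality) (auto, metis mult.assoc mult_1_left mult_1_right)

text \<open>Expanding each member of one quasi-basis in the other one shows that the index is the same for both.\<close>

lemma Ind_W_eq:
  fixes N :: "'c::unital_cstar_algebra set"
  assumes us: "quasi_basis N E us" and star: "\<And>c. c \<in> N \<Longrightarrow> star c \<in> N"
  shows "Ind_W N E = (\<Sum>u\<leftarrow>us. u * star u)"
proof -
  have eq: "(\<Sum>v\<leftarrow>vs. v * star v) = (\<Sum>u\<leftarrow>us. u * star u)" if vs: "quasi_basis N E vs" for vs
  proof -
    have "(\<Sum>u\<leftarrow>us. u * star u) = (\<Sum>u\<leftarrow>us. (\<Sum>v\<leftarrow>vs. v * E (star v * u)) * star u)"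
      using us vs by (intro arg_cong[of _ _ sum_list] map_cong) (auto simp: quasi_basis_def)
    also have "\<dots> = (\<Sum>u\<leftarrow>us. \<Sum>v\<leftarrow>vs. v * (E (star v * u) * star u))"
      by (simp add: sum_list_mult_const[symmetric] mult.assoc)
    also have "\<dots> = (\<Sum>v\<leftarrow>vs. \<Sum>u\<leftarrow>us. v * (E (star v * u) * star u))" by (rule sum_list_swap)
    also have "\<dots> = (\<Sum>v\<leftarrow>vs. v * (\<Sum>u\<leftarrow>us. E (star v * u) * star u))"
      by (simp add: sum_list_const_mult)
    also have "\<dots> = (\<Sum>v\<leftarrow>vs. v * star v)"
      using us vs star by (intro arg_cong[of _ _ sum_list] map_cong) (auto simp: quasi_basis_def)
    finally show ?thesis by simp
  qed
  show ?thesis unfolding Ind_W_def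
    by (rule the_equality) (use us eq in blast)+
qed

locale finite_index_expectation =
  fixes A :: "'c::unital_cstar_algebra set" and E :: "'c \<Rightarrow> 'c"
  assumes subalgebra: "unital_cstar_subalgebra A"
    and expectation: "conditional_expectation A E"
    and finite_index: "index_finite UNIV E"
begin

definition ind :: 'c where "ind = Ind_W UNIV E"

lemma A_closed: "1 \<in> A" "a \<in> A \<Longrightarrow> b \<in> A \<Longrightarrow> a + b \<in> A" "a \<in> A \<Longrightarrow> b \<in> A \<Longrightarrow> a * b \<in> A"
  "a \<in> A \<Longrightarrow> star a \<in> A" "a \<in> A \<Longrightarrow> c *\<^sub>C a \<in> A"
  using subalgebra by (auto simp: unital_cstar_subalgebra_def)

lemma A_zero: "0 \<in> A"
  using A_closed(5)[OF A_closed(1), of 0] by simp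

lemma A_sum_list: "(\<And>x. x \<in> set xs \<Longrightarrow> g x \<in> A) \<Longrightarrow> (\<Sum>x\<leftarrow>xs. g x) \<in> A"
  by (induction xs) (simp_all add: A_closed A_zero)

lemma E_linear: "E (c + c') = E c + E c'" "E (k *\<^sub>C c) = k *\<^sub>C E c"
  and E_closed: "E c \<in> A" and E_fix: "a \<in> A \<Longrightarrow> E a = a" and E_norm: "norm (E c) \<le> norm c"
  and E_module: "a \<in> A \<Longrightarrow> E (a * c) = a * E c" "a \<in> A \<Longrightarrow> E (c * a) = E c * a"
  and E_positive: "sqpos c \<Longrightarrow> sqpos (E c)"
  using expectation by (auto simp: conditional_expectation_def cpositive_iff_sqpos)

lemma E_zero [simp]: "E 0 = 0"
  by (rule E_fix[OF A_zero])

lemma E_scaleR: "E (r *\<^sub>R c) = r *\<^sub>R E c"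
  by (simp add: scaleR_scaleC E_linear)

lemma E_diff: "E (c - c') = E c - E c'"
  using E_linear(1)[of "c - c'" c'] by simp

lemma E_sum_list: "E (\<Sum>x\<leftarrow>xs. g x) = (\<Sum>x\<leftarrow>xs. E (g x))"
  by (induction xs) (simp_all add: E_linear)

text \<open>A selfadjoint \<open>h\<close> is the difference of the squares of \<open>(h + 1)/2\<close> and \<open>(h - 1)/2\<close>, so positivity of
  \<open>E\<close> makes \<open>E h\<close> selfadjoint.\<close>

lemma E_star: "E (star c) = star (E c)"
proof -
  have sa: "star (E h) = E h" if h: "star h = h" for h
  proof -
    have h4: "4 *\<^sub>R h = (h + 1) * (h + 1) - (h - 1) * (h - 1)"
      using scaleR_add_left[of 2 2 h] by (simp add: algebra_simps scaleR_2)
    have "star (h + 1) = h + 1" "star (h - 1) = h - 1" using h by (simp_all add: star_add star_diff)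
    then have "sqpos ((h + 1) * (h + 1))" "sqpos ((h - 1) * (h - 1))" by (metis sqpos_def)+
    then have "star (E (4 *\<^sub>R h)) = E (4 *\<^sub>R h)"
      unfolding h4 E_diff star_diff by (simp add: E_positive sqpos_selfadjoint)
    then show ?thesis by (simp add: E_scaleR star_scaleR)
  qed
  define h where "h = (1/2) *\<^sub>R (c + star c)"
  define g where "g = (- \<i> / 2) *\<^sub>C (c - star c)"
  have h: "star h = h" by (simp add: h_def star_scaleR star_add star_star add.commute)
  have "star g = (\<i> / 2) *\<^sub>C (- (c - star c))" by (simp add: g_def star_scaleC star_diff star_star)
  also have "\<dots> = g" by (simp only: g_def scaleC_minus_right) (simp add: scaleC_minus_left)
  finally have g: "star g = g" .
  have ig: "\<i> *\<^sub>C g = (1/2) *\<^sub>R (c - star c)" by (simp add: g_def scaleC_scaleC scaleR_scaleC)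
  have half: "(1/2) *\<^sub>R x + (1/2) *\<^sub>R x = x" for x :: 'c by (simp flip: scaleR_add_left)
  have c: "c = h + \<i> *\<^sub>C g" unfolding ig h_def using half[of c] by (simp add: algebra_simps)
  have c': "star c = h - \<i> *\<^sub>C g" unfolding ig h_def using half[of "star c"] by (simp add: algebra_simps)
  have "E c = E h + \<i> *\<^sub>C E g" using arg_cong[OF c, of E] by (simp add: E_linear)
  then have "star (E c) = E h - \<i> *\<^sub>C E g"
    by (simp add: star_add star_scaleC sa[OF h] sa[OF g] scaleC_minus_left)
  then show ?thesis unfolding c' by (simp add: E_linear E_diff)
qed

lemma quasi_basis_UNIV:
  obtains us where "\<And>c. (\<Sum>u\<leftarrow>us. u * E (star u * c)) = c" "\<And>c. (\<Sum>u\<leftarrow>us. E (c * u) * star u) = c"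
    "ind = (\<Sum>u\<leftarrow>us. u * star u)"
proof -
  obtain us where us: "quasi_basis UNIV E us" using finite_index by (auto simp: index_finite_def)
  show thesis using us Ind_W_eq[OF us] by (intro that[of us]) (simp_all add: quasi_basis_def ind_def)
qed

lemma ind_central: "c * ind = ind * c"
proof -
  obtain us where us: "\<And>c. (\<Sum>u\<leftarrow>us. u * E (star u * c)) = c" "\<And>c. (\<Sum>u\<leftarrow>us. E (c * u) * star u) = c"
    "ind = (\<Sum>u\<leftarrow>us. u * star u)" using quasi_basis_UNIV by metis
  have "c * ind = (\<Sum>u\<leftarrow>us. c * u * star u)" by (simp add: us(3) mult.assoc flip: sum_list_const_mult)
  also have "\<dots> = (\<Sum>u\<leftarrow>us. (\<Sum>v\<leftarrow>us. v * E (star v * (c * u))) * star u)" by (simp only: us(1))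
  also have "\<dots> = (\<Sum>u\<leftarrow>us. \<Sum>v\<leftarrow>us. v * (E (star v * c * u) * star u))"
    by (simp add: sum_list_mult_const[symmetric] mult.assoc)
  also have "\<dots> = (\<Sum>v\<leftarrow>us. \<Sum>u\<leftarrow>us. v * (E (star v * c * u) * star u))" by (rule sum_list_swap)
  also have "\<dots> = (\<Sum>v\<leftarrow>us. v * (star v * c))" by (simp add: sum_list_const_mult us(2))
  also have "\<dots> = ind * c" by (simp add: us(3) mult.assoc flip: sum_list_mult_const)
  finally show ?thesis .
qed

lemma ind_commute: "c * (ind * d) = ind * (c * d)"
  by (metis ind_central mult.assoc)

lemma ind_selfadjoint: "star ind = ind"
  by (rule quasi_basis_UNIV) (simp add: star_sum_list star_mult star_star)

text \<open>The index is at least \<open>1\<close>: \<open>\<Sum> (u - E u)(u - E u)\<^sup>*\<close> equals the index minus \<open>1\<close>.\<close>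

lemma ind_invertible:
  obtains b where "ind * b = 1" "b * ind = 1"
proof -
  obtain us where us: "\<And>c. (\<Sum>u\<leftarrow>us. u * E (star u * c)) = c" "\<And>c. (\<Sum>u\<leftarrow>us. E (c * u) * star u) = c"
    "ind = (\<Sum>u\<leftarrow>us. u * star u)" using quasi_basis_UNIV by metis
  have "(\<Sum>u\<leftarrow>us. (u - E u) * star (u - E u))
      = (\<Sum>u\<leftarrow>us. u * star u) - (\<Sum>u\<leftarrow>us. u * E (star u)) - (\<Sum>u\<leftarrow>us. E u * star u)
        + (\<Sum>u\<leftarrow>us. E u * E (star u))"
    by (induction us) (simp_all add: algebra_simps star_diff E_star)
  also have "(\<Sum>u\<leftarrow>us. E u * E (star u)) = E (\<Sum>u\<leftarrow>us. E u * star u)"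
    by (simp add: E_sum_list E_module E_closed)
  also have "(\<Sum>u\<leftarrow>us. u * E (star u)) = 1" using us(1)[of 1] by simp
  also have "(\<Sum>u\<leftarrow>us. E u * star u) = 1" using us(2)[of 1] by simp
  finally have "(\<Sum>u\<leftarrow>us. (u - E u) * star (u - E u)) = ind - 1"
    by (simp add: us(3) E_fix A_closed)
  moreover have "sqpos (\<Sum>u\<leftarrow>us. (u - E u) * star (u - E u))"
    by (intro sum_list_sqpos mult_star_self_sqpos)
  ultimately have "sqpos (ind - 1)" by simp
  then obtain b where "(1 *\<^sub>R 1 + (ind - 1)) * b = 1" "b * (1 *\<^sub>R 1 + (ind - 1)) = 1"
    using one_plus_sqpos_invertible[of "ind - 1" 1] by auto
  then show thesis using that by simp
qed

lemma cinverse_ind: "ind * cinverse ind = 1" "cinverse ind * ind = 1"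
proof -
  obtain b where "ind * b = 1" "b * ind = 1" using ind_invertible .
  then show "ind * cinverse ind = 1" "cinverse ind * ind = 1" by (simp_all add: cinverse_eq)
qed

end

text \<open>The data on one side of the bimodule. Both \<open>A \<subseteq> C\<close> with \<open>p\<close> and \<open>B \<subseteq> D\<close> with \<open>q\<close> are instances.\<close>

locale jones_projection = finite_index_expectation A E
  for A :: "'c::unital_cstar_algebra set" and E +
  fixes p :: 'c and E\<^sub>P :: "'c \<Rightarrow> 'c"
  assumes ind_in: "Ind_W UNIV E \<in> A"
    and full: "full_projection p"
    and E_p: "E p = cinverse (Ind_W UNIV E)"
    and EP_def: "a \<in> A \<Longrightarrow> E\<^sub>P a = Ind_W UNIV E * E (p * a * p)"
begin

lemma p_proj: "star p = p" "p * p = p" "p * (p * c) = p * c"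
  using full by (simp_all add: full_projection_def flip: mult.assoc)

lemma ind_A: "ind \<in> A"
  using ind_in by (simp add: ind_def)

lemma E_p_ind: "E p * ind = 1" "ind * E p = 1"
  using E_p cinverse_ind by (simp_all add: ind_def)

text \<open>The Jones relation. In the basic construction of \<open>A \<subseteq> C\<close> with Jones projection \<open>e\<close> it reads
  \<open>p = ind p e p\<close>; the right side is a projection below \<open>p\<close> with the same value under the dual
  expectation. Unfolding the faithfulness of that expectation on a quasi-basis gives the computation with
  \<open>z\<close> below.\<close>

lemma p_absorb: "p * c = ind * (p * E (p * c))"
proof -
  obtain us where us: "\<And>c. (\<Sum>u\<leftarrow>us. u * E (star u * c)) = c" "\<And>c. (\<Sum>u\<leftarrow>us. E (c * u) * star u) = c"
    "ind = (\<Sum>u\<leftarrow>us. u * star u)" using quasi_basis_UNIV by metis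
  define z where "z u = p * u - ind * (p * E (p * u))" for u
  have star_z: "star (z u) = star u * p - ind * (E (star u * p) * p)" for u
    by (simp add: z_def star_diff star_mult p_proj ind_selfadjoint E_star[symmetric] ind_central mult.assoc ind_commute)
  have zz: "z u * star (z u) = p * (u * star u) * p - ind * (p * (u * E (star u * p)) * p)
      - ind * (p * (E (p * u) * star u) * p) + ind * (ind * (p * (E (p * u) * E (star u * p)) * p))" for u
    unfolding star_z
    by (simp add: z_def algebra_simps ind_commute[of "E (p * u)"] ind_commute[of p] ind_commute[of u]
       ind_commute[of "star u"])
  have "(\<Sum>u\<leftarrow>us. z u * star (z u))
      = p * (\<Sum>u\<leftarrow>us. u * star u) * p - ind * (p * (\<Sum>u\<leftarrow>us. u * E (star u * p)) * p)
        - ind * (p * (\<Sum>u\<leftarrow>us. E (p * u) * star u) * p)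
        + ind * (ind * (p * (\<Sum>u\<leftarrow>us. E (p * u) * E (star u * p)) * p))"
    unfolding zz by (induction us) (simp_all add: algebra_simps)
  also have "(\<Sum>u\<leftarrow>us. E (p * u) * E (star u * p)) = E ((\<Sum>u\<leftarrow>us. E (p * u) * star u) * p)"
    by (simp add: E_sum_list E_module E_closed mult.assoc flip: sum_list_mult_const)
  also have "\<dots> = E p" by (simp add: us(2) p_proj)
  also have "ind * (ind * (p * E p * p)) = ind * p"
    by (metis E_p_ind(2) ind_commute mult.assoc mult_1_right p_proj(2))
  finally have "(\<Sum>u\<leftarrow>us. z u * star (z u)) = 0"
    by (simp add: us(1,2) us(3)[symmetric] p_proj ind_central[of p] mult.assoc)
  then have z0: "p * u = ind * (p * E (p * u))" if "u \<in> set us" for u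
    using sum_list_mult_star_zero[of z us u] that by (simp add: z_def)
  have "p * c = (\<Sum>u\<leftarrow>us. (p * u) * E (star u * c))"
    by (subst us(1)[of c, symmetric]) (simp add: mult.assoc flip: sum_list_const_mult)
  also have "\<dots> = (\<Sum>u\<leftarrow>us. ind * (p * E ((p * u) * E (star u * c))))"
  proof (intro arg_cong[of _ _ sum_list] map_cong refl)
    fix u assume "u \<in> set us"
    then show "p * u * E (star u * c) = ind * (p * E (p * u * E (star u * c)))"
      unfolding E_module(2)[OF E_closed] by (subst z0) (simp_all add: mult.assoc)
  qed
  also have "\<dots> = ind * (p * E (\<Sum>u\<leftarrow>us. (p * u) * E (star u * c)))"
    by (simp add: E_sum_list sum_list_const_mult)
  also have "(\<Sum>u\<leftarrow>us. (p * u) * E (star u * c)) = p * c"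
    by (subst (2) us(1)[of c, symmetric]) (simp add: mult.assoc flip: sum_list_const_mult)
  finally show ?thesis .
qed

lemma p_absorb_right: "c * p = ind * (E (c * p) * p)"
proof -
  have "star (p * star c) = star (ind * (p * E (p * star c)))" using p_absorb by metis
  then show ?thesis by (simp add: star_mult star_star p_proj ind_selfadjoint ind_central[of "_ * _"] flip: E_star)
qed

lemma EP_eq: "a \<in> A \<Longrightarrow> E\<^sub>P a = ind * E (p * a * p)"
  by (simp add: EP_def ind_def)

lemma EP_closed: "a \<in> A \<Longrightarrow> E\<^sub>P a \<in> A"
  by (simp add: EP_eq A_closed ind_A E_closed)

lemma EP_mult_p: "a \<in> A \<Longrightarrow> E\<^sub>P a * p = p * a * p"
  using p_absorb_right[of "p * a"] by (simp add: EP_eq mult.assoc)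

lemma p_mult_EP: "a \<in> A \<Longrightarrow> p * E\<^sub>P a = p * a * p"
  using p_absorb[of "a * p"] by (simp add: EP_eq mult.assoc ind_commute)

text \<open>Since \<open>E p\<close> is invertible, elements of \<open>A\<close> are determined by their products with \<open>p\<close>. Identities in \<open>A\<close>
  are therefore checked after multiplication by \<open>p\<close>, where \<open>E\<^sub>P\<close> becomes compression.\<close>

lemma cancel_right: "a \<in> A \<Longrightarrow> b \<in> A \<Longrightarrow> a * p = b * p \<Longrightarrow> a = b"
  by (metis E_module(1) E_p_ind(1) mult.assoc mult_1_right)

lemma cancel_left: "a \<in> A \<Longrightarrow> b \<in> A \<Longrightarrow> p * a = p * b \<Longrightarrow> a = b"
  by (metis E_module(2) E_p_ind(2) mult.assoc mult_1_left)

text \<open>Fullness gives \<open>C = C p C\<close>, and \<open>p_absorb\<close> moves the outer factors into \<open>A\<close>.\<close>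

lemma ApA:
  obtains xys where "set xys \<subseteq> A \<times> A" "c = (\<Sum>(x, y)\<leftarrow>xys. x * p * y)"
proof -
  have "c \<in> cspan {c * p * c' | c c'. True}" using full by (simp add: full_projection_def)
  then have "\<exists>xys. set xys \<subseteq> A \<times> A \<and> c = (\<Sum>(x, y)\<leftarrow>xys. x * p * y)"
  proof (induction rule: cspan_induct)
    case zero
    show ?case by (rule exI[of _ "[]"]) simp
  next
    case (add c c')
    then obtain v w where "set v \<subseteq> A \<times> A" "c = (\<Sum>(x, y)\<leftarrow>v. x * p * y)"
      "set w \<subseteq> A \<times> A" "c' = (\<Sum>(x, y)\<leftarrow>w. x * p * y)" by blast
    then show ?case by (intro exI[of _ "v @ w"]) simp
  next
    case (scale k c)
    then obtain v where v: "set v \<subseteq> A \<times> A" "c = (\<Sum>(x, y)\<leftarrow>v. x * p * y)" by blast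
    have "k *\<^sub>C (\<Sum>(x, y)\<leftarrow>v. x * p * y) = (\<Sum>(x, y)\<leftarrow>map (\<lambda>(x, y). (k *\<^sub>C x, y)) v. x * p * y)"
      by (induction v) (auto simp: scaleC_add_right mult_scaleC_left)
    then show ?case using v by (intro exI[of _ "map (\<lambda>(x, y). (k *\<^sub>C x, y)) v"]) (auto simp: A_closed)
  next
    case (base c)
    then obtain c1 c2 where "c = c1 * p * c2" by blast
    then have "c = (c1 * p) * (p * c2)" by (simp add: mult.assoc p_proj)
    also have "\<dots> = (ind * E (c1 * p)) * p * (ind * E (p * c2))"
      by (subst p_absorb_right, subst p_absorb) (simp add: mult.assoc p_proj ind_commute[of p])
    finally show ?case
      by (intro exI[of _ "[(ind * E (c1 * p), ind * E (p * c2))]"]) (simp add: A_closed ind_A E_closed)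
  qed
  then show thesis using that by blast
qed

text \<open>For every representation \<open>c = \<Sum> x p y\<close>, the element \<open>w = \<Sum> x E\<^sub>P(y z)\<close> of \<open>A\<close> satisfies \<open>w p = c z p\<close>.
  This determines \<open>w\<close>, so the action is well defined and has a formula free of choices.\<close>

lemma lact_basic:
  assumes z: "z \<in> A"
  shows "lact (basic_bimodule A p E\<^sub>P) c z = ind * E (c * z * p)"
proof -
  have eq: "(\<Sum>(x, y)\<leftarrow>xys. x * E\<^sub>P (y * z)) = ind * E (c * z * p)"
    if xys: "set xys \<subseteq> A \<times> A" "c = (\<Sum>(x, y)\<leftarrow>xys. x * p * y)" for xys
  proof (rule cancel_right)
    show "(\<Sum>(x, y)\<leftarrow>xys. x * E\<^sub>P (y * z)) \<in> A"
      by (rule A_sum_list) (use xys z in \<open>auto simp: A_closed EP_closed\<close>)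
    have "(\<Sum>(x, y)\<leftarrow>xys. x * E\<^sub>P (y * z)) * p = (\<Sum>(x, y)\<leftarrow>xys. x * p * y) * z * p"
      using xys(1) by (induction xys) (auto simp: distrib_right mult.assoc EP_mult_p[unfolded mult.assoc] A_closed z)
    then show "(\<Sum>(x, y)\<leftarrow>xys. x * E\<^sub>P (y * z)) * p = ind * E (c * z * p) * p"
      using p_absorb_right[of "c * z"] xys(2) by (simp add: mult.assoc)
  qed (simp add: A_closed ind_A E_closed)
  obtain xys where "set xys \<subseteq> A \<times> A" "c = (\<Sum>(x, y)\<leftarrow>xys. x * p * y)" using ApA .
  then show ?thesis unfolding basic_bimodule_def by (simp, intro the_equality) (use eq in metis)+
qed

lemma lact_basic_p: "z \<in> A \<Longrightarrow> lact (basic_bimodule A p E\<^sub>P) c z * p = c * z * p"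
  using p_absorb_right[of "c * z"] by (simp add: lact_basic mult.assoc)

lemma lact_basic_closed: "z \<in> A \<Longrightarrow> lact (basic_bimodule A p E\<^sub>P) c z \<in> A"
  by (simp add: lact_basic A_closed ind_A E_closed)

lemma quasi_basis_sum_eq_1:
  assumes ss: "quasi_basis A E\<^sub>P ss"
  shows "(\<Sum>s\<leftarrow>ss. s * p * star s) = 1"
proof -
  let ?e = "\<Sum>s\<leftarrow>ss. s * p * star s"
  have sA: "s \<in> A" if "s \<in> set ss" for s using ss that by (auto simp: quasi_basis_def)
  \<comment> \<open>The sum acts as a left unit on \<open>A p A\<close>, which contains \<open>1\<close>.\<close>
  have e: "?e * (x * p * y) = x * p * y" if x: "x \<in> A" for x y
  proof -
    have "?e * x * p = (\<Sum>s\<leftarrow>ss. s * (E\<^sub>P (star s * x) * p))"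
      using sA x by (simp add: EP_mult_p A_closed mult.assoc flip: sum_list_mult_const cong: map_cong)
    also have "\<dots> = (\<Sum>s\<leftarrow>ss. s * E\<^sub>P (star s * x)) * p"
      by (simp add: mult.assoc flip: sum_list_mult_const)
    also have "\<dots> = x * p" using ss x by (simp add: quasi_basis_def)
    finally show ?thesis by (simp add: mult.assoc[symmetric])
  qed
  obtain xys where xys: "set xys \<subseteq> A \<times> A" "1 = (\<Sum>(x, y)\<leftarrow>xys. x * p * y)" using ApA .
  have "?e * (\<Sum>(x, y)\<leftarrow>xys. x * p * y) = (\<Sum>(x, y)\<leftarrow>xys. x * p * y)"
    using xys(1) by (induction xys) (auto simp: distrib_left e)
  then show ?thesis by (simp flip: xys(2))
qed

lemma quasi_basisI:
  assumes ss: "set ss \<subseteq> A" and sum: "(\<Sum>s\<leftarrow>ss. s * p * star s) = 1"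
  shows "quasi_basis A E\<^sub>P ss"
  unfolding quasi_basis_def
proof (intro conjI ballI ss)
  fix c assume c: "c \<in> A"
  have sA: "s \<in> A" if "s \<in> set ss" for s using ss that by auto
  show "(\<Sum>s\<leftarrow>ss. s * E\<^sub>P (star s * c)) = c"
  proof (rule cancel_right[OF _ c])
    show "(\<Sum>s\<leftarrow>ss. s * E\<^sub>P (star s * c)) \<in> A" by (rule A_sum_list) (simp add: A_closed EP_closed sA c)
    have "(\<Sum>s\<leftarrow>ss. s * E\<^sub>P (star s * c)) * p = (\<Sum>s\<leftarrow>ss. s * p * star s) * (c * p)"
      using sA c by (simp add: EP_mult_p A_closed mult.assoc flip: sum_list_mult_const cong: map_cong)
    then show "(\<Sum>s\<leftarrow>ss. s * E\<^sub>P (star s * c)) * p = c * p" by (simp add: sum)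
  qed
  show "(\<Sum>s\<leftarrow>ss. E\<^sub>P (c * s) * star s) = c"
  proof (rule cancel_left[OF _ c])
    show "(\<Sum>s\<leftarrow>ss. E\<^sub>P (c * s) * star s) \<in> A" by (rule A_sum_list) (simp add: A_closed EP_closed sA c)
    have "p * (\<Sum>s\<leftarrow>ss. E\<^sub>P (c * s) * star s) = (\<Sum>s\<leftarrow>ss. p * E\<^sub>P (c * s) * star s)"
      by (simp add: mult.assoc flip: sum_list_const_mult)
    also have "\<dots> = p * c * (\<Sum>s\<leftarrow>ss. s * p * star s)"
      using sA c by (simp add: p_mult_EP A_closed mult.assoc flip: sum_list_const_mult cong: map_cong)
    finally show "p * (\<Sum>s\<leftarrow>ss. E\<^sub>P (c * s) * star s) = p * c" by (simp add: sum)
  qed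
qed

text \<open>From \<open>1 = \<Sum> x p y\<close> put \<open>w = x + y\<^sup>*\<close>. Then \<open>h = \<Sum> w p w\<^sup>*\<close> is \<open>2\<close> plus a positive element, and the
  family \<open>h\<^sup>-\<^sup>1\<^sup>/\<^sup>2 w\<close> satisfies \<open>\<Sum> s p s\<^sup>* = 1\<close>. Its members are moved into \<open>A\<close> by \<open>p_absorb_right\<close>, which
  leaves \<open>s p\<close> unchanged.\<close>

lemma quasi_basis_exists:
  obtains ss where "quasi_basis A E\<^sub>P ss"
proof -
  obtain xys where xys: "set xys \<subseteq> A \<times> A" "1 = (\<Sum>(x, y)\<leftarrow>xys. x * p * y)" using ApA .
  define w where "w = (\<lambda>(x, y). x + star y :: 'c)"
  define h where "h = (\<Sum>xy\<leftarrow>xys. w xy * p * star (w xy))"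
  define m where "m = (\<Sum>(x, y)\<leftarrow>xys. (x * p) * star (x * p) + star (p * y) * (p * y))"
  have m: "sqpos m" unfolding m_def
    by (intro sum_list_sqpos) (auto intro: sqpos_add mult_star_self_sqpos star_mult_self_sqpos)
  have "h = (\<Sum>(x, y)\<leftarrow>xys. x * p * y) + star (\<Sum>(x, y)\<leftarrow>xys. x * p * y) + m"
    unfolding h_def m_def
    by (induction xys) (auto simp: w_def star_add star_mult star_star p_proj algebra_simps)
  then have h: "h = 2 *\<^sub>R 1 + m" by (simp add: scaleR_2 flip: xys(2))
  obtain b where b: "h * b = 1" "b * h = 1" using one_plus_sqpos_invertible[OF m, of 2] h by auto
  have "sqpos h" unfolding h_def
  proof (rule sum_list_sqpos)
    fix xy
    show "sqpos (w xy * p * star (w xy))"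
      using mult_star_self_sqpos[of "w xy * p"] by (simp add: star_mult p_proj mult.assoc)
  qed
  then obtain r0 where r0: "star r0 = r0" "h = r0 * r0" by (auto simp: sqpos_def)
  \<comment> \<open>\<open>r\<close> is the inverse square root of \<open>h\<close>.\<close>
  define r where "r = b * r0"
  have rb: "r = r0 * b" by (metis b mult.assoc mult_1_left mult_1_right r0(2) r_def)
  have rr: "r * r0 = 1" "r0 * r = 1" using b r0(2) by (simp_all add: r_def mult.assoc) (simp add: rb flip: r_def mult.assoc)
  have r: "star r = r" by (metis r0(1) rr mult.assoc mult_1_left mult_1_right star_mult star_one)
  define ss where "ss = map (\<lambda>xy. ind * E (r * w xy * p)) xys"
  have ssA: "set ss \<subseteq> A" by (auto simp: ss_def A_closed ind_A E_closed)
  have sp: "(ind * E (r * w xy * p)) * p = r * w xy * p" for xy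
    using p_absorb_right[of "r * w xy"] by (simp add: mult.assoc)
  have sps: "s * p * star s = (s * p) * star (s * p)" for s by (simp add: star_mult p_proj mult.assoc)
  have "(\<Sum>s\<leftarrow>ss. s * p * star s) = (\<Sum>xy\<leftarrow>xys. r * (w xy * p * star (w xy)) * r)"
    unfolding ss_def map_map o_def sps sp by (simp add: star_mult r p_proj mult.assoc)
  also have "\<dots> = r * h * r" by (simp add: h_def sum_list_const_mult sum_list_mult_const)
  also have "\<dots> = 1" by (simp add: r0(2) rr mult.assoc[symmetric])
  finally show thesis using that quasi_basisI[OF ssA] by blast
qed

text \<open>Apply \<open>E\<close> to \<open>\<Sum> s p s\<^sup>* = 1\<close>.\<close>

lemma Ind_W_EP: "Ind_W A E\<^sub>P = ind"
proof -
  obtain ss where ss: "quasi_basis A E\<^sub>P ss" using quasi_basis_exists .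
  have sA: "s \<in> A" if "s \<in> set ss" for s using ss that by (auto simp: quasi_basis_def)
  have "E (\<Sum>s\<leftarrow>ss. s * p * star s) = (\<Sum>s\<leftarrow>ss. s * E p * star s)"
    using sA by (simp add: E_sum_list E_module A_closed cong: map_cong)
  then have "1 = (\<Sum>s\<leftarrow>ss. s * E p * star s)"
    by (simp add: quasi_basis_sum_eq_1[OF ss] E_fix A_closed)
  then have "ind = ind * (\<Sum>s\<leftarrow>ss. s * E p * star s)" by simp
  also have "\<dots> = (\<Sum>s\<leftarrow>ss. s * ((ind * E p) * star s))"
    by (simp add: ind_commute mult.assoc flip: sum_list_const_mult)
  also have "\<dots> = (\<Sum>s\<leftarrow>ss. s * star s)" by (simp add: E_p_ind)
  finally show ?thesis using Ind_W_eq[OF ss] A_closed(4) by simp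
qed

end

section \<open>The downward basic construction\<close>

text \<open>A dense left ideal contains an element close to \<open>1\<close>, hence an invertible one. The fullness
  conditions, which speak of closures of spans, thereby become finite sums with value \<open>1\<close>.\<close>

lemma one_in_dense_left_ideal:
  fixes S :: "'a::unital_cstar_algebra set"
  assumes dense: "closure (cspan S) = UNIV" and left: "\<And>c s. s \<in> S \<Longrightarrow> c * s \<in> S"
  shows "1 \<in> cspan S"
proof -
  interpret module "scaleC :: complex \<Rightarrow> 'a \<Rightarrow> 'a" by (rule module_scaleC)
  have "\<exists>a\<in>cspan S. dist a 1 < 1" using dense closure_approachable[of 1 "cspan S"] by auto
  then obtain a where a: "a \<in> cspan S" "norm (1 - a) < 1" by (auto simp: dist_norm norm_minus_commute)
  then obtain b where b: "b * a = 1" using invertible_near_one by metis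
  have "b * a \<in> cspan S" using a(1)
    by (induction rule: cspan_induct)
       (use left in \<open>auto simp: cspan_def span_zero distrib_left mult_scaleC_right
          intro: span_add span_scale span_base\<close>)
  then show ?thesis by (simp add: b)
qed

locale downward_construction =
  C: jones_projection A E\<^sub>A p E\<^sub>P + D: jones_projection B E\<^sub>B q E\<^sub>Q
  for A :: "'c::unital_cstar_algebra set" and E\<^sub>A p E\<^sub>P
    and B :: "'d::unital_cstar_algebra set" and E\<^sub>B q E\<^sub>Q +
  fixes Y :: "('c, 'y, 'd) bimodule" and X Z :: "'y set" and E\<^sub>X E\<^sub>Z :: "'y \<Rightarrow> 'y"
  assumes morita: "strongly_Morita_equivalent A B Y X"
    and bimodule_exp: "bimodule_expectation A B Y X E\<^sub>A E\<^sub>B E\<^sub>X"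
    and Z_def: "Z = {x \<in> X. lact Y p x = ract Y x q}"
    and EZ_def: "x \<in> X \<Longrightarrow> E\<^sub>Z x = lact Y (Ind_W UNIV E\<^sub>A) (E\<^sub>X (ract Y (lact Y p x) q))"

sublocale downward_construction \<subseteq> equivalence_bimodule Y
  using morita by (simp add: strongly_Morita_equivalent_def)

context downward_construction
begin

lemma X_sub: "x \<in> X \<Longrightarrow> x \<in> bcarrier Y"
  and X_scale: "x \<in> X \<Longrightarrow> bscale Y k x \<in> X"
  and X_lact: "a \<in> A \<Longrightarrow> x \<in> X \<Longrightarrow> lact Y a x \<in> X"
  and X_ract: "b \<in> B \<Longrightarrow> x \<in> X \<Longrightarrow> ract Y x b \<in> X"
  and X_rip: "x \<in> X \<Longrightarrow> y \<in> X \<Longrightarrow> rip Y x y \<in> B"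
  using morita unfolding strongly_Morita_equivalent_def closed_subspace_def by blast+

lemma EX_closed: "y \<in> bcarrier Y \<Longrightarrow> E\<^sub>X y \<in> X"
  and EX_add: "y \<in> bcarrier Y \<Longrightarrow> y' \<in> bcarrier Y \<Longrightarrow> E\<^sub>X (badd Y y y') = badd Y (E\<^sub>X y) (E\<^sub>X y')"
  and EX_scale: "y \<in> bcarrier Y \<Longrightarrow> E\<^sub>X (bscale Y k y) = bscale Y k (E\<^sub>X y)"
  and EX_lact_X: "x \<in> X \<Longrightarrow> E\<^sub>X (lact Y c x) = lact Y (E\<^sub>A c) x"
  and EX_A: "a \<in> A \<Longrightarrow> y \<in> bcarrier Y \<Longrightarrow> E\<^sub>X (lact Y a y) = lact Y a (E\<^sub>X y)"
  and EX_ract_X: "x \<in> X \<Longrightarrow> E\<^sub>X (ract Y x d) = ract Y x (E\<^sub>B d)"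
  and EX_B: "b \<in> B \<Longrightarrow> y \<in> bcarrier Y \<Longrightarrow> E\<^sub>X (ract Y y b) = ract Y (E\<^sub>X y) b"
  and EB_rip: "x \<in> X \<Longrightarrow> y \<in> bcarrier Y \<Longrightarrow> E\<^sub>B (rip Y y x) = rip Y (E\<^sub>X y) x"
  using bimodule_exp unfolding bimodule_expectation_def by blast+

lemma EX_carrier: "y \<in> bcarrier Y \<Longrightarrow> E\<^sub>X y \<in> bcarrier Y"
  by (rule X_sub[OF EX_closed])

lemma X_zero: "bzero Y \<in> X"
  using morita by (simp add: strongly_Morita_equivalent_def closed_subspace_def)

lemma EX_zero: "E\<^sub>X (bzero Y) = bzero Y"
  using EX_lact_X[OF X_zero, of 0] by (simp add: lact_zero_right)

lemma rip_sum_one: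
  obtains v where "set v \<subseteq> bcarrier Y \<times> X" "(\<Sum>(y, x)\<leftarrow>v. rip Y y x) = 1"
proof -
  let ?S = "{rip Y y x | y x. y \<in> bcarrier Y \<and> x \<in> X}"
  have "1 \<in> cspan ?S"
  proof (rule one_in_dense_left_ideal)
    show "closure (cspan ?S) = UNIV" using morita by (simp add: strongly_Morita_equivalent_def)
    fix c s assume "s \<in> ?S"
    then obtain y x where "y \<in> bcarrier Y" "x \<in> X" "s = rip Y y x" by blast
    moreover from this have "c * s = rip Y (ract Y y (star c)) x"
      by (simp add: rip_ract_left X_sub star_star)
    ultimately show "c * s \<in> ?S" using ract_closed by blast
  qed
  then have "\<exists>v. set v \<subseteq> bcarrier Y \<times> X \<and> (\<Sum>(y, x)\<leftarrow>v. rip Y y x) = 1"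
  proof (induction rule: cspan_induct)
    case zero
    show ?case by (rule exI[of _ "[]"]) simp
  next
    case (add c c')
    then obtain v w where "set v \<subseteq> bcarrier Y \<times> X" "(\<Sum>(y, x)\<leftarrow>v. rip Y y x) = c"
      "set w \<subseteq> bcarrier Y \<times> X" "(\<Sum>(y, x)\<leftarrow>w. rip Y y x) = c'" by blast
    then show ?case by (intro exI[of _ "v @ w"]) simp
  next
    case (scale k c)
    then obtain v where v: "set v \<subseteq> bcarrier Y \<times> X" "(\<Sum>(y, x)\<leftarrow>v. rip Y y x) = c" by blast
    have "(\<Sum>(y, x)\<leftarrow>map (\<lambda>(y, x). (y, bscale Y k x)) v. rip Y y x) = k *\<^sub>C (\<Sum>(y, x)\<leftarrow>v. rip Y y x)"
      using v(1) by (induction v) (auto simp: scaleC_add_right rip_scale X_sub)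
    then show ?case using v
      by (intro exI[of _ "map (\<lambda>(y, x). (y, bscale Y k x)) v"]) (auto simp: X_scale)
  next
    case (base c)
    then obtain y x where "y \<in> bcarrier Y" "x \<in> X" "c = rip Y y x" by blast
    then show ?case by (intro exI[of _ "[(y, x)]"]) simp
  qed
  then show thesis using that by blast
qed

lemma lip_sum_one:
  obtains v where "set v \<subseteq> bcarrier Y \<times> X" "(\<Sum>(y, x)\<leftarrow>v. lip Y x y) = 1"
proof -
  let ?S = "{lip Y y x | y x. y \<in> bcarrier Y \<and> x \<in> X}"
  have "1 \<in> cspan ?S"
  proof (rule one_in_dense_left_ideal)
    show "closure (cspan ?S) = UNIV" using morita by (simp add: strongly_Morita_equivalent_def)
    fix c s assume "s \<in> ?S"
    then obtain y x where "y \<in> bcarrier Y" "x \<in> X" "s = lip Y y x" by blast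
    moreover from this have "c * s = lip Y (lact Y c y) x" by (simp add: lip_lact X_sub)
    ultimately show "c * s \<in> ?S" using lact_closed by blast
  qed
  then have "\<exists>v. set v \<subseteq> bcarrier Y \<times> X \<and> (\<Sum>(y, x)\<leftarrow>v. lip Y x y) = star 1"
  proof (induction rule: cspan_induct)
    case zero
    show ?case by (rule exI[of _ "[]"]) simp
  next
    case (add c c')
    then obtain v w where "set v \<subseteq> bcarrier Y \<times> X" "(\<Sum>(y, x)\<leftarrow>v. lip Y x y) = star c"
      "set w \<subseteq> bcarrier Y \<times> X" "(\<Sum>(y, x)\<leftarrow>w. lip Y x y) = star c'" by blast
    then show ?case by (intro exI[of _ "v @ w"]) (simp add: star_add)
  next
    case (scale k c)
    then obtain v where v: "set v \<subseteq> bcarrier Y \<times> X" "(\<Sum>(y, x)\<leftarrow>v. lip Y x y) = star c" by blast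
    have "(\<Sum>(y, x)\<leftarrow>map (\<lambda>(y, x). (y, bscale Y (cnj k) x)) v. lip Y x y) = cnj k *\<^sub>C (\<Sum>(y, x)\<leftarrow>v. lip Y x y)"
      using v(1) by (induction v) (auto simp: scaleC_add_right lip_scale X_sub)
    then show ?case using v
      by (intro exI[of _ "map (\<lambda>(y, x). (y, bscale Y (cnj k) x)) v"]) (auto simp: X_scale star_scaleC)
  next
    case (base c)
    then obtain y x where "y \<in> bcarrier Y" "x \<in> X" "c = lip Y y x" by blast
    then show ?case by (intro exI[of _ "[(y, x)]"]) (simp add: lip_star X_sub)
  qed
  then show thesis using that by auto
qed

lemma bsum_in:
  assumes "P (bzero Y)" "\<And>x y. x \<in> bcarrier Y \<Longrightarrow> y \<in> bcarrier Y \<Longrightarrow> P x \<Longrightarrow> P y \<Longrightarrow> P (badd Y x y)"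
    and "\<And>x. x \<in> set xs \<Longrightarrow> x \<in> bcarrier Y \<and> P x"
  shows "P (bsum Y xs)"
  using assms(3)
proof (induction xs)
  case (Cons x xs)
  then show ?case by (simp add: assms(2) bsum_closed subset_iff)
qed (simp add: assms(1))

text \<open>If \<open>\<Sum> \<langle>y', x\<rangle> = 1\<close> with \<open>x\<close> in \<open>X\<close>, then \<open>y = \<Sum> y \<cdot> \<langle>y', x\<rangle>\<close> is a sum of vectors of \<open>C \<cdot> X\<close>, by the
  compatibility of the two inner products. So additive identities in \<open>Y\<close> need only be checked on \<open>c \<cdot> x\<close>,
  where \<open>E\<^sub>X\<close> is given by \<open>E\<^sub>A\<close>.\<close>

lemma lact_X_induct [consumes 1, case_names zero add lact]:
  assumes y: "y \<in> bcarrier Y" and "P (bzero Y)"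
    "\<And>x y. x \<in> bcarrier Y \<Longrightarrow> y \<in> bcarrier Y \<Longrightarrow> P x \<Longrightarrow> P y \<Longrightarrow> P (badd Y x y)"
    "\<And>c x. x \<in> X \<Longrightarrow> P (lact Y c x)"
  shows "P y"
proof -
  obtain v where v: "set v \<subseteq> bcarrier Y \<times> X" "(\<Sum>(y, x)\<leftarrow>v. rip Y y x) = 1" by (rule rip_sum_one)
  have "y = ract Y y (\<Sum>i\<leftarrow>v. rip Y (fst i) (snd i))" using v(2)[unfolded case_prod_unfold] y by (simp add: ract_one)
  also have "\<dots> = bsum Y (map (\<lambda>i. ract Y y (rip Y (fst i) (snd i))) v)" using y by (simp add: bsum_ract)
  also have "\<dots> = bsum Y (map (\<lambda>i. lact Y (lip Y y (fst i)) (snd i)) v)"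
    using v(1) y by (intro arg_cong[of _ _ "bsum Y"] map_cong) (auto simp: compatible X_sub)
  also have "P \<dots>" 
    by (rule bsum_in[OF assms(2,3)]) (use v(1) in \<open>auto simp: lact_closed X_sub assms(4) dest!: subsetD[of "set v"]\<close>)
  finally show ?thesis .
qed

lemma ract_X_induct [consumes 1, case_names zero add ract]:
  assumes y: "y \<in> bcarrier Y" and "P (bzero Y)"
    "\<And>x y. x \<in> bcarrier Y \<Longrightarrow> y \<in> bcarrier Y \<Longrightarrow> P x \<Longrightarrow> P y \<Longrightarrow> P (badd Y x y)"
    "\<And>d x. x \<in> X \<Longrightarrow> P (ract Y x d)"
  shows "P y"
proof -
  obtain v where v: "set v \<subseteq> bcarrier Y \<times> X" "(\<Sum>(y, x)\<leftarrow>v. lip Y x y) = 1" by (rule lip_sum_one)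
  have "y = lact Y (\<Sum>i\<leftarrow>v. lip Y (snd i) (fst i)) y" using v(2)[unfolded case_prod_unfold] y by (simp add: lact_one)
  also have "\<dots> = bsum Y (map (\<lambda>i. lact Y (lip Y (snd i) (fst i)) y) v)" using y by (simp add: bsum_lact)
  also have "\<dots> = bsum Y (map (\<lambda>i. ract Y (snd i) (rip Y (fst i) y)) v)"
    using v(1) y by (intro arg_cong[of _ _ "bsum Y"] map_cong) (auto simp: compatible X_sub)
  also have "P \<dots>" 
    by (rule bsum_in[OF assms(2,3)]) (use v(1) in \<open>auto simp: ract_closed X_sub assms(4) dest!: subsetD[of "set v"]\<close>)
  finally show ?thesis .
qed

lemma p_absorb_module:
  "y \<in> bcarrier Y \<Longrightarrow> lact Y p y = lact Y C.ind (lact Y p (E\<^sub>X (lact Y p y)))"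
proof (induction rule: lact_X_induct)
  case zero
  show ?case by (simp add: lact_zero_right EX_zero)
next
  case (add x y)
  then show ?case by (simp add: lact_add_right EX_add closed EX_carrier)
next
  case (lact c x)
  have "lact Y p (lact Y c x) = lact Y (C.ind * (p * E\<^sub>A (p * c))) x"
    using lact by (simp add: X_sub flip: lact_mult C.p_absorb)
  also have "\<dots> = lact Y C.ind (lact Y p (E\<^sub>X (lact Y p (lact Y c x))))"
    using lact by (simp add: X_sub lact_closed EX_lact_X lact_mult[symmetric])
  finally show ?case .
qed

lemma q_absorb_module:
  "y \<in> bcarrier Y \<Longrightarrow> ract Y y q = ract Y (ract Y (E\<^sub>X (ract Y y q)) D.ind) q"
proof (induction rule: ract_X_induct)
  case zero
  show ?case by (simp add: ract_zero_left EX_zero)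
next
  case (add x y)
  then show ?case by (simp add: ract_add_left EX_add closed EX_carrier)
next
  case (ract d x)
  have "ract Y (ract Y x d) q = ract Y x (D.ind * (E\<^sub>B (d * q) * q))"
    using ract by (simp add: X_sub flip: ract_mult D.p_absorb_right)
  also have "D.ind * (E\<^sub>B (d * q) * q) = E\<^sub>B (d * q) * (D.ind * q)" by (rule D.ind_commute[symmetric])
  also have "ract Y x \<dots> = ract Y (ract Y (E\<^sub>X (ract Y (ract Y x d) q)) D.ind) q"
    using ract by (simp add: X_sub ract_closed EX_ract_X ract_mult[symmetric] mult.assoc)
  finally show ?case .
qed

lemma quasi_basis_left:
  assumes us: "\<And>c. (\<Sum>u\<leftarrow>us. u * E\<^sub>A (star u * c)) = c" and y: "y \<in> bcarrier Y"
  shows "bsum Y (map (\<lambda>u. lact Y u (E\<^sub>X (lact Y (star u) y))) us) = y"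
  using y
proof (induction rule: lact_X_induct)
  case zero
  show ?case using bsum_lact[OF zero_closed, of "\<lambda>_. 0" us] by (simp add: lact_zero_right EX_zero)
next
  case (add x y)
  have "bsum Y (map (\<lambda>u. lact Y u (E\<^sub>X (lact Y (star u) (badd Y x y)))) vs)
     = badd Y (bsum Y (map (\<lambda>u. lact Y u (E\<^sub>X (lact Y (star u) x))) vs))
         (bsum Y (map (\<lambda>u. lact Y u (E\<^sub>X (lact Y (star u) y))) vs))" for vs
    by (rule vector_eqI) (use add(1,2) in \<open>simp_all add: rip_bsum rip_linear bsum_closed image_subset_iff closed
      EX_carrier lact_add_right EX_add sum_list_addf\<close>)
  then show ?case using add by simp
next
  case (lact c x)
  have "bsum Y (map (\<lambda>u. lact Y u (E\<^sub>X (lact Y (star u) (lact Y c x)))) us)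
      = bsum Y (map (\<lambda>u. lact Y (u * E\<^sub>A (star u * c)) x) us)"
    using lact by (simp add: X_sub lact_closed EX_lact_X lact_mult[symmetric])
  then show ?case using lact by (simp add: bsum_lact X_sub us)
qed

lemma quasi_basis_right:
  assumes us: "\<And>c. (\<Sum>u\<leftarrow>us. E\<^sub>B (c * u) * star u) = c" and y: "y \<in> bcarrier Y"
  shows "bsum Y (map (\<lambda>u. ract Y (E\<^sub>X (ract Y y u)) (star u)) us) = y"
  using y
proof (induction rule: ract_X_induct)
  case zero
  show ?case using bsum_lact[OF zero_closed, of "\<lambda>_. 0" us] by (simp add: lact_zero_right ract_zero_left EX_zero)
next
  case (add x y)
  have "bsum Y (map (\<lambda>u. ract Y (E\<^sub>X (ract Y (badd Y x y) u)) (star u)) vs)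
     = badd Y (bsum Y (map (\<lambda>u. ract Y (E\<^sub>X (ract Y x u)) (star u)) vs))
         (bsum Y (map (\<lambda>u. ract Y (E\<^sub>X (ract Y y u)) (star u)) vs))" for vs
    by (rule vector_eqI) (use add(1,2) in \<open>simp_all add: rip_bsum rip_add bsum_closed image_subset_iff closed
      EX_carrier ract_add_left EX_add sum_list_addf\<close>)
  then show ?case using add by simp
next
  case (ract d x)
  have "bsum Y (map (\<lambda>u. ract Y (E\<^sub>X (ract Y (ract Y x d) u)) (star u)) us)
      = bsum Y (map (\<lambda>u. ract Y x (E\<^sub>B (d * u) * star u)) us)"
    using ract by (simp add: X_sub ract_closed EX_ract_X ract_mult[symmetric])
  then show ?case using ract by (simp add: bsum_ract X_sub us)
qed

text \<open>Expand \<open>y\<close> with quasi-bases \<open>u\<close>, \<open>v\<close> of \<open>E\<^sub>A\<close> and \<open>E\<^sub>B\<close>: both sides equal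
  \<open>\<Sum> u \<cdot> E\<^sub>X(u\<^sup>* \<cdot> y \<cdot> v) \<cdot> v\<^sup>*\<close>.\<close>

lemma ind_lact_eq_ract:
  assumes y: "y \<in> bcarrier Y"
  shows "lact Y C.ind y = ract Y y D.ind"
proof -
  obtain us where us: "\<And>c. (\<Sum>u\<leftarrow>us. u * E\<^sub>A (star u * c)) = c" "C.ind = (\<Sum>u\<leftarrow>us. u * star u)"
    using C.quasi_basis_UNIV by metis
  obtain vs where vs: "\<And>c. (\<Sum>u\<leftarrow>vs. E\<^sub>B (c * u) * star u) = c" "D.ind = (\<Sum>u\<leftarrow>vs. u * star u)"
    using D.quasi_basis_UNIV by metis
  let ?e = "\<lambda>u v. lact Y u (ract Y (E\<^sub>X (ract Y (lact Y (star u) y) v)) (star v))"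
  have e: "?e u v \<in> bcarrier Y" for u v using y by (simp add: closed EX_carrier)
  have "lact Y C.ind y = bsum Y (map (\<lambda>u. lact Y u (lact Y (star u) y)) us)"
    using y by (simp add: us(2) bsum_lact[symmetric] lact_mult)
  also have "\<dots> = bsum Y (map (\<lambda>u. bsum Y (map (?e u) vs)) us)"
  proof (intro arg_cong[of _ _ "bsum Y"] map_cong refl)
    fix u
    have "lact Y u (lact Y (star u) y)
        = lact Y u (bsum Y (map (\<lambda>v. ract Y (E\<^sub>X (ract Y (lact Y (star u) y) v)) (star v)) vs))"
      using y by (simp add: quasi_basis_right[OF vs(1)] closed)
    then show "lact Y u (lact Y (star u) y) = bsum Y (map (?e u) vs)"
      using y by (simp add: lact_bsum closed EX_carrier)
  qed
  also have "\<dots> = bsum Y (map (\<lambda>v. bsum Y (map (\<lambda>u. ?e u v) us)) vs)"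
    by (rule bsum_swap) (rule e)
  also have "\<dots> = bsum Y (map (\<lambda>v. ract Y (ract Y y v) (star v)) vs)"
  proof (intro arg_cong[of _ _ "bsum Y"] map_cong refl)
    fix v
    have "ract Y (ract Y y v) (star v)
        = ract Y (bsum Y (map (\<lambda>u. lact Y u (E\<^sub>X (lact Y (star u) (ract Y y v)))) us)) (star v)"
      using y by (simp add: quasi_basis_left[OF us(1)] closed)
    then show "bsum Y (map (\<lambda>u. ?e u v) us) = ract Y (ract Y y v) (star v)"
      using y by (simp add: ract_bsum closed EX_carrier lact_ract)
  qed
  also have "\<dots> = ract Y y D.ind" using y by (simp add: vs(2) bsum_ract[symmetric] ract_mult)
  finally show ?thesis .
qed

text \<open>The vector of \<open>Z\<close> that represents the compression of \<open>y\<close>: \<open>p \<cdot> compress y = compress y \<cdot> q = p \<cdot> y \<cdot> q\<close>.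
  On \<open>X\<close> it is \<open>E\<^sub>Z\<close>.\<close>

definition compress :: "'y \<Rightarrow> 'y" where
  "compress y = lact Y C.ind (E\<^sub>X (ract Y (lact Y p y) q))"

lemma compress_X: "y \<in> bcarrier Y \<Longrightarrow> compress y \<in> X"
  by (simp add: compress_def X_lact C.ind_A EX_closed closed)

lemma lact_compress: "y \<in> bcarrier Y \<Longrightarrow> lact Y p (compress y) = ract Y (lact Y p y) q"
  using p_absorb_module[of "ract Y y q"]
  by (simp add: compress_def lact_ract closed EX_carrier C.ind_central[of p] flip: lact_mult)

lemma ract_compress: "y \<in> bcarrier Y \<Longrightarrow> ract Y (compress y) q = ract Y (lact Y p y) q"
  using q_absorb_module[of "lact Y p y"]
  by (simp add: compress_def ind_lact_eq_ract closed EX_carrier)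

lemma compress_Z: "y \<in> bcarrier Y \<Longrightarrow> compress y \<in> Z"
  by (simp add: Z_def compress_X lact_compress ract_compress)

lemma EZ_eq_compress: "x \<in> X \<Longrightarrow> E\<^sub>Z x = compress x"
  by (simp add: EZ_def compress_def C.ind_def)

lemma ZD: "z \<in> Z \<Longrightarrow> z \<in> X" "z \<in> Z \<Longrightarrow> z \<in> bcarrier Y" "z \<in> Z \<Longrightarrow> ract Y z q = lact Y p z"
  by (auto simp: Z_def X_sub)

text \<open>The subspace \<open>Y \<cdot> q\<close>, the model of \<open>A \<otimes>\<^sub>P Z\<close>.\<close>

definition corner :: "'y set" where
  "corner = {y \<in> bcarrier Y. ract Y y q = y}"

lemma cornerD: "y \<in> corner \<Longrightarrow> y \<in> bcarrier Y" "y \<in> corner \<Longrightarrow> ract Y y q = y"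
  by (auto simp: corner_def)

lemma corner_ract_q: "y \<in> bcarrier Y \<Longrightarrow> ract Y y q \<in> corner"
  by (simp add: corner_def closed D.p_proj flip: ract_mult)

lemma corner_lact: "y \<in> corner \<Longrightarrow> lact Y c y \<in> corner"
  by (simp add: corner_def closed lact_ract)

lemma corner_ract: "y \<in> corner \<Longrightarrow> q * r = r * q \<Longrightarrow> ract Y y r \<in> corner"
proof -
  assume y: "y \<in> corner" and r: "q * r = r * q"
  have "ract Y (ract Y y r) q = ract Y (ract Y y q) r"
    using y by (simp add: cornerD(1) r flip: ract_mult)
  then show ?thesis using y by (simp add: corner_def closed)
qed

lemma corner_scale: "y \<in> corner \<Longrightarrow> bscale Y k y \<in> corner"
  by (simp add: corner_def closed ract_scale_left)

lemma closed_subspace_corner: "closed_subspace Y corner"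
  unfolding closed_subspace_def
proof (intro conjI ballI allI impI)
  fix s :: "nat \<Rightarrow> 'y" and y
  assume a: "(\<forall>k. s k \<in> corner) \<and> y \<in> bcarrier Y \<and> (\<lambda>k. rnorm Y (bdiff Y (s k) y)) \<longlonglongrightarrow> 0"
  then have s: "converges s y" by (auto simp: converges_def corner_def)
  then have "converges (\<lambda>i. ract Y (s i) q) (ract Y y q)" by (rule converges_ract)
  then have "converges s (ract Y y q)" using a by (simp add: cornerD)
  then have "ract Y y q = y" using s converges_unique converges_diff_null by blast
  then show "y \<in> corner" using a by (simp add: corner_def)
qed (auto simp: corner_def closed ract_zero_left ract_add_left ract_scale_left)

text \<open>On \<open>q D\<close>, hence on the inner products of vectors of \<open>Y \<cdot> q\<close>, the map \<open>d \<mapsto> l E\<^sub>B(d)\<close> is inverse to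
  multiplication by \<open>q\<close>. This is the map \<open>f\<close> in the model of \<open>A \<otimes>\<^sub>P Z\<close>.\<close>

lemma rip_corner: "y \<in> corner \<Longrightarrow> y' \<in> corner \<Longrightarrow> q * (D.ind * E\<^sub>B (rip Y y y')) = rip Y y y'"
proof -
  assume y: "y \<in> corner" "y' \<in> corner"
  have "q * rip Y y y' = rip Y y y'" using rip_ract_left[of y y' q] y by (simp add: cornerD D.p_proj)
  then show ?thesis using D.p_absorb[of "rip Y y y'"] by (simp add: D.ind_commute)
qed

end

section \<open>The upward basic construction\<close>

text \<open>The model of \<open>A \<otimes>\<^sub>P Z\<close>: \<open>a \<otimes> z\<close> is the vector \<open>a \<cdot> z \<cdot> q = a p \<cdot> z\<close>. Compressing by \<open>q\<close> turns the right
  inner product of two such vectors into \<open>\<langle>z, E\<^sub>P(a\<^sup>* a') \<cdot> z'\<rangle> q\<close>.\<close>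

sublocale downward_construction \<subseteq> T1: tensor_model Y "basic_bimodule A p E\<^sub>P" "Y\<lparr>bcarrier := Z\<rparr>"
  "\<lambda>a z. lact Y a (ract Y z q)" "\<lambda>d. D.ind * E\<^sub>B d" corner "norm D.ind + norm q"
proof unfold_locales
  show "closed_subspace Y corner" by (rule closed_subspace_corner)
  show "lact Y m (ract Y n q) \<in> corner" if "m \<in> bcarrier (basic_bimodule A p E\<^sub>P)" "n \<in> bcarrier (Y\<lparr>bcarrier := Z\<rparr>)" for m n
    using that by (intro corner_lact corner_ract_q) (simp add: ZD)
  show "bscale (basic_bimodule A p E\<^sub>P) k m \<in> bcarrier (basic_bimodule A p E\<^sub>P)"
    if "m \<in> bcarrier (basic_bimodule A p E\<^sub>P)" for m k
    using that by (simp add: basic_bimodule_def C.A_closed)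
  show "lact Y (bscale (basic_bimodule A p E\<^sub>P) k m) (ract Y n q) = bscale Y k (lact Y m (ract Y n q))"
    if "m \<in> bcarrier (basic_bimodule A p E\<^sub>P)" "n \<in> bcarrier (Y\<lparr>bcarrier := Z\<rparr>)" for m n k
    using that by (simp add: basic_bimodule_def lact_scale_left closed ZD(2))
  fix a z a' z'
  assume "a \<in> bcarrier (basic_bimodule A p E\<^sub>P)" "z \<in> bcarrier (Y\<lparr>bcarrier := Z\<rparr>)"
    "a' \<in> bcarrier (basic_bimodule A p E\<^sub>P)" "z' \<in> bcarrier (Y\<lparr>bcarrier := Z\<rparr>)"
  then have a: "a \<in> A" "a' \<in> A" and z: "z \<in> Z" "z' \<in> Z" by (simp_all add: basic_bimodule_def)
  have zc: "z \<in> bcarrier Y" "z' \<in> bcarrier Y" using z ZD by auto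
  have "lip Y (ract Y z q) (ract Y z' q) = lip Y z (ract Y z' q)"
    using zc by (simp add: lip_ract closed D.p_proj flip: ract_mult)
  also have "\<dots> = lip Y z z' * p" using zc z by (simp add: ZD(3) lip_lact_right C.p_proj)
  finally have "lip Y (ract Y z q) (ract Y z' q) = lip Y z z' * p" .
  then show "lip (basic_bimodule A p E\<^sub>P) (ract (basic_bimodule A p E\<^sub>P) a (lip (Y\<lparr>bcarrier := Z\<rparr>) z z')) a'
      = lip Y (lact Y a (ract Y z q)) (lact Y a' (ract Y z' q))"
    using zc by (simp add: basic_bimodule_def lip_lact lip_lact_right closed mult.assoc)
  let ?r = "E\<^sub>P (star a * a')"
  have r: "?r \<in> A" using a by (simp add: C.EP_closed C.A_closed)
  have "rip Y (lact Y a (ract Y z q)) (lact Y a' (ract Y z' q))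
      = rip Y z (lact Y (p * (star a * a') * p) z')"
    using zc z by (simp add: ZD(3) rip_lact closed C.p_proj lact_mult)
  also have "\<dots> = rip Y z (lact Y ?r (lact Y p z'))"
    using a zc by (simp add: C.EP_mult_p[symmetric] C.A_closed lact_mult)
  also have "\<dots> = rip Y z (lact Y ?r z') * q"
    using zc by (simp add: ZD(3)[OF z(2), symmetric] rip_ract closed flip: lact_ract)
  finally have eq: "rip Y (lact Y a (ract Y z q)) (lact Y a' (ract Y z' q)) = rip Y z (lact Y ?r z') * q" .
  have "rip Y z (lact Y ?r z') \<in> B" using z r by (simp add: X_rip X_lact ZD)
  then have "D.ind * E\<^sub>B (rip Y z (lact Y ?r z') * q) = rip Y z (lact Y ?r z') * (D.ind * E\<^sub>B q)"
    by (simp add: D.E_module D.ind_commute)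
  then show "rip (Y\<lparr>bcarrier := Z\<rparr>) z (lact (Y\<lparr>bcarrier := Z\<rparr>) (rip (basic_bimodule A p E\<^sub>P) a a') z')
      = D.ind * E\<^sub>B (rip Y (lact Y a (ract Y z q)) (lact Y a' (ract Y z' q)))"
    unfolding eq by (simp add: basic_bimodule_def D.E_p_ind)
next
  show "D.ind * E\<^sub>B (d + d') = D.ind * E\<^sub>B d + D.ind * E\<^sub>B d'" for d d'
    by (simp add: D.E_linear distrib_left)
  show "norm (D.ind * E\<^sub>B d) \<le> (norm D.ind + norm q) * norm d" for d
  proof -
    have "norm (D.ind * E\<^sub>B d) \<le> norm D.ind * norm (E\<^sub>B d)" by (rule norm_mult_ineq)
    also have "\<dots> \<le> (norm D.ind + norm q) * norm d" by (intro mult_mono D.E_norm) auto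
    finally show ?thesis .
  qed
  show "norm (rip Y y y) \<le> (norm D.ind + norm q) * norm (D.ind * E\<^sub>B (rip Y y y))" if "y \<in> corner" for y
  proof -
    have "norm (rip Y y y) \<le> norm q * norm (D.ind * E\<^sub>B (rip Y y y))"
      using norm_mult_ineq[of q "D.ind * E\<^sub>B (rip Y y y)"] rip_corner[OF that that] by simp
    also have "\<dots> \<le> (norm D.ind + norm q) * norm (D.ind * E\<^sub>B (rip Y y y))" by (intro mult_right_mono) auto
    finally show ?thesis .
  qed
  fix y assume y: "y \<in> corner"
  obtain ss where ss: "quasi_basis A E\<^sub>P ss" by (rule C.quasi_basis_exists)
  let ?v = "map (\<lambda>s. (s, compress (lact Y (star s) y))) ss"
  have yc: "y \<in> bcarrier Y" using y by (simp add: cornerD)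
  have "y = lact Y (\<Sum>s\<leftarrow>ss. s * p * star s) y" using yc by (simp add: C.quasi_basis_sum_eq_1[OF ss] lact_one)
  also have "\<dots> = bsum Y (map (\<lambda>s. lact Y (s * p * star s) y) ss)" using yc by (simp add: bsum_lact)
  also have "\<dots> = bsum Y (map (\<lambda>s. lact Y s (ract Y (compress (lact Y (star s) y)) q)) ss)"
  proof (intro arg_cong[of _ _ "bsum Y"] map_cong refl)
    fix s
    have "lact Y (s * p * star s) y = lact Y (s * p * star s) (ract Y y q)" using y by (simp add: cornerD)
    then show "lact Y (s * p * star s) y = lact Y s (ract Y (compress (lact Y (star s) y)) q)"
      using yc by (simp add: ract_compress closed lact_mult lact_ract)
  qed
  finally have "y = bsum Y (map (\<lambda>(m, n). lact Y m (ract Y n q)) ?v)" by (simp add: o_def)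
  moreover have "set ?v \<subseteq> bcarrier (basic_bimodule A p E\<^sub>P) \<times> bcarrier (Y\<lparr>bcarrier := Z\<rparr>)"
    using ss yc by (auto simp: quasi_basis_def basic_bimodule_def compress_Z closed)
  ultimately show "\<exists>v. set v \<subseteq> bcarrier (basic_bimodule A p E\<^sub>P) \<times> bcarrier (Y\<lparr>bcarrier := Z\<rparr>) \<and>
      y = bsum Y (map (\<lambda>(m, n). lact Y m (ract Y n q)) v)" by blast
qed

context downward_construction
begin

abbreviation U1 where "U1 \<equiv> bimodule_tensor (basic_bimodule A p E\<^sub>P) (Y\<lparr>bcarrier := Z\<rparr>)"

definition uncls :: "(nat \<Rightarrow> ('c \<times> 'y) list) set \<Rightarrow> 'y" where
  "uncls = the_inv_into corner T1.cls"

lemma uncls_cls [simp]: "y \<in> corner \<Longrightarrow> uncls (T1.cls y) = y"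
  by (simp add: uncls_def the_inv_into_f_f T1.cls_inj)

lemma U1_elim:
  assumes "\<xi> \<in> bcarrier U1"
  obtains y where "y \<in> corner" "\<xi> = T1.cls y"
  using assms by (auto simp: T1.tensor_carrier)

lemma U1_lact: "y \<in> corner \<Longrightarrow> lact U1 c (T1.cls y) = T1.cls (lact Y c y)"
proof (rule T1.tensor_lact)
  fix a z
  assume "a \<in> bcarrier (basic_bimodule A p E\<^sub>P)"
  then have a: "a \<in> A" by (simp add: basic_bimodule_def)
  show "lact (basic_bimodule A p E\<^sub>P) c a \<in> bcarrier (basic_bimodule A p E\<^sub>P)"
    using C.lact_basic_closed[OF a] by (simp add: basic_bimodule_def)
  assume "z \<in> bcarrier (Y\<lparr>bcarrier := Z\<rparr>)"
  then have z: "z \<in> Z" by simp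
  then show "lact Y (lact (basic_bimodule A p E\<^sub>P) c a) (ract Y z q) = lact Y c (lact Y a (ract Y z q))"
    using C.lact_basic_p[OF a, of c] by (simp add: ZD flip: lact_mult) (simp add: mult.assoc)
qed

lemma U1_ract:
  assumes "y \<in> corner" "r \<in> B" "q * r = r * q"
  shows "ract U1 (T1.cls y) r = T1.cls (ract Y y r)"
proof (rule T1.tensor_ract)
  fix z
  assume "z \<in> bcarrier (Y\<lparr>bcarrier := Z\<rparr>)"
  then have z: "z \<in> Z" by simp
  have eq: "ract Y (ract Y z r) q = ract Y (ract Y z q) r"
    using z assms(3) by (simp add: ZD(2) flip: ract_mult)
  then have "ract Y z r \<in> Z"
    using z assms(2) by (simp add: Z_def X_ract X_sub lact_ract[symmetric])
  then show "ract (Y\<lparr>bcarrier := Z\<rparr>) z r \<in> bcarrier (Y\<lparr>bcarrier := Z\<rparr>)" by simp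
  show "lact Y a (ract Y (ract (Y\<lparr>bcarrier := Z\<rparr>) z r) q) = ract Y (lact Y a (ract Y z q)) r" for a
    using z eq by (simp add: lact_ract closed ZD(2))
qed (rule assms)

abbreviation N2 where "N2 \<equiv> dual_bimodule (basic_bimodule B q E\<^sub>Q)"

lemma N2_simps: "bcarrier N2 = B" "lip N2 b b' = E\<^sub>Q (star b * b')" "rip N2 b b' = b * q * star b'"
  "lact N2 d b = b * star d" "ract N2 b d = lact (basic_bimodule B q E\<^sub>Q) (star d) b"
  by (simp_all add: dual_bimodule_simps) (simp_all add: basic_bimodule_def)

lemma EQ_commutes: "b \<in> B \<Longrightarrow> q * E\<^sub>Q b = E\<^sub>Q b * q"
  by (simp add: D.EP_mult_p D.p_mult_EP)

end

text \<open>The model of the full tensor product: the tensor of the class of \<open>y\<close> with \<open>b~\<close> is \<open>y \<cdot> b\<^sup>*\<close>. The inner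
  products agree because \<open>y = y \<cdot> q\<close> and \<open>q b\<^sup>* b' q = E\<^sub>Q(b\<^sup>* b') q\<close>, and the values span \<open>Y\<close> because
  \<open>y = \<Sum> y \<cdot> t q t\<^sup>*\<close>.\<close>

sublocale downward_construction \<subseteq> T2: tensor_model Y
  "bimodule_tensor (basic_bimodule A p E\<^sub>P) (Y\<lparr>bcarrier := Z\<rparr>)" "dual_bimodule (basic_bimodule B q E\<^sub>Q)"
  "\<lambda>\<xi> b. ract Y (uncls \<xi>) (star b)" "\<lambda>d. d" "bcarrier Y" 1
proof unfold_locales
  show "closed_subspace Y (bcarrier Y)" by (auto simp: closed_subspace_def closed)
  fix \<xi> b assume \<xi>: "\<xi> \<in> bcarrier U1" and "b \<in> bcarrier N2"
  then have b: "b \<in> B" by (simp add: N2_simps)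
  obtain y where y: "y \<in> corner" "\<xi> = T1.cls y" using \<xi> by (rule U1_elim)
  show "ract Y (uncls \<xi>) (star b) \<in> bcarrier Y" using y by (simp add: cornerD closed)
  show "ract Y (uncls (bscale U1 k \<xi>)) (star b) = bscale Y k (ract Y (uncls \<xi>) (star b))" for k
    using y by (simp add: T1.tensor_scale corner_scale ract_scale_left cornerD)
  fix \<xi>' b' assume \<xi>': "\<xi>' \<in> bcarrier U1" and "b' \<in> bcarrier N2"
  then have b': "b' \<in> B" by (simp add: N2_simps)
  obtain y' where y': "y' \<in> corner" "\<xi>' = T1.cls y'" using \<xi>' by (rule U1_elim)
  note yc = cornerD(1)[OF y(1)] cornerD(1)[OF y'(1)]
  let ?r = "E\<^sub>Q (star b * b')"
  have r: "?r \<in> B" "q * ?r = ?r * q" using b b' by (simp_all add: D.EP_closed D.A_closed EQ_commutes)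
  have "lip Y (ract Y y (star b)) (ract Y y' (star b')) = lip Y (ract Y y (star b * b')) (ract Y y' q)"
    using yc y' by (simp add: lip_ract closed cornerD ract_mult)
  also have "\<dots> = lip Y (ract Y (ract Y y q) (star b * b' * q)) y'"
    using yc y by (simp add: lip_ract closed cornerD D.p_proj star_mult star_star ract_mult)
  also have "ract Y (ract Y y q) (star b * b' * q) = ract Y y (q * (star b * b') * q)"
    using yc by (simp add: ract_mult closed)
  also have "\<dots> = ract Y (ract Y y q) ?r"
    using yc b b' by (simp add: D.p_mult_EP[symmetric] D.A_closed ract_mult)
  also have "\<dots> = ract Y y ?r" using y by (simp add: cornerD)
  finally show "lip U1 (ract U1 \<xi> (lip N2 b b')) \<xi>' = lip Y (ract Y (uncls \<xi>) (star b)) (ract Y (uncls \<xi>') (star b'))"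
    using y y' r by (simp add: N2_simps U1_ract T1.tensor_lip corner_ract)
  let ?s = "D.ind * E\<^sub>B (rip Y y y')"
  have "b * q * star (b' * star ?s) = b * (q * ?s) * star b'"
    by (simp add: star_mult star_star mult.assoc)
  also have "q * ?s = rip Y y y'" by (rule rip_corner[OF y(1) y'(1)])
  finally have "b * q * star (b' * star ?s) = b * rip Y y y' * star b'" .
  then show "rip N2 b (lact N2 (rip U1 \<xi> \<xi>') b') = rip Y (ract Y (uncls \<xi>) (star b)) (ract Y (uncls \<xi>') (star b'))"
    using y y' yc by (simp only: N2_simps T1.tensor_rip uncls_cls) (simp add: rip_ract rip_ract_left closed star_star mult.assoc)
next
  show "bscale U1 k \<xi> \<in> bcarrier U1" if "\<xi> \<in> bcarrier U1" for \<xi> k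
    using that by (auto simp: T1.tensor_carrier T1.tensor_scale corner_scale)
  fix y assume y: "y \<in> bcarrier Y"
  obtain ts where ts: "quasi_basis B E\<^sub>Q ts" by (rule D.quasi_basis_exists)
  let ?v = "map (\<lambda>t. (T1.cls (ract Y (ract Y y t) q), t)) ts"
  have "y = ract Y y (\<Sum>t\<leftarrow>ts. t * q * star t)" using y by (simp add: D.quasi_basis_sum_eq_1[OF ts] ract_one)
  also have "\<dots> = bsum Y (map (\<lambda>t. ract Y (ract Y (ract Y y t) q) (star t)) ts)"
    using y by (simp add: bsum_ract[symmetric] ract_mult)
  finally have "y = bsum Y (map (\<lambda>(\<xi>, b). ract Y (uncls \<xi>) (star b)) ?v)"
    using y by (simp add: o_def corner_ract_q closed)
  moreover have "set ?v \<subseteq> bcarrier U1 \<times> bcarrier N2"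
    using ts y by (auto simp: quasi_basis_def N2_simps T1.tensor_carrier corner_ract_q closed)
  ultimately show "\<exists>v. set v \<subseteq> bcarrier U1 \<times> bcarrier N2 \<and> y = bsum Y (map (\<lambda>(\<xi>, b). ract Y (uncls \<xi>) (star b)) v)"
    by blast
qed simp_all

context downward_construction
begin

abbreviation U where "U \<equiv> upward_construction A p E\<^sub>P Y Z B q E\<^sub>Q"

lemma U_unfold: "U = bimodule_tensor U1 N2"
  by (simp add: upward_construction_def)

lemma U_carrier: "bcarrier U = T2.cls ` bcarrier Y"
  by (simp add: U_unfold T2.tensor_carrier)

lemma U_lact: "y \<in> bcarrier Y \<Longrightarrow> lact U c (T2.cls y) = T2.cls (lact Y c y)"
  unfolding U_unfold
proof (rule T2.tensor_lact)
  fix \<xi> b assume "\<xi> \<in> bcarrier U1"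
  then obtain y where y: "y \<in> corner" "\<xi> = T1.cls y" by (rule U1_elim)
  show "lact U1 c \<xi> \<in> bcarrier U1" using y by (simp add: U1_lact T1.tensor_carrier corner_lact)
  show "ract Y (uncls (lact U1 c \<xi>)) (star b) = lact Y c (ract Y (uncls \<xi>) (star b))"
    using y by (simp add: U1_lact corner_lact lact_ract cornerD)
qed

lemma U_ract: "y \<in> bcarrier Y \<Longrightarrow> ract U (T2.cls y) d = T2.cls (ract Y y d)"
  unfolding U_unfold
proof (rule T2.tensor_ract)
  fix b assume "b \<in> bcarrier N2"
  then have b: "b \<in> B" by (simp add: N2_simps)
  show "ract N2 b d \<in> bcarrier N2" using b by (simp add: N2_simps D.lact_basic_closed)
  fix \<xi> assume "\<xi> \<in> bcarrier U1"
  then obtain y where y: "y \<in> corner" "\<xi> = T1.cls y" by (rule U1_elim)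
  have star_eq: "q * star (ract N2 b d) = q * star b * d"
    using arg_cong[OF D.lact_basic_p[OF b, of "star d"], of star]
    by (simp add: N2_simps star_mult star_star D.p_proj mult.assoc)
  have "ract Y y (star (ract N2 b d)) = ract Y y (q * star (ract N2 b d))"
    using y by (simp add: ract_mult cornerD)
  also have "\<dots> = ract Y (ract Y y (star b)) d"
    unfolding star_eq using y by (simp add: ract_mult cornerD closed)
  finally show "ract Y (uncls \<xi>) (star (ract N2 b d)) = ract Y (ract Y (uncls \<xi>) (star b)) d" using y by simp
qed

lemma U_add: "x \<in> bcarrier Y \<Longrightarrow> y \<in> bcarrier Y \<Longrightarrow> badd U (T2.cls x) (T2.cls y) = T2.cls (badd Y x y)"
  and U_scale: "x \<in> bcarrier Y \<Longrightarrow> bscale U k (T2.cls x) = T2.cls (bscale Y k x)"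
  and U_rip: "x \<in> bcarrier Y \<Longrightarrow> y \<in> bcarrier Y \<Longrightarrow> rip U (T2.cls x) (T2.cls y) = rip Y x y"
  and U_lip: "x \<in> bcarrier Y \<Longrightarrow> y \<in> bcarrier Y \<Longrightarrow> lip U (T2.cls x) (T2.cls y) = lip Y x y"
  and U_zero: "bzero U = T2.cls (bzero Y)"
  by (simp_all add: U_unfold T2.tensor_add T2.tensor_scale T2.tensor_rip T2.tensor_lip T2.tensor_zero)

lemma isomorphism: "bimodule_isomorphism Y U T2.cls"
  using equivalence_bimodule_axioms U_carrier T2.cls_inj U_zero U_add U_scale U_lact U_ract U_lip U_rip
  by (rule equivalence_bimodule_transport(2))

lemma upward_tensor_eq:
  assumes a: "a \<in> A" and z: "z \<in> Z" and b: "b \<in> B"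
  shows "upward_tensor A p E\<^sub>P Y Z B q E\<^sub>Q a z b = T2.cls (ract Y (lact Y a (ract Y z q)) (star b))"
proof -
  have "elementary_tensor (basic_bimodule A p E\<^sub>P) (Y\<lparr>bcarrier := Z\<rparr>) a z = T1.cls (lact Y a (ract Y z q))"
    by (rule T1.tensor_elementary) (use a z in \<open>simp_all add: basic_bimodule_def\<close>)
  moreover have c: "lact Y a (ract Y z q) \<in> corner" using z by (intro corner_lact corner_ract_q) (simp add: ZD)
  ultimately show ?thesis unfolding upward_tensor_def
    using T2.tensor_elementary[of "T1.cls (lact Y a (ract Y z q))" b] b by (simp add: T1.tensor_carrier N2_simps)
qed

lemma bsum_concat:
  assumes "\<And>xs. xs \<in> set xss \<Longrightarrow> set xs \<subseteq> bcarrier Y"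
  shows "bsum Y (concat xss) = bsum Y (map (bsum Y) xss)"
  using assms by (induction xss) (auto simp: bsum_append UN_subset_iff)

lemma bsum_U: "set xs \<subseteq> bcarrier Y \<Longrightarrow> bsum U (map T2.cls xs) = T2.cls (bsum Y xs)"
  by (induction xs) (simp_all add: U_zero U_add bsum_closed)

text \<open>By \<open>\<Sum> s p s\<^sup>* = 1\<close> and \<open>\<Sum> t q t\<^sup>* = 1\<close> one has \<open>x = \<Sum> s p s\<^sup>* \<cdot> x \<cdot> t q t\<^sup>*\<close>, and the \<open>(s, t)\<close> term is the
  vector of the elementary tensor formed from \<open>s\<close>, \<open>E\<^sub>Z(s\<^sup>* \<cdot> x \<cdot> t)\<close> and \<open>t\<close>.\<close>

lemma embedding_eq:
  assumes ss: "quasi_basis A E\<^sub>P ss" and ts: "quasi_basis B E\<^sub>Q ts" and x: "x \<in> X"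
  shows "T2.cls x = upward_embedding A p E\<^sub>P Y Z B q E\<^sub>Q E\<^sub>Z ss ts x"
proof -
  let ?g = "\<lambda>s t. ract Y (lact Y (s * p * star s) x) (t * q * star t)"
  have xc: "x \<in> bcarrier Y" using x by (rule X_sub)
  have g: "?g s t \<in> bcarrier Y" for s t using xc by (simp add: closed)
  have eq: "upward_tensor A p E\<^sub>P Y Z B q E\<^sub>Q s (E\<^sub>Z (ract Y (lact Y (star s) x) t)) t = T2.cls (?g s t)"
    if "s \<in> set ss" "t \<in> set ts" for s t
  proof -
    have sA: "s \<in> A" and tB: "t \<in> B" using that ss ts by (auto simp: quasi_basis_def)
    let ?x = "ract Y (lact Y (star s) x) t"
    have xX: "?x \<in> X" using x sA tB by (simp add: X_ract X_lact C.A_closed)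
    have "upward_tensor A p E\<^sub>P Y Z B q E\<^sub>Q s (E\<^sub>Z ?x) t = T2.cls (ract Y (lact Y s (ract Y (compress ?x) q)) (star t))"
      using xX sA tB by (simp add: EZ_eq_compress upward_tensor_eq compress_Z X_sub)
    also have "ract Y (lact Y s (ract Y (compress ?x) q)) (star t) = ?g s t"
      using xc by (simp add: ract_compress closed lact_mult ract_mult lact_ract)
    finally show ?thesis .
  qed
  have "upward_embedding A p E\<^sub>P Y Z B q E\<^sub>Q E\<^sub>Z ss ts x
      = bsum U (concat (map (\<lambda>s. map (\<lambda>t. T2.cls (?g s t)) ts) ss))"
    unfolding upward_embedding_def using eq by (intro arg_cong[of _ _ "bsum _"] arg_cong[of _ _ concat] map_cong) auto
  also have "\<dots> = bsum U (map T2.cls (concat (map (\<lambda>s. map (?g s) ts) ss)))"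
    by (simp add: map_concat o_def)
  also have "\<dots> = T2.cls (bsum Y (concat (map (\<lambda>s. map (?g s) ts) ss)))"
    by (rule bsum_U) (use g in auto)
  also have "bsum Y (concat (map (\<lambda>s. map (?g s) ts) ss)) = bsum Y (map (\<lambda>s. bsum Y (map (?g s) ts)) ss)"
    by (subst bsum_concat) (use g in \<open>auto simp: o_def\<close>)
  also have "\<dots> = bsum Y (map (\<lambda>s. lact Y (s * p * star s) x) ss)"
    using xc by (simp add: bsum_ract closed D.quasi_basis_sum_eq_1[OF ts] ract_one)
  also have "\<dots> = x" using xc by (simp add: bsum_lact C.quasi_basis_sum_eq_1[OF ss] lact_one)
  finally show ?thesis by simp
qed

text \<open>\<open>\<langle>E\<^sub>X y, E\<^sub>X y\<rangle> = E\<^sub>B(\<langle>y, E\<^sub>X y\<rangle>)\<close>, so Cauchy-Schwarz and contractivity of \<open>E\<^sub>B\<close> suffice.\<close>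

lemma EX_contractive:
  assumes y: "y \<in> bcarrier Y"
  shows "rnorm Y (E\<^sub>X y) \<le> rnorm Y y"
proof (cases "rnorm Y (E\<^sub>X y) = 0")
  case False
  have "rnorm Y (E\<^sub>X y) * rnorm Y (E\<^sub>X y) = norm (E\<^sub>B (rip Y y (E\<^sub>X y)))"
    using rnorm_square[of "E\<^sub>X y"] EB_rip[OF EX_closed[OF y] y] by (simp add: power2_eq_square)
  also have "\<dots> \<le> norm (rip Y y (E\<^sub>X y))" by (rule D.E_norm)
  also have "\<dots> \<le> rnorm Y y * rnorm Y (E\<^sub>X y)" by (intro norm_rip_le y EX_carrier)
  finally show ?thesis using False rnorm_nonneg[of "E\<^sub>X y"] by (simp add: less_le)
qed simp

definition dual_exp :: "(nat \<Rightarrow> ((nat \<Rightarrow> ('c \<times> 'y) list) set \<times> 'd) list) set \<Rightarrow> 'y" where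
  "dual_exp \<xi> = E\<^sub>X (the_inv_into (bcarrier Y) T2.cls \<xi>)"

lemma dual_exp_cls: "y \<in> bcarrier Y \<Longrightarrow> dual_exp (T2.cls y) = E\<^sub>X y"
  by (simp add: dual_exp_def the_inv_into_f_f T2.cls_inj)

lemma dual_exp_tensor:
  assumes a: "a \<in> A" and z: "z \<in> Z" and b: "b \<in> B"
  shows "dual_exp (upward_tensor A p E\<^sub>P Y Z B q E\<^sub>Q a z b)
    = lact Y (cinverse (Ind_W A E\<^sub>P)) (ract Y (lact Y a z) (star b))"
proof -
  have zc: "z \<in> bcarrier Y" "z \<in> X" using z ZD by auto
  have "a * E\<^sub>A p = (E\<^sub>A p * C.ind) * (a * E\<^sub>A p)" by (simp add: C.E_p_ind)
  also have "\<dots> = E\<^sub>A p * (a * (C.ind * E\<^sub>A p))" by (simp only: mult.assoc C.ind_commute)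
  finally have ki: "a * E\<^sub>A p = E\<^sub>A p * a" by (simp add: C.E_p_ind)
  have EAp: "E\<^sub>A p = cinverse (Ind_W A E\<^sub>P)" using C.E_p by (simp add: C.Ind_W_EP C.ind_def)
  have "dual_exp (upward_tensor A p E\<^sub>P Y Z B q E\<^sub>Q a z b) = E\<^sub>X (ract Y (lact Y a (lact Y p z)) (star b))"
    using z zc by (simp add: upward_tensor_eq[OF a z b] dual_exp_cls closed ZD(3))
  also have "\<dots> = ract Y (lact Y (a * E\<^sub>A p) z) (star b)"
    using a b zc by (simp add: EX_B EX_A D.A_closed closed EX_lact_X lact_mult)
  also have "\<dots> = lact Y (E\<^sub>A p) (ract Y (lact Y a z) (star b))"
    using zc by (simp add: ki lact_mult lact_ract closed)
  finally show ?thesis by (simp add: EAp)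
qed

lemma dual_expectation_dual_exp: "dual_expectation A p E\<^sub>P Y X Z B q E\<^sub>Q dual_exp"
proof -
  have "rnorm Y (dual_exp \<xi>) \<le> 1 * rnorm U \<xi>" if "\<xi> \<in> bcarrier U" for \<xi>
    using that EX_contractive by (auto simp: U_carrier dual_exp_cls rnorm_def U_rip)
  then have "\<exists>K. \<forall>\<xi>\<in>bcarrier U. rnorm Y (dual_exp \<xi>) \<le> K * rnorm U \<xi>" by blast
  then show ?thesis unfolding dual_expectation_def Let_def
    by (auto simp: U_carrier dual_exp_cls EX_closed U_add U_scale EX_add EX_scale closed dual_exp_tensor)
qed

end

theorem proposition9p3:
  fixes A P :: "'c::unital_cstar_algebra set"
    and B Q :: "'d::unital_cstar_algebra set"
    and Y :: "('c, 'y, 'd) bimodule"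
    and X Z :: "'y set"
    and E\<^sub>A E\<^sub>P :: "'c \<Rightarrow> 'c" and E\<^sub>B E\<^sub>Q :: "'d \<Rightarrow> 'd" and E\<^sub>X E\<^sub>Z :: "'y \<Rightarrow> 'y"
    and p :: 'c and q :: 'd
  assumes "strongly_Morita_equivalent A B Y X"
    and "conditional_expectation A E\<^sub>A" and "index_finite UNIV E\<^sub>A" and "Ind_W UNIV E\<^sub>A \<in> A"
    and "conditional_expectation B E\<^sub>B" and "index_finite UNIV E\<^sub>B" and "Ind_W UNIV E\<^sub>B \<in> B"
    and "bimodule_expectation A B Y X E\<^sub>A E\<^sub>B E\<^sub>X"
    and "full_projection p" and "E\<^sub>A p = cinverse (Ind_W UNIV E\<^sub>A)"
    and "full_projection q" and "E\<^sub>B q = cinverse (Ind_W UNIV E\<^sub>B)"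
    and "P = {a \<in> A. p * a = a * p}" and "Q = {b \<in> B. q * b = b * q}"
    and "\<And>a. a \<in> A \<Longrightarrow> E\<^sub>P a = Ind_W UNIV E\<^sub>A * E\<^sub>A (p * a * p)"
    and "\<And>b. b \<in> B \<Longrightarrow> E\<^sub>Q b = Ind_W UNIV E\<^sub>B * E\<^sub>B (q * b * q)"
    and "Z = {x \<in> X. lact Y p x = ract Y x q}"
    and "\<And>x. x \<in> X \<Longrightarrow> E\<^sub>Z x = lact Y (Ind_W UNIV E\<^sub>A) (E\<^sub>X (ract Y (lact Y p x) q))"
  shows "\<exists>\<theta> F.
    bimodule_isomorphism Y (upward_construction A p E\<^sub>P Y Z B q E\<^sub>Q) \<theta> \<and>
    (\<forall>ss ts. quasi_basis A E\<^sub>P ss \<and> quasi_basis B E\<^sub>Q ts \<longrightarrow>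
       (\<forall>x\<in>X. \<theta> x = upward_embedding A p E\<^sub>P Y Z B q E\<^sub>Q E\<^sub>Z ss ts x)) \<and>
    dual_expectation A p E\<^sub>P Y X Z B q E\<^sub>Q F \<and>
    (\<forall>y\<in>bcarrier Y. E\<^sub>X y = F (\<theta> y))"
proof -
  have sub: "unital_cstar_subalgebra A" "unital_cstar_subalgebra B"
    using assms(1) by (simp_all add: strongly_Morita_equivalent_def)
  interpret downward_construction A E\<^sub>A p E\<^sub>P B E\<^sub>B q E\<^sub>Q Y X Z E\<^sub>X E\<^sub>Z
    by unfold_locales (assumption | rule assms sub)+
  show ?thesis
    using isomorphism embedding_eq dual_expectation_dual_exp dual_exp_cls
    by (intro exI[of _ T2.cls] exI[of _ dual_exp]) simp
qed

end
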